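(* Let $n\ge 4$ and let $K$ be a centrally-symmetric convex body in $\mathbb{R}^n$. For $a\in\{2,3\}$, let $K_a$ be the star-body whose radial function is $\rho_{K_a}=\rho_K^{1/(n-a)}$. Then $K_a$ is an $(n-a)$-Busemann-Petty body. Consequently, for every centrally-symmetric star-body $L\subset\mathbb{R}^n$ satisfying $\mathrm{Vol}(K_a\cap H)\le \mathrm{Vol}(L\cap H)$ for all $H\in G(n,a)$, one has $\mathrm{Vol}(K_a)\le\mathrm{Vol}(L)$.
   Context: All bodies are centrally-symmetric star-bodies $K\subset\mathbb{R}^n$, determined by a continuous radial function $\rho_K(\theta)=\max\{r\ge0: r\theta\in K\}$, $\theta\in S^{n-1}$. $G(n,m)$ is the Grassmannian of $m$-dimensional linear subspaces of $\mathbb{R}^n$, and $\mathrm{Vol}$ denotes Lebesgue measure in the affine hull. The $m$-dimensional spherical Radon transform $R_m:C(S^{n-1})\to C(G(n,m))$ is $R_m(f)(E)=\int_{S^{n-1}\cap E}f\,d\sigma_m$, where $\sigma_m$ is the Haar probability measure on the sphere $S^{n-1}\cap E$. Its dual $R_m^*$ maps signed Borel measures on $G(n,m)$ to signed Borel measures on $S^{n-1}$ via $\int_{S^{n-1}} f\,R_m^*(d\mu)=\int_{G(n,m)}R_m(f)\,d\mu$ for all $f\in C(S^{n-1})$. A star-body $K$ is called a $k$-Busemann-Petty body ($1\le k\le n-1$) if $\rho_K^k\,d\theta = R_{n-k}^*(d\mu)$ as measures on $S^{n-1}$ for some non-negative Borel measure $\mu$ on $G(n,n-k)$ (here $\rho_K^k$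 is identified with the measure having that density with respect to the normalized Haar measure on $S^{n-1}$). *)

theory Defs
  imports "HOL-Analysis.Analysis" "HOL-Probability.Probability"
begin

definition radial :: "(real^'n) set \<Rightarrow> real^'n \<Rightarrow> real" where
  "radial K \<theta> = Sup {r. 0 \<le> r \<and> r *\<^sub>R \<theta> \<in> K}"

definition star_body :: "(real^'n) set \<Rightarrow> bool" where
  "star_body K \<longleftrightarrow> 0 \<in> K \<and> compact K \<and> (\<forall>x\<in>K. \<forall>t\<in>{0..1}. t *\<^sub>R x \<in> K)
     \<and> uminus ` K = K \<and> continuous_on (sphere 0 1) (radial K)"

definition star_of :: "(real^'n \<Rightarrow> real) \<Rightarrow> (real^'n) set" where
  "star_of \<rho> = {r *\<^sub>R \<theta> | r \<theta>. \<theta> \<in> sphere 0 1 \<and> 0 \<le> r \<and> r \<le> \<rho> \<theta>}"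

definition grass :: "nat \<Rightarrow> (real^'n) set set" where
  "grass m = {E. subspace E \<and> dim E = m}"

definition onb :: "(real^'n) set \<Rightarrow> (nat \<Rightarrow> real^'n) \<Rightarrow> bool" where
  "onb E b \<longleftrightarrow> (\<forall>i<dim E. b i \<in> E) \<and>
     (\<forall>i<dim E. \<forall>j<dim E. b i \<bullet> b j = (if i = j then 1 else 0))"

definition coords :: "(real^'n) set \<Rightarrow> (nat \<Rightarrow> real) \<Rightarrow> real^'n" where
  "coords E c = (\<Sum>i<dim E. c i *\<^sub>R (SOME b. onb E b) i)"

definition leb_dim :: "nat \<Rightarrow> (nat \<Rightarrow> real) measure" where
  "leb_dim m = (\<Pi>\<^sub>M i\<in>{..<m}. lborel)"

definition sub_vol :: "(real^'n) set \<Rightarrow> (real^'n) set \<Rightarrow> real" where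
  "sub_vol E S = measure (leb_dim (dim E))
      {c \<in> space (leb_dim (dim E)). coords E c \<in> S}"

text \<open>Normalized (Haar probability) measure on the sphere S^{n-1} \<inter> E: the image of the
  uniform distribution on the unit ball of E under radial projection.\<close>
definition sphere_measure :: "(real^'n) set \<Rightarrow> (real^'n) measure" where
  "sphere_measure E = distr
      (uniform_measure (leb_dim (dim E))
         {c \<in> space (leb_dim (dim E)). (\<Sum>i<dim E. (c i)\<^sup>2) \<le> 1})
      borel (\<lambda>c. sgn (coords E c))"

definition radon :: "(real^'n \<Rightarrow> real) \<Rightarrow> (real^'n) set \<Rightarrow> real" where
  "radon f E = integral\<^sup>L (sphere_measure E) f"

text \<open>G(n,m) is identified (homeomorphically) with the orthogonal projection matrices of rank m;
  Borel measures on G(n,m) are Borel measures on the matrices concentrated on this closed set.\<close>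
definition proj_grass :: "nat \<Rightarrow> (real^'n^'n) set" where
  "proj_grass m = {P. P ** P = P \<and> transpose P = P \<and> dim (range (\<lambda>x. P *v x)) = m}"

text \<open>k-Busemann-Petty body: rho_K^k d\<theta> = R_{n-k}^*(d\<mu>), \<mu> \<ge> 0 Borel on G(n,n-k).\<close>
definition bp_body :: "nat \<Rightarrow> (real^'n) set \<Rightarrow> bool" where
  "bp_body k K \<longleftrightarrow> star_body K \<and> 1 \<le> k \<and> k \<le> CARD('n) - 1 \<and>
     (\<exists>\<mu> :: (real^'n^'n) measure.
        sets \<mu> = sets borel \<and> finite_measure \<mu> \<and>
        (AE P in \<mu>. P \<in> proj_grass (CARD('n) - k)) \<and>
        (\<forall>f. continuous_on (sphere 0 1) f \<longrightarrow>
           (\<integral>\<theta>. f \<theta> * (radial K \<theta>) ^ k \<partial>sphere_measure (UNIV :: (real^'n) set)) =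
           (LINT P:proj_grass (CARD('n) - k)|\<mu>. radon f (range (\<lambda>x. P *v x)))))"

end

(* Let b1, ..., b4 be orthonormal and let Q be a random orthogonal matrix. By Brunn's theorem the section
   of K by Q span(b1,b2,b3) has at least the volume of the parallel section at height t; let w_t(Q) >= 0
   be the difference of the two volumes. For every f, rotations fixing b1 show that E[f(Q b1) 1_K(Q v)]
   depends on v only through its component x along b1 and its distance s from the line R b1. A point of
   the shifted section with transversal coordinate z in R^2 has s^2 = |z|^2 + t^2, and in R^2 adding t^2
   to |z|^2 amounts to removing the disc |z| < t. Hence E[f(Q b1) w_t(Q)] is the average of f(Q b1) times
   the volume of the part of Q^{-1} K in the cylinder |z| < t, which divided by 2 pi t^2 converges to
   E[f(Q b1) rho_K(Q b1)], the integral of f rho_K over the sphere. By invariance b1 may be replaced by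
   any unit vector of span(b1,b2,b3), so on the left f may be averaged over the unit sphere of span(b1,b2)
   or of span(b1,b2,b3), that is, replaced by its Radon transform at Q span. A weak limit of the measures
   w_t dQ / (2 pi t^2) then represents rho_K as R_a^* mu, a = 2, 3. The comparison of volumes follows from
   this representation, polar coordinates and Young's inequality. *)

theory Submission
  imports Defs
begin

section \<open>Weak compactness of probability measures on a compact set\<close>

text \<open>The weights \<open>w_t / t^2\<close> are difference quotients of the parallel section
  function and formally tend to minus half its second derivative at 0. For a general convex body
  that derivative need not exist, so the quotients stay densities of positive measures and only a
  weak limit is taken. Two constraints meet in the number 3. A section needs an axis on which f is
  evaluated and a transversal plane, because the volume of a ball is linear in its squared radius
  exactly in dimension 2. The sphere over which f is averaged must lie in the span of the section.
  Hence a is at most 3 and, with the direction of the shift, n is at least 4. The measures live on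
  orthogonal matrices, a compact set in a Euclidean space, and reach the Grassmannian only at the
  end, through the continuous map from a frame to the projection onto its span. The same compactness
  theorem produces Haar measure. It rests on the selection theorem for tight sequences of measures
  on the line, to which Schoenberg's space-filling curve gives access.\<close>

definition schoenberg_step :: "real \<Rightarrow> real" where
  "schoenberg_step t = max 0 (min 1 (1/2 - cos (pi * t)))"

text \<open>Coordinate \<open>j\<close> of Schoenberg's curve: it reads the ternary digits of
  \<open>t\<close> at the positions \<open>prod_encode (k, j)\<close> as the binary digits of its
  value. The pairing splits one digit sequence into infinitely many independent ones.\<close>

definition schoenberg :: "nat \<Rightarrow> real \<Rightarrow> real" where
  "schoenberg j t = (\<Sum>k. schoenberg_step (3 ^ prod_encode (k, j) * t) / 2 ^ Suc k)"

lemma schoenberg_step_bounds: "0 \<le> schoenberg_step t" "schoenberg_step t \<le> 1"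
  by (auto simp: schoenberg_step_def)

lemma continuous_on_schoenberg_step: "continuous_on UNIV schoenberg_step"
  unfolding schoenberg_step_def by (intro continuous_intros)

text \<open>The step function has period 2 and plateaus 0 on [0, 1/3] and 1 on [2/3, 1], where
  \<open>1/2 - cos (pi * t)\<close> has left the interval (0, 1). An error \<open>r\<close> of at
  most 1/3, the size of a tail of ternary digits, is therefore invisible.\<close>

lemma schoenberg_step_even_plus:
  fixes m :: int
  assumes "d \<in> {0, 1::real}" and "0 \<le> r" "r \<le> 1/3"
  shows "schoenberg_step (2 * of_int m + (2 * d / 3 + r)) = d"
proof -
  have 1: "cos (pi * (2 * of_int m + (2 * d / 3 + r))) = cos (pi * (2 * d / 3 + r))"
  proof -
    have "pi * (2 * of_int m + (2 * d / 3 + r)) = pi * (2 * d / 3 + r) + 2 * pi * of_int m"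
      by (simp add: algebra_simps)
    then show ?thesis by (simp add: cos_add)
  qed
  show ?thesis
  proof (cases "d = 0")
    case True
    have "cos (pi / 3) \<le> cos (pi * r)"
      using assms by (intro cos_monotone_0_pi_le) (auto simp: field_simps)
    then show ?thesis using 1 True by (simp add: schoenberg_step_def cos_60)
  next
    case False
    then have d: "d = 1" using assms by auto
    have "cos (pi * (2 / 3 + r)) \<le> cos (2 * pi / 3)"
      using assms by (intro cos_monotone_0_pi_le) (auto simp: field_simps)
    also have "\<dots> = - 1/2" by (rule cos_120)
    finally show ?thesis using 1 d by (simp add: schoenberg_step_def)
  qed
qed

lemma geometric_scaled:
  fixes r c :: real
  assumes "\<bar>r\<bar> < 1"
  shows "(\<lambda>i. c * r ^ i) sums (c / (1 - r))"
  using sums_mult[OF geometric_sums[of r], of c] assms by simp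

text \<open>After multiplication by \<open>3 ^ k\<close> the digits before position \<open>k\<close>
  form an even integer, since every digit is 0 or 2, and those after it a remainder in [0, 1/3].
  Periodicity removes the former and the plateaus absorb the latter.\<close>

lemma schoenberg_step_ternary:
  assumes d: "\<And>i. d i \<in> {0, 1::real}"
  shows "schoenberg_step (3 ^ k * (\<Sum>i. 2 * d i / 3 ^ Suc i)) = d k"
proof -
  define c where "c i = 2 * d i / 3 ^ Suc i" for i
  have d01: "0 \<le> d i" "d i \<le> 1" for i using d[of i] by auto
  have geo: "summable (\<lambda>i. (2/9) * (1/3::real) ^ i)" "(\<Sum>i. (2/9) * (1/3::real) ^ i) = 1/3"
    using geometric_scaled[of "1/3" "2/9"] by (simp_all add: sums_iff)
  have sc: "summable c"
  proof (rule summable_comparison_test')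
    show "summable (\<lambda>i. (2/3) * (1/3::real) ^ i)" by (intro summable_mult summable_geometric) simp
    show "norm (c i) \<le> (2/3) * (1/3) ^ i" for i
      using d01[of i] by (simp add: c_def power_divide field_simps)
  qed
  define r where "r = 3 ^ k * (\<Sum>i. c (i + Suc k))"
  have tail: "3 ^ k * c (i + Suc k) = 2 * d (i + Suc k) / 9 * (1/3) ^ i" for i
    by (simp add: c_def power_divide power_add field_simps)
  have sct: "summable (\<lambda>i. 3 ^ k * c (i + Suc k))"
    using sc by (intro summable_mult summable_ignore_initial_segment) 
  have r_eq: "r = (\<Sum>i. 3 ^ k * c (i + Suc k))"
    unfolding r_def using sc by (intro suminf_mult[symmetric] summable_ignore_initial_segment)
  have r0: "0 \<le> r" unfolding r_eq using sct d01 by (intro suminf_nonneg) (auto simp only: tail intro!: mult_nonneg_nonneg divide_nonneg_nonneg zero_le_power)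
  have "r \<le> (\<Sum>i. (2/9) * (1/3::real) ^ i)"
    unfolding r_eq
  proof (rule suminf_le[OF _ sct geo(1)])
    show "3 ^ k * c (i + Suc k) \<le> (2/9) * (1/3::real) ^ i" for i
      unfolding tail using d01[of "i + Suc k"] by (intro mult_right_mono) simp_all
  qed
  then have r1: "r \<le> 1/3" using geo by simp
  define m where "m = (\<Sum>i<k. (if d i = 1 then 1 else 0) * 3 ^ (k - Suc i) :: int)"
  have "(\<Sum>i<k. 3 ^ k * c i) = 2 * of_int m"
    unfolding m_def of_int_sum sum_distrib_left
  proof (rule sum.cong)
    fix i assume "i \<in> {..<k}"
    then have "(3::real) ^ k = 3 ^ (k - Suc i) * 3 ^ Suc i"
      by (subst power_add[symmetric]) simp
    then show "3 ^ k * c i = 2 * of_int ((if d i = 1 then 1 else 0) * 3 ^ (k - Suc i))"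
      using d[of i] by (auto simp: c_def field_simps)
  qed simp
  moreover have "3 ^ k * c k = 2 * d k / 3" by (simp add: c_def)
  ultimately have "3 ^ k * (\<Sum>i<Suc k. c i) = 2 * of_int m + 2 * d k / 3"
    by (simp only: sum.lessThan_Suc distrib_left sum_distrib_left)
  then have "3 ^ k * suminf c = 2 * of_int m + (2 * d k / 3 + r)"
    using suminf_split_initial_segment[OF sc, of "Suc k"] by (simp add: r_def algebra_simps)
  then show ?thesis
    using schoenberg_step_even_plus[OF d[of k] r0 r1, of m] by (simp add: c_def[abs_def])
qed

lemma binary_expansion:
  fixes x :: real
  assumes "0 \<le> x" "x < 1"
  obtains d where "\<And>k. d k \<in> {0, 1::real}" "(\<lambda>k. d k / 2 ^ Suc k) sums x"
proof
  define d where "d k = real_of_int (\<lfloor>2 ^ Suc k * x\<rfloor> - 2 * \<lfloor>2 ^ k * x\<rfloor>)" for k :: nat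
  show "d k \<in> {0, 1}" for k
  proof -
    have "\<lfloor>2 * (2 ^ k * x)\<rfloor> - 2 * \<lfloor>2 ^ k * x\<rfloor> \<in> {0, 1}"
      by (simp; linarith)
    then show ?thesis by (auto simp: d_def mult.assoc)
  qed
  \<comment> \<open>The digits are differences of consecutive scaled floors, so the partial sums
    telescope; the floor of \<open>x\<close> itself is 0 because \<open>x < 1\<close>.\<close>
  have part: "(\<Sum>k<m. d k / 2 ^ Suc k) = \<lfloor>2 ^ m * x\<rfloor> / 2 ^ m" for m
  proof (induction m)
    case 0
    then show ?case using assms by (simp add: floor_eq_iff)
  next
    case (Suc m)
    then show ?case by (simp add: d_def field_simps)
  qed
  have "(\<lambda>m. \<lfloor>2 ^ m * x\<rfloor> / 2 ^ m) \<longlonglongrightarrow> x"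
  proof (rule tendsto_sandwich)
    show "\<forall>\<^sub>F m in sequentially. x - (1/2) ^ m \<le> \<lfloor>2 ^ m * x\<rfloor> / 2 ^ m"
    proof (intro always_eventually allI)
      fix m :: nat
      have "2 ^ m * x - 1 \<le> \<lfloor>2 ^ m * x\<rfloor>" by linarith
      then have "(2 ^ m * x - 1) / 2 ^ m \<le> \<lfloor>2 ^ m * x\<rfloor> / 2 ^ m" by (rule divide_right_mono) simp
      then show "x - (1/2) ^ m \<le> \<lfloor>2 ^ m * x\<rfloor> / 2 ^ m"
        by (simp add: diff_divide_distrib power_divide)
    qed
    show "\<forall>\<^sub>F m in sequentially. \<lfloor>2 ^ m * x\<rfloor> / 2 ^ m \<le> x"
    proof (intro always_eventually allI)
      fix m :: nat
      have "\<lfloor>2 ^ m * x\<rfloor> \<le> 2 ^ m * x" by linarith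
      then show "\<lfloor>2 ^ m * x\<rfloor> / 2 ^ m \<le> x" by (simp add: field_simps)
    qed
    have "(\<lambda>m. x - (1/2) ^ m) \<longlonglongrightarrow> x - 0" by (intro tendsto_intros LIMSEQ_power_zero) simp
    then show "(\<lambda>m. x - (1/2) ^ m) \<longlonglongrightarrow> x" by simp
  qed simp
  then show "(\<lambda>k. d k / 2 ^ Suc k) sums x"
    unfolding sums_def part .
qed

lemma
  shows continuous_on_schoenberg: "continuous_on UNIV (schoenberg j)"
    and schoenberg_bounds: "0 \<le> schoenberg j t" "schoenberg j t \<le> 1"
proof -
  have geo: "summable (\<lambda>k. (1/2) * (1/2::real) ^ k)" "(\<Sum>k. (1/2) * (1/2::real) ^ k) = 1"
    using geometric_scaled[of "1/2" "1/2"] by (simp_all add: sums_iff)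
  have bd: "norm (schoenberg_step (3 ^ prod_encode (k, j) * t) / 2 ^ Suc k) \<le> (1/2) * (1/2::real) ^ k" for k t
    using schoenberg_step_bounds[of "3 ^ prod_encode (k, j) * t"] by (simp add: power_divide field_simps)
  have sm: "summable (\<lambda>k. schoenberg_step (3 ^ prod_encode (k, j) * t) / 2 ^ Suc k)"
    by (rule summable_comparison_test'[OF geo(1) bd])
  show "0 \<le> schoenberg j t"
    unfolding schoenberg_def using sm schoenberg_step_bounds by (intro suminf_nonneg) auto
  have "schoenberg j t \<le> (\<Sum>k. (1/2) * (1/2::real) ^ k)"
    unfolding schoenberg_def
    using sm geo(1) bd[unfolded real_norm_def, THEN abs_le_D1] by (intro suminf_le)
  then show "schoenberg j t \<le> 1" using geo by simp
  have "uniform_limit UNIV (\<lambda>n t. \<Sum>k<n. schoenberg_step (3 ^ prod_encode (k, j) * t) / 2 ^ Suc k)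
      (\<lambda>t. \<Sum>k. schoenberg_step (3 ^ prod_encode (k, j) * t) / 2 ^ Suc k) sequentially"
    by (rule Weierstrass_m_test[OF bd geo(1)])
  then have "continuous_on UNIV (\<lambda>t. \<Sum>k. schoenberg_step (3 ^ prod_encode (k, j) * t) / 2 ^ Suc k)"
    by (rule uniform_limit_theorem[rotated])
       (auto intro!: always_eventually continuous_intros continuous_on_compose2[OF continuous_on_schoenberg_step])
  then show "continuous_on UNIV (schoenberg j)" by (simp add: schoenberg_def[abs_def])
qed

text \<open>The binary digits of all \<open>x j\<close> are interleaved into the ternary digits, 0
  or 2, of a single \<open>t\<close>, so that all coordinates take their prescribed values at
  once.\<close>

lemma schoenberg_surj:
  fixes x :: "nat \<Rightarrow> real"
  assumes "\<And>j. 0 \<le> x j" "\<And>j. x j < 1"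
  obtains t where "t \<in> {0..1}" "\<And>j. schoenberg j t = x j"
proof -
  have "\<forall>j. \<exists>d. (\<forall>k. d k \<in> {0, 1::real}) \<and> (\<lambda>k. d k / 2 ^ Suc k) sums x j"
    using binary_expansion assms by metis
  then obtain D where D: "\<And>j k. D j k \<in> {0, 1::real}" "\<And>j. (\<lambda>k. D j k / 2 ^ Suc k) sums x j"
    by metis
  define d where "d i = (case prod_decode i of (k, j) \<Rightarrow> D j k)" for i
  have d: "d i \<in> {0, 1}" for i unfolding d_def using D(1) by (auto split: prod.split)
  define t where "t = (\<Sum>i. 2 * d i / 3 ^ Suc i)"
  have geo: "summable (\<lambda>i. (2/3) * (1/3::real) ^ i)" "(\<Sum>i. (2/3) * (1/3::real) ^ i) = 1"
    using geometric_scaled[of "1/3" "2/3"] by (simp_all add: sums_iff)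
  have d01: "0 \<le> d i" "d i \<le> 1" for i using d[of i] by auto
  have bd: "norm (2 * d i / 3 ^ Suc i) \<le> (2/3) * (1/3::real) ^ i" for i
    using d01[of i] by (simp add: power_divide field_simps)
  have sm: "summable (\<lambda>i. 2 * d i / 3 ^ Suc i)"
    by (rule summable_comparison_test'[OF geo(1) bd])
  have "0 \<le> t" unfolding t_def using sm d01 by (intro suminf_nonneg) auto
  moreover have "t \<le> (\<Sum>i. (2/3) * (1/3::real) ^ i)"
    unfolding t_def
    using sm geo(1) bd[unfolded real_norm_def, THEN abs_le_D1] by (intro suminf_le)
  moreover have "schoenberg j t = x j" for j
  proof -
    have "schoenberg_step (3 ^ prod_encode (k, j) * t) = D j k" for k
      unfolding t_def by (subst schoenberg_step_ternary[OF d]) (simp add: d_def)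
    then show ?thesis
      unfolding schoenberg_def using D(2)[of j] by (simp add: sums_iff)
  qed
  ultimately show ?thesis using that[of t] geo by simp
qed

lemma compact_subset_space_filling_curve:
  fixes S :: "'a::euclidean_space set"
  assumes "compact S"
  obtains g :: "real \<Rightarrow> 'a"
  where "continuous_on UNIV g" "bounded (range g)" "S \<subseteq> g ` {0..1}"
proof -
  obtain R where R: "R > 0" "\<And>x. x \<in> S \<Longrightarrow> norm x \<le> R"
    using compact_imp_bounded[OF assms] by (auto simp: bounded_pos)
  define e :: "'a \<Rightarrow> nat" where "e = to_nat_on Basis"
  have inj: "inj_on e Basis" unfolding e_def by (intro inj_on_to_nat_on countable_finite) simp
  \<comment> \<open>Each coordinate sweeps [-R, 3R] instead of [-R, R]: the points of
    \<open>S\<close> then correspond to values of \<open>schoenberg\<close> of at most 1/2, and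
    \<open>schoenberg_surj\<close> asks for values strictly below 1.\<close>
  define g where "g t = (\<Sum>b\<in>Basis. (4 * R * schoenberg (e b) t - R) *\<^sub>R (b::'a))" for t
  show ?thesis
  proof
    show "continuous_on UNIV g"
      unfolding g_def
      by (intro continuous_intros continuous_on_compose2[OF continuous_on_schoenberg]) auto
    have "norm (g t) \<le> (\<Sum>b\<in>(Basis::'a set). 3 * R)" for t
      unfolding g_def
    proof (rule sum_norm_le)
      fix b :: 'a assume "b \<in> Basis"
      have "0 \<le> R * schoenberg (e b) t" "R * schoenberg (e b) t \<le> R * 1"
        using schoenberg_bounds R(1) by (auto intro!: mult_left_mono mult_nonneg_nonneg)
      then have "\<bar>4 * R * schoenberg (e b) t - R\<bar> \<le> 3 * R"
        by (simp add: abs_le_iff)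
      then show "norm ((4 * R * schoenberg (e b) t - R) *\<^sub>R b) \<le> 3 * R"
        using \<open>b \<in> Basis\<close> by simp
    qed
    then show "bounded (range g)" by (auto simp: bounded_iff)
    show "S \<subseteq> g ` {0..1}"
    proof
      fix x assume x: "x \<in> S"
      define y where "y j = (if \<exists>b\<in>Basis. e b = j then (x \<bullet> (THE b. b \<in> Basis \<and> e b = j) + R) / (4 * R) else 0)" for j
      have y: "y (e b) = (x \<bullet> b + R) / (4 * R)" if "b \<in> Basis" for b
      proof -
        have "(THE b'. b' \<in> Basis \<and> e b' = e b) = b"
          using that inj by (auto simp: inj_on_def)
        then show ?thesis using that by (auto simp: y_def)
      qed
      have bd: "0 \<le> y (e b) \<and> y (e b) < 1" if "b \<in> Basis" for b
      proof -
        have "\<bar>x \<bullet> b\<bar> \<le> R" using Basis_le_norm[OF that, of x] R(2)[OF x] by linarith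
        then show ?thesis using R(1) by (simp add: y[OF that] field_simps) linarith
      qed
      have "0 \<le> y j \<and> y j < 1" for j
      proof (cases "\<exists>b\<in>Basis. e b = j")
        case True
        then show ?thesis using bd by metis
      next
        case False
        then show ?thesis by (simp add: y_def)
      qed
      then obtain t where t: "t \<in> {0..1}" "\<And>j. schoenberg j t = y j"
        using schoenberg_surj[of y] by metis
      have "g t = (\<Sum>b\<in>Basis. (x \<bullet> b) *\<^sub>R b)"
        unfolding g_def using R(1) by (intro sum.cong) (auto simp: t y)
      then show "x \<in> g ` {0..1}" using t by (auto simp: euclidean_representation)
    qed
  qed
qed

text \<open>A space filling curve and a Borel section of it reduce the statement to measures on the line.\<close>

theorem weakly_convergent_subsequence_on_compact:
  fixes M :: "nat \<Rightarrow> 'a::euclidean_space measure"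
  assumes S: "compact S" and pM: "\<And>n. prob_space (M n)" and sM: "\<And>n. sets (M n) = sets borel"
    and AM: "\<And>n. AE x in M n. x \<in> S"
  obtains r N where "strict_mono (r :: nat \<Rightarrow> nat)" "prob_space N" "sets N = sets borel" "AE x in N. x \<in> S"
    "\<And>\<phi> :: 'a \<Rightarrow> real. continuous_on UNIV \<phi> \<Longrightarrow> (\<lambda>n. integral\<^sup>L (M (r n)) \<phi>) \<longlonglongrightarrow> integral\<^sup>L N \<phi>"
proof -
  obtain g where g: "continuous_on UNIV g" "bounded (range g)" "S \<subseteq> g ` {0..1::real}"
    using compact_subset_space_filling_curve[OF S] .
  define T where "T x = {0..1} \<inter> g -` {x}" for x
  define s where "s x = (if x \<in> S then Inf (T x) else 0)" for x
  have T: "Inf (T x) \<in> T x" if "x \<in> S" for x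
  proof (rule closed_contains_Inf)
    show "T x \<noteq> {}" using that g by (auto simp: T_def)
    show "bdd_below (T x)" by (auto simp: T_def)
    have "closed (g -` {x})" using continuous_closed_vimage[of "{x}" g] g(1)
      by (auto simp: continuous_on_eq_continuous_at)
    then show "closed (T x)" by (auto simp: T_def)
  qed
  have s01: "s x \<in> {0..1}" for x using T by (auto simp: s_def T_def)
  have gs: "g (s x) = x" if "x \<in> S" for x using T[OF that] that by (auto simp: s_def T_def)
  have Sb[measurable]: "S \<in> sets borel" using S by (simp add: compact_imp_closed borel_closed)
  have sm[measurable]: "s \<in> borel_measurable borel"
  proof (rule borel_measurableI_le)
    fix c :: real
    \<comment> \<open>The least parameter of \<open>x\<close> is at most \<open>c\<close> iff some
      parameter is, so within \<open>S\<close> the sublevel set is the image of a compact set of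
      parameters.\<close>
    have "{x \<in> space borel. s x \<le> c} = (S \<inter> g ` ({0..1} \<inter> {..c})) \<union> (if 0 \<le> c then - S else {})"
    proof -
      have "s x \<le> t" if "x = g t" "t \<in> {0..1}" "x \<in> S" for x t
        using that by (auto simp: s_def T_def intro!: cInf_lower)
      moreover have "x \<in> g ` ({0..1} \<inter> {..c})" if "s x \<le> c" "x \<in> S" for x
        using gs[OF that(2)] s01[of x] that by (intro image_eqI[of _ _ "s x"]) auto
      ultimately show ?thesis by (auto simp: s_def) (force)+
    qed
    moreover have "g ` ({0..1} \<inter> {..c}) \<in> sets borel"
      using g(1) by (intro borel_compact compact_continuous_image)
        (auto intro: continuous_on_subset)
    ultimately show "{x \<in> space borel. s x \<le> c} \<in> sets borel" by auto
  qed
  have gm[measurable]: "g \<in> borel_measurable borel" using g(1) by (rule borel_measurable_continuous_onI)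
  have sM'[measurable_cong]: "sets (M n) = sets borel" for n by (rule sM)
  define D where "D n = distr (M n) borel s" for n
  have D: "real_distribution (D n)" for n
    unfolding D_def real_distribution_def real_distribution_axioms_def
    using pM by (auto intro!: prob_space.prob_space_distr)
  have "tight D"
    unfolding tight_def
  proof (intro conjI allI impI)
    fix \<epsilon> :: real assume "\<epsilon> > 0"
    \<comment> \<open>The interval is open on the left, so it has to start below 0 to contain
      [0, 1], where all the \<open>D n\<close> live.\<close>
    have "measure (D n) {-1<..1} = 1" for n
    proof -
      have "s -` {-1<..1} \<inter> space (M n) = space (M n)" using s01 by force
      then show ?thesis using prob_space.prob_space[OF pM] by (simp add: D_def measure_distr)
    qed
    then show "\<exists>a b. a < b \<and> (\<forall>n. 1 - \<epsilon> < measure (D n) {a<..b})"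
      using \<open>\<epsilon> > 0\<close> by (intro exI[of _ "-1"] exI[of _ 1]) auto
  qed (rule D)
  from tight_imp_convergent_subsubsequence[OF this strict_mono_id]
  obtain r L where r: "strict_mono r" and L: "real_distribution L" and conv: "weak_conv_m (D \<circ> r) L"
    by (auto simp: o_def)
  interpret L: real_distribution L by fact
  define N where "N = distr L borel g"
  have pN: "prob_space N" unfolding N_def by (intro L.prob_space_distr) simp
  have sN[measurable_cong]: "sets N = sets borel" by (simp add: N_def)
  have lim: "(\<lambda>n. integral\<^sup>L (M (r n)) \<phi>) \<longlonglongrightarrow> integral\<^sup>L N \<phi>"
    if \<phi>: "continuous_on UNIV \<phi>" for \<phi> :: "'a \<Rightarrow> real"
  proof -
    have [measurable]: "\<phi> \<in> borel_measurable borel" using \<phi> by (rule borel_measurable_continuous_onI)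
    have "compact (\<phi> ` closure (range g))"
      using \<phi> g(2) by (intro compact_continuous_image) (auto intro: continuous_on_subset simp: compact_closure)
    then have "bounded (\<phi> ` closure (range g))" by (rule compact_imp_bounded)
    then obtain B where "\<forall>x\<in>closure (range g). norm (\<phi> x) \<le> B"
      by (auto simp only: bounded_iff ball_simps)
    then have B: "norm (\<phi> (g t)) \<le> B" for t
      using closure_subset[of "range g"] by (meson rangeI subsetD)
    have "(\<lambda>n. integral\<^sup>L ((D \<circ> r) n) (\<lambda>t. \<phi> (g t))) \<longlonglongrightarrow> integral\<^sup>L L (\<lambda>t. \<phi> (g t))"
    proof (rule weak_conv_imp_integral_bdd_continuous_conv[OF _ L conv _ B])
      show "real_distribution ((D \<circ> r) n)" for n using D by simp
      have "continuous_on UNIV (\<lambda>t. \<phi> (g t))"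
        using continuous_on_compose2[OF \<phi> g(1)] by simp
      then show "isCont (\<lambda>t. \<phi> (g t)) t" for t by (simp add: continuous_on_eq_continuous_at)
    qed
    moreover have "integral\<^sup>L (D n) (\<lambda>t. \<phi> (g t)) = integral\<^sup>L (M n) \<phi>" for n
    proof -
      have "integral\<^sup>L (D n) (\<lambda>t. \<phi> (g t)) = integral\<^sup>L (M n) (\<lambda>x. \<phi> (g (s x)))"
        unfolding D_def by (subst integral_distr) auto
      also have "\<dots> = integral\<^sup>L (M n) \<phi>"
        using AM[of n] by (intro integral_cong_AE) (auto simp: gs)
      finally show ?thesis .
    qed
    moreover have "integral\<^sup>L N \<phi> = integral\<^sup>L L (\<lambda>t. \<phi> (g t))"
      unfolding N_def by (subst integral_distr) auto
    ultimately show ?thesis by simp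
  qed
  have "AE x in N. x \<in> S"
  proof (cases "S = {}")
    case True
    then have "emeasure (M 0) (space (M 0)) = 0"
      using AM[of 0] by (simp add: eventually_False trivial_limit_def[symmetric] ae_filter_eq_bot_iff)
    then show ?thesis using prob_space.emeasure_space_1[OF pM[of 0]] by simp
  next
    case False
    \<comment> \<open>A bounded continuous function vanishing exactly on \<open>S\<close>: its
      integrals are 0 along the sequence, hence 0 in the limit.\<close>
    define \<phi> where "\<phi> x = min 1 (infdist x S)" for x
    have \<phi>c: "continuous_on UNIV \<phi>"
      unfolding \<phi>_def by (intro continuous_intros)
    have \<phi>m[measurable]: "\<phi> \<in> borel_measurable borel"
      using \<phi>c by (rule borel_measurable_continuous_onI)
    have \<phi>0: "\<phi> x = 0 \<longleftrightarrow> x \<in> S" for x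
      using in_closed_iff_infdist_zero[OF compact_imp_closed[OF S] False, of x]
      by (auto simp: \<phi>_def min_def)
    have "integral\<^sup>L (M n) \<phi> = 0" for n
      using AM[of n] by (intro integral_eq_zero_AE) (auto simp: \<phi>0)
    then have "integral\<^sup>L N \<phi> = 0" using lim[OF \<phi>c] by (simp add: LIMSEQ_const_iff)
    moreover have "integrable N \<phi>"
      using pN by (intro finite_measure.integrable_const_bound[of _ _ 1])
        (auto simp: \<phi>_def prob_space_def infdist_nonneg)
    moreover have "AE x in N. 0 \<le> \<phi> x" by (auto simp: \<phi>_def infdist_nonneg)
    ultimately have "AE x in N. \<phi> x = 0" by (simp add: integral_nonneg_eq_0_iff_AE)
    then show ?thesis by (simp add: \<phi>0)
  qed
  then show ?thesis using that r pN sN lim by blast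
qed

section \<open>Lebesgue measure and linear isometries\<close>

text \<open>Comparing \<open>\<mu> A \<cdot> \<lambda> B\<close> with \<open>\<lambda> A \<cdot> \<mu> B\<close> through Fubini's theorem, where \<open>\<mu>\<close> is the image measure and
  \<open>B\<close> is the unit ball.\<close>

lemma lborel_distr_linear_isometry:
  fixes f :: "'a::euclidean_space \<Rightarrow> 'b::euclidean_space"
  assumes lin: "linear f" and iso: "\<And>x. norm (f x) = norm x" and dim: "DIM('a) = DIM('b)"
  shows "distr lborel borel f = lborel"
proof -
  have [measurable]: "f \<in> borel_measurable borel"
    using lin by (intro borel_measurable_continuous_onI linear_continuous_on) (simp add: linear_conv_bounded_linear)
  define \<mu> where "\<mu> = distr lborel borel f"
  have [measurable_cong, simp]: "sets \<mu> = sets borel" and [simp]: "space \<mu> = UNIV" by (simp_all add: \<mu>_def)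
  have inj: "inj f"
    using iso lin by (simp add: linear_injective_0) (metis norm_eq_zero)
  have surj: "surj f"
    using lin inj dim linear_injective_imp_surjective[of f] by (simp add: dim)
  have trans: "distr \<mu> borel ((+) c) = \<mu>" for c
  proof -
    obtain a where a: "f a = c" using surj by (metis surjD)
    have "distr \<mu> borel ((+) c) = distr lborel borel (\<lambda>x. f (a + x))"
      unfolding \<mu>_def by (subst distr_distr) (auto simp: comp_def a linear_add[OF lin])
    also have "\<dots> = distr (distr lborel borel ((+) a)) borel f"
      by (subst distr_distr) (auto simp: comp_def)
    finally show ?thesis by (simp add: lborel_distr_plus \<mu>_def)
  qed
  have ball: "emeasure \<mu> (cball c 1) = emeasure lborel (cball (0::'b) 1)" for c
  proof -
    obtain a where a: "f a = c" using surj by (metis surjD)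
    have "f -` cball c 1 = cball a 1"
      using iso[of "a - x" for x] by (auto simp: dist_norm a linear_diff[OF lin])
    then show ?thesis
      by (simp add: \<mu>_def emeasure_distr emeasure_cball dim)
  qed
  have fin: "emeasure lborel (cball (0::'b) 1) \<noteq> \<infinity>" "emeasure lborel (cball (0::'b) 1) \<noteq> 0"
    using unit_ball_vol_pos[of "real DIM('b)"] by (simp_all add: emeasure_cball ennreal_eq_0_iff not_le)
  have sf: "sigma_finite_measure \<mu>"
  proof
    show "\<exists>A. countable A \<and> A \<subseteq> sets \<mu> \<and> \<Union>A = space \<mu> \<and> (\<forall>a\<in>A. emeasure \<mu> a \<noteq> \<infinity>)"
    proof (intro exI[of _ "range (\<lambda>n::nat. cball 0 (real n))"] conjI ballI)
      show "\<Union>(range (\<lambda>n::nat. cball 0 (real n))) = space \<mu>"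
        using real_arch_simple by (auto simp: dist_norm)
      fix A assume "A \<in> range (\<lambda>n::nat. cball (0::'b) (real n))"
      then obtain n where "A = cball 0 (real n)" by auto
      moreover have "f -` cball 0 (real n) = cball 0 (real n)" by (auto simp: iso)
      ultimately show "emeasure \<mu> A \<noteq> \<infinity>" by (simp add: \<mu>_def emeasure_distr emeasure_cball)
    qed auto
  qed
  interpret \<mu>: sigma_finite_measure \<mu> by (rule sf)
  interpret P: pair_sigma_finite \<mu> lborel by unfold_locales
  define B where "B = cball (0::'b) 1"
  have B[measurable]: "B \<in> sets borel" by (simp add: B_def)
  have finB: "emeasure lborel B \<noteq> \<infinity>" "emeasure lborel B \<noteq> 0" using fin by (simp_all add: B_def)
  have "\<mu> = lborel"
  proof (rule measure_eqI)
    fix A assume "A \<in> sets \<mu>"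
    then have [measurable]: "A \<in> sets borel" by simp
    have "emeasure \<mu> A * emeasure lborel B = (\<integral>\<^sup>+y. (\<integral>\<^sup>+x. indicator A x * indicator B y \<partial>\<mu>) \<partial>lborel)"
      by (simp add: nn_integral_multc nn_integral_cmult_indicator)
    also have "\<dots> = (\<integral>\<^sup>+y. (\<integral>\<^sup>+x. indicator A (y + x) * indicator B y \<partial>\<mu>) \<partial>lborel)"
    proof (rule nn_integral_cong)
      fix y :: 'b
      have "(\<integral>\<^sup>+x. indicator A x * indicator B y \<partial>\<mu>) = (\<integral>\<^sup>+x. indicator A x * indicator B y \<partial>distr \<mu> borel ((+) y))"
        by (simp only: trans)
      then show "(\<integral>\<^sup>+x. indicator A x * indicator B y \<partial>\<mu>) = (\<integral>\<^sup>+x. indicator A (y + x) * indicator B y \<partial>\<mu>)"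
        by (subst (asm) nn_integral_distr) auto
    qed
    also have "\<dots> = (\<integral>\<^sup>+x. (\<integral>\<^sup>+y. indicator A (y + x) * indicator B y \<partial>lborel) \<partial>\<mu>)"
      by (rule P.Fubini') measurable
    \<comment> \<open>Translating \<open>y\<close> by \<open>- x\<close> moves the shift from
      \<open>A\<close> to \<open>B\<close>. Read as a condition on \<open>x\<close>, membership of
      \<open>y - x\<close> in \<open>B\<close> says that \<open>x\<close> lies in the unit ball
      about \<open>y\<close>, whose \<open>\<mu>\<close>-measure does not depend on
      \<open>y\<close>.\<close>
    also have "\<dots> = (\<integral>\<^sup>+x. (\<integral>\<^sup>+y. indicator A y * indicator B (y - x) \<partial>lborel) \<partial>\<mu>)"
    proof (rule nn_integral_cong)
      fix x :: 'b
      have "(\<integral>\<^sup>+y. indicator A y * indicator B (y - x) \<partial>lborel)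
        = (\<integral>\<^sup>+y. indicator A y * indicator B (y - x) \<partial>distr lborel borel ((+) x))"
        by (simp add: lborel_distr_plus)
      also have "\<dots> = (\<integral>\<^sup>+y. indicator A (y + x) * indicator B y \<partial>lborel)"
        by (subst nn_integral_distr) (auto simp: add.commute)
      finally show "(\<integral>\<^sup>+y. indicator A (y + x) * indicator B y \<partial>lborel) =
        (\<integral>\<^sup>+y. indicator A y * indicator B (y - x) \<partial>lborel)" by simp
    qed
    also have "\<dots> = (\<integral>\<^sup>+y. (\<integral>\<^sup>+x. indicator A y * indicator B (y - x) \<partial>\<mu>) \<partial>lborel)"
      by (rule P.Fubini'[symmetric]) measurable
    also have "\<dots> = (\<integral>\<^sup>+y. (\<integral>\<^sup>+x. indicator A y * indicator (cball y 1) x \<partial>\<mu>) \<partial>lborel)"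
      by (intro nn_integral_cong arg_cong2[where f="(*)"]) (auto simp: indicator_def dist_norm norm_minus_commute B_def)
    also have "\<dots> = (\<integral>\<^sup>+y. indicator A y * emeasure lborel B \<partial>lborel)"
      by (intro nn_integral_cong) (simp add: nn_integral_cmult_indicator ball B_def)
    also have "\<dots> = emeasure lborel A * emeasure lborel B"
      by (simp add: nn_integral_multc)
    finally show "emeasure \<mu> A = emeasure lborel A"
      using finB by (simp add: mult.commute[of _ "emeasure lborel B"] ennreal_mult_cancel_left)
  qed simp
  then show ?thesis by (simp add: \<mu>_def)
qed


section \<open>Coordinates on linear subspaces\<close>

lemma lborel_eq_distr_leb_dim:
  fixes e :: "nat \<Rightarrow> 'a::euclidean_space"
  assumes e: "bij_betw e {..<m} Basis"
  shows "distr (leb_dim m) borel (\<lambda>c. \<Sum>i<m. c i *\<^sub>R e i) = (lborel :: 'a measure)"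
proof (rule lborel_eqI[symmetric])
  interpret product_sigma_finite "\<lambda>_::nat. lborel :: real measure" by unfold_locales
  let ?\<phi> = "\<lambda>c. \<Sum>i<m. c i *\<^sub>R e i"
  have [measurable]: "?\<phi> \<in> borel_measurable (leb_dim m)"
    unfolding leb_dim_def by measurable
  have eB: "e i \<in> Basis" if "i < m" for i using e that by (auto simp: bij_betw_def)
  have comp: "?\<phi> c \<bullet> e i = c i" if "i < m" for i c
  proof -
    have "?\<phi> c \<bullet> e i = (\<Sum>j<m. if j = i then c j else 0)"
      unfolding inner_sum_left
    proof (intro sum.cong refl)
      fix j assume "j \<in> {..<m}"
      then have "e j = e i \<longleftrightarrow> j = i" using e that by (auto simp: bij_betw_def inj_on_def)
      then show "(c j *\<^sub>R e j) \<bullet> e i = (if j = i then c j else 0)"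
        using eB \<open>j \<in> {..<m}\<close> that by (auto simp: inner_Basis)
    qed
    then show ?thesis using that by simp
  qed
  fix l u :: 'a assume lu: "\<And>b. b \<in> Basis \<Longrightarrow> l \<bullet> b \<le> u \<bullet> b"
  have "?\<phi> -` box l u \<inter> space (leb_dim m) = PiE {..<m} (\<lambda>i. {l \<bullet> e i <..< u \<bullet> e i})"
  proof -
    have "?\<phi> c \<in> box l u \<longleftrightarrow> (\<forall>i<m. c i \<in> {l \<bullet> e i <..< u \<bullet> e i})" for c
    proof -
      have "?\<phi> c \<in> box l u \<longleftrightarrow> (\<forall>b\<in>e ` {..<m}. l \<bullet> b < ?\<phi> c \<bullet> b \<and> ?\<phi> c \<bullet> b < u \<bullet> b)"
        using e by (simp add: mem_box bij_betw_def)
      then show ?thesis by (auto simp: comp)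
    qed
    then show ?thesis by (auto simp: leb_dim_def space_PiM PiE_def Pi_def)
  qed
  then have "emeasure (distr (leb_dim m) borel ?\<phi>) (box l u) = emeasure (leb_dim m) (PiE {..<m} (\<lambda>i. {l \<bullet> e i <..< u \<bullet> e i}))"
    by (subst emeasure_distr) auto
  also have "\<dots> = (\<Prod>i<m. emeasure lborel {l \<bullet> e i <..< u \<bullet> e i})"
    unfolding leb_dim_def by (intro emeasure_PiM) auto
  also have "\<dots> = (\<Prod>i<m. ennreal ((u - l) \<bullet> e i))"
    using lu eB by (intro prod.cong) (auto simp: inner_diff_left)
  also have "\<dots> = ennreal (\<Prod>i<m. (u - l) \<bullet> e i)"
    using lu eB by (intro prod_ennreal) (auto simp: inner_diff_left)
  also have "(\<Prod>i<m. (u - l) \<bullet> e i) = (\<Prod>b\<in>Basis. (u - l) \<bullet> b)"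
    using e by (rule prod.reindex_bij_betw)
  finally show "emeasure (distr (leb_dim m) borel ?\<phi>) (box l u) = (\<Prod>b\<in>Basis. (u - l) \<bullet> b)" .
qed simp

lemma onb_exists:
  fixes E :: "(real^'n) set"
  assumes "subspace E"
  shows "\<exists>b. onb E b"
proof -
  obtain B where B: "B \<subseteq> E" "pairwise orthogonal B" "\<And>x. x \<in> B \<Longrightarrow> norm x = 1"
      "independent B" "card B = dim E"
    using orthonormal_basis_subspace[OF assms] by metis
  have "finite B" using B(4) by (rule finiteI_independent)
  then obtain b where b: "bij_betw b {..<dim E} B"
    using B(5) ex_bij_betw_nat_finite[of B] by (auto simp: atLeast0LessThan)
  have "b i \<bullet> b j = (if i = j then 1 else 0)" if "i < dim E" "j < dim E" for i j
  proof -
    have "b i \<in> B" "b j \<in> B" "b i = b j \<longleftrightarrow> i = j"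
      using b that by (auto simp: bij_betw_def inj_on_def)
    then show ?thesis using B(2,3) by (auto simp: pairwise_def orthogonal_def dot_square_norm)
  qed
  moreover have "b i \<in> E" if "i < dim E" for i using b B(1) that by (auto simp: bij_betw_def)
  ultimately have "onb E b" unfolding onb_def by blast
  then show ?thesis by blast
qed

lemma borel_measurable_coords [measurable]: "coords E \<in> borel_measurable (leb_dim (dim E))"
  unfolding coords_def[abs_def] leb_dim_def by measurable

lemma norm_coords:
  assumes "subspace E"
  shows "(norm (coords E c))\<^sup>2 = (\<Sum>i<dim E. (c i)\<^sup>2)"
proof -
  have b: "onb E (SOME b. onb E b)" (is "onb E ?b") using onb_exists[OF assms] by (rule someI_ex)
  have "(norm (coords E c))\<^sup>2 = (\<Sum>i<dim E. \<Sum>j<dim E. (c i * c j) * (?b i \<bullet> ?b j))"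
    unfolding coords_def power2_norm_eq_inner inner_sum_left inner_sum_right
    by (intro sum.cong refl) (simp add: inner_commute)
  also have "\<dots> = (\<Sum>i<dim E. \<Sum>j<dim E. if i = j then c i * c j else 0)"
    using b by (intro sum.cong) (auto simp: onb_def)
  also have "\<dots> = (\<Sum>i<dim E. (c i)\<^sup>2)"
    by (intro sum.cong) (auto simp: power2_eq_square)
  finally show ?thesis .
qed

lemma dim_range_linear_isometry:
  fixes T :: "'k::euclidean_space \<Rightarrow> 'b::euclidean_space"
  assumes lin: "linear T" and iso: "\<And>x. norm (T x) = norm x"
  shows "inj T" "dim (range T) = DIM('k)"
proof -
  show "inj T"
    using iso lin by (simp add: linear_injective_0) (metis norm_eq_zero)
  then show "dim (range T) = DIM('k)"
    using dim_image_eq[OF lin, of UNIV] by simp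
qed

text \<open>\<open>coords\<close> hides an arbitrary choice of orthonormal basis, while
  \<open>T\<close> is another isometric parametrization of the same subspace. The two differ by the
  linear isometry \<open>V\<close> of the parameter space, which preserves Lebesgue measure, so the
  choice is immaterial and \<open>T\<close> may be picked to suit.\<close>

lemma distr_leb_dim_coords:
  fixes T :: "'k::euclidean_space \<Rightarrow> real^'n"
  assumes lin: "linear T" and iso: "\<And>x. norm (T x) = norm x"
  shows "distr (leb_dim (dim (range T))) borel (coords (range T)) = distr lborel borel T"
proof -
  define E where "E = range T"
  have E: "subspace E" unfolding E_def using lin by (intro linear_subspace_image) auto
  have dE: "dim E = DIM('k)" unfolding E_def by (rule dim_range_linear_isometry[OF lin iso])
  have injT: "inj T" by (rule dim_range_linear_isometry[OF lin iso])
  define b where "b = (SOME b. onb E b)"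
  have b: "onb E b" unfolding b_def using onb_exists[OF E] by (rule someI_ex)
  obtain e where e: "bij_betw e {..<dim E} (Basis :: 'k set)"
    using ex_bij_betw_nat_finite[of "Basis :: 'k set"] by (auto simp: atLeast0LessThan dE)
  have eB: "e i \<in> Basis" if "i < dim E" for i using e that by (auto simp: bij_betw_def)
  define \<phi> where "\<phi> c = (\<Sum>i<dim E. c i *\<^sub>R e i)" for c
  define U where "U x = coords E (\<lambda>i. x \<bullet> e i)" for x
  have U_def': "U x = (\<Sum>i<dim E. (x \<bullet> e i) *\<^sub>R b i)" for x
    by (simp add: U_def coords_def b_def)
  have linU: "linear U"
    unfolding U_def' by (intro linearI) (simp_all add: inner_add_left scaleR_left_distrib sum.distrib scaleR_sum_right)
  have normU: "norm (U x) = norm x" for x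
  proof -
    have "(norm (U x))\<^sup>2 = (\<Sum>i<dim E. (x \<bullet> e i)\<^sup>2)" unfolding U_def by (rule norm_coords[OF E])
    also have "\<dots> = (\<Sum>i\<in>Basis. (x \<bullet> i)\<^sup>2)" using e by (rule sum.reindex_bij_betw)
    also have "\<dots> = (norm x)\<^sup>2" unfolding power2_norm_eq_inner euclidean_inner[of x x] by (simp add: power2_eq_square)
    finally show ?thesis by simp
  qed
  have comp: "\<phi> c \<bullet> e i = c i" if "i < dim E" for i c
  proof -
    have "\<phi> c \<bullet> e i = (\<Sum>j<dim E. if j = i then c j else 0)"
      unfolding \<phi>_def inner_sum_left
    proof (intro sum.cong refl)
      fix j assume "j \<in> {..<dim E}"
      then have "e j = e i \<longleftrightarrow> j = i" using e that by (auto simp: bij_betw_def inj_on_def)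
      then show "(c j *\<^sub>R e j) \<bullet> e i = (if j = i then c j else 0)"
        using eB \<open>j \<in> {..<dim E}\<close> that by (auto simp: inner_Basis)
    qed
    then show ?thesis using that by simp
  qed
  have co: "coords E c = U (\<phi> c)" for c
    by (simp add: U_def' coords_def b_def comp)
  have UE: "U x \<in> range T" for x
    unfolding E_def[symmetric] U_def' using b E by (auto simp: onb_def intro!: subspace_sum subspace_scale)
  define V where "V x = inv T (U x)" for x
  have TV: "T (V x) = U x" for x unfolding V_def using UE by (rule f_inv_into_f)
  have linV: "linear V"
    by (intro linearI; rule injD[OF injT])
       (simp_all add: TV linear_add[OF lin] linear_add[OF linU] linear_scale[OF lin] linear_scale[OF linU])
  have normV: "norm (V x) = norm x" for x using iso[of "V x"] by (simp add: TV normU)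
  have [measurable]: "V \<in> borel_measurable borel" "T \<in> borel_measurable borel" "U \<in> borel_measurable borel"
    using linV lin linU by (auto intro!: borel_measurable_continuous_onI linear_continuous_on simp: linear_conv_bounded_linear)
  have [measurable]: "\<phi> \<in> borel_measurable (leb_dim (dim E))"
    unfolding \<phi>_def[abs_def] leb_dim_def by measurable
  have "distr (leb_dim (dim E)) borel (coords E) = distr (distr (leb_dim (dim E)) borel \<phi>) borel U"
    by (subst distr_distr) (auto simp: comp_def co[abs_def])
  also have "\<dots> = distr lborel borel U"
    using lborel_eq_distr_leb_dim[OF e] by (simp add: \<phi>_def[abs_def])
  also have "\<dots> = distr (distr lborel borel V) borel T"
    by (subst distr_distr) (auto simp: comp_def TV)
  also have "\<dots> = distr lborel borel T"
    by (simp add: lborel_distr_linear_isometry[OF linV normV])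
  finally show ?thesis by (simp add: E_def)
qed

section \<open>Sphere measures and section volumes in isometric parametrizations\<close>

lemma distr_uniform_measure_vimage:
  assumes f[measurable]: "f \<in> measurable M N" and g[measurable]: "g \<in> measurable N L" and B[measurable]: "B \<in> sets N"
  shows "distr (uniform_measure M (f -` B \<inter> space M)) L (\<lambda>x. g (f x)) = distr (uniform_measure (distr M N f) B) L g"
proof (rule measure_eqI)
  fix A assume "A \<in> sets (distr (uniform_measure M (f -` B \<inter> space M)) L (\<lambda>x. g (f x)))"
  then have [measurable]: "A \<in> sets L" by simp
  have "(f -` B \<inter> space M) \<inter> ((\<lambda>x. g (f x)) -` A \<inter> space M) = f -` (B \<inter> (g -` A \<inter> space N)) \<inter> space M"
    using measurable_space[OF f] by auto
  then show "emeasure (distr (uniform_measure M (f -` B \<inter> space M)) L (\<lambda>x. g (f x))) A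
      = emeasure (distr (uniform_measure (distr M N f) B) L g) A"
    by (simp add: emeasure_distr)
qed simp

lemma borel_measurable_linear:
  fixes T :: "'a::euclidean_space \<Rightarrow> 'b::euclidean_space"
  assumes "linear T"
  shows "T \<in> borel_measurable borel"
  using assms by (intro borel_measurable_continuous_onI linear_continuous_on) (simp add: linear_conv_bounded_linear)

lemma linear_isometry_inner:
  fixes J :: "'a::real_inner \<Rightarrow> 'b::real_inner"
  assumes "linear J" "\<And>x. norm (J x) = norm x"
  shows "J x \<bullet> J y = x \<bullet> y"
  using assms(2)[of "x + y"] assms(2)[of x] assms(2)[of y]
  by (simp add: linear_add[OF assms(1)] norm_eq_sqrt_inner inner_add_left inner_add_right inner_commute)

lemma integrable_indicator_cball:
  "integrable lborel (\<lambda>x::'a::euclidean_space. c * indicator (cball a r) x :: real)"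
  using emeasure_bounded_finite[OF bounded_cball[of a r]]
  by (intro integrable_mult_right integrable_real_indicator) simp_all

lemma sphere_measure_linear_isometry:
  fixes T :: "'k::euclidean_space \<Rightarrow> real^'n"
  assumes lin: "linear T" and iso: "\<And>x. norm (T x) = norm x"
  shows "sphere_measure (range T) = distr (uniform_measure lborel (cball 0 1)) borel (\<lambda>x. sgn (T x))"
proof -
  define E where "E = range T"
  have E: "subspace E" unfolding E_def using lin by (intro linear_subspace_image) auto
  have [measurable]: "T \<in> borel_measurable borel" using lin by (rule borel_measurable_linear)
  let ?L = "leb_dim (dim E)"
  have "{c \<in> space ?L. (\<Sum>i<dim E. (c i)\<^sup>2) \<le> 1} = coords E -` cball 0 1 \<inter> space ?L"
    by (auto simp: norm_coords[OF E, symmetric] abs_square_le_1)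
  then have "sphere_measure E = distr (uniform_measure (distr ?L borel (coords E)) (cball 0 1)) borel sgn"
    unfolding sphere_measure_def
    using distr_uniform_measure_vimage[of "coords E" ?L borel sgn borel "cball 0 1"] by simp
  also have "distr ?L borel (coords E) = distr lborel borel T"
    unfolding E_def by (rule distr_leb_dim_coords[OF lin iso])
  also have "distr (uniform_measure (distr lborel borel T) (cball 0 1)) borel sgn
      = distr (uniform_measure lborel (T -` cball 0 1 \<inter> space lborel)) borel (\<lambda>x. sgn (T x))"
    by (intro distr_uniform_measure_vimage[symmetric]) auto
  also have "T -` cball 0 1 \<inter> space lborel = cball 0 1" by (auto simp: iso)
  finally show ?thesis by (simp add: E_def)
qed

lemma sub_vol_linear_isometry:
  fixes T :: "'k::euclidean_space \<Rightarrow> real^'n"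
  assumes lin: "linear T" and iso: "\<And>x. norm (T x) = norm x" and S[measurable]: "S \<in> sets borel"
  shows "sub_vol (range T) S = measure lborel (T -` S)"
proof -
  have [measurable]: "T \<in> borel_measurable borel" using lin by (rule borel_measurable_linear)
  let ?L = "leb_dim (dim (range T))"
  have "sub_vol (range T) S = measure (distr ?L borel (coords (range T))) S"
    unfolding sub_vol_def by (subst measure_distr) (auto simp: vimage_def Int_def conj_commute)
  also have "\<dots> = measure lborel (T -` S)"
    unfolding distr_leb_dim_coords[OF lin iso] by (subst measure_distr) auto
  finally show ?thesis .
qed

lemma integral_sphere_measure:
  fixes T :: "'k::euclidean_space \<Rightarrow> real^'n" and f :: "real^'n \<Rightarrow> real"
  assumes lin: "linear T" and iso: "\<And>x. norm (T x) = norm x" and f[measurable]: "f \<in> borel_measurable borel"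
  shows "integral\<^sup>L (sphere_measure (range T)) f
    = (LINT x:cball 0 1|lborel. f (sgn (T x))) / measure lborel (cball (0::'k) 1)"
proof -
  have [measurable]: "T \<in> borel_measurable borel" using lin by (rule borel_measurable_linear)
  have "emeasure lborel (cball (0::'k) 1) \<noteq> 0"
    using unit_ball_vol_pos[of "real DIM('k)"] by (simp add: emeasure_cball ennreal_eq_0_iff not_le)
  have d: "1 / emeasure lborel (cball (0::'k) 1) = ennreal (1 / measure lborel (cball (0::'k) 1))"
    using unit_ball_vol_pos[of "real DIM('k)"]
    by (simp add: emeasure_cball measure_def divide_ennreal flip: ennreal_1)
  have "integral\<^sup>L (sphere_measure (range T)) f = (\<integral>x. f (sgn (T x)) \<partial>uniform_measure lborel (cball 0 1))"
    unfolding sphere_measure_linear_isometry[OF lin iso] by (subst integral_distr) auto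
  also have "\<dots> = (\<integral>x. (indicator (cball 0 1) x / measure lborel (cball (0::'k) 1)) * f (sgn (T x)) \<partial>lborel)"
  proof -
    have "uniform_measure lborel (cball (0::'k) 1) = density lborel (\<lambda>x. ennreal (indicator (cball 0 1) x / measure lborel (cball (0::'k) 1)))"
      unfolding uniform_measure_def
      by (intro density_cong) (auto simp: indicator_def d)
    moreover have "(\<lambda>x::'k. indicator (cball 0 1) x / measure lborel (cball (0::'k) 1)) \<in> borel_measurable borel"
      by (intro borel_measurable_divide borel_measurable_indicator) simp_all
    ultimately show ?thesis by (simp only:) (subst integral_real_density, auto)
  qed
  finally show ?thesis by (simp add: set_lebesgue_integral_def field_simps)
qed

section \<open>Haar measure on the orthogonal group\<close>

text \<open>Closed sets form an intersection-stable generator, and the indicator of a nonempty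
  closed set is the limit of the functions \<open>max 0 (1 - n * infdist x C)\<close>. The empty set
  is treated apart because \<open>infdist x {}\<close> is 0.\<close>

lemma finite_measure_eqI_continuous:
  fixes M N :: "'a::metric_space measure"
  assumes M: "finite_measure M" "sets M = sets borel" and N: "finite_measure N" "sets N = sets borel"
    and eq: "\<And>\<phi> :: 'a \<Rightarrow> real. continuous_on UNIV \<phi> \<Longrightarrow> (\<And>x. \<phi> x \<in> {0..1}) \<Longrightarrow> integral\<^sup>L M \<phi> = integral\<^sup>L N \<phi>"
  shows "M = N"
proof (rule measure_eqI_generator_eq[of "Collect closed" UNIV M N "\<lambda>_. UNIV"])
  interpret M: finite_measure M by fact
  interpret N: finite_measure N by fact
  have sM: "space M = UNIV" "space N = UNIV" using M N by (auto dest: sets_eq_imp_space_eq)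
  show "Int_stable (Collect (closed :: 'a set \<Rightarrow> bool))" by (auto simp: Int_stable_def)
  show "sets M = sigma_sets UNIV (Collect closed)" "sets N = sigma_sets UNIV (Collect closed)"
    using M N by (simp_all add: borel_eq_closed)
  show "emeasure M UNIV \<noteq> \<infinity>" by simp
  fix C :: "'a set" assume "C \<in> Collect closed"
  then have C: "closed C" by simp
  have ind: "(\<lambda>n. integral\<^sup>L L (\<lambda>x. max 0 (1 - real n * infdist x C))) \<longlonglongrightarrow> measure L C"
    if L: "finite_measure L" "sets L = sets borel" and "C \<noteq> {}" for L
  proof -
    interpret L: finite_measure L by (rule L)
    have [measurable_cong]: "sets L = sets borel" by (rule L)
    have [measurable]: "C \<in> sets borel" using C by simp
    have "(\<lambda>n. integral\<^sup>L L (\<lambda>x. max 0 (1 - real n * infdist x C))) \<longlonglongrightarrow> integral\<^sup>L L (indicator C :: 'a \<Rightarrow> real)"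
    proof (rule integral_dominated_convergence[where w="\<lambda>_. 1"])
      show "(\<lambda>x. max 0 (1 - real n * infdist x C)) \<in> borel_measurable L" for n
        unfolding measurable_cong_sets[OF L(2) refl]
        by (intro borel_measurable_continuous_onI continuous_intros)
      show "AE x in L. norm (max 0 (1 - real n * infdist x C)) \<le> 1" for n
        by (intro always_eventually allI) (auto simp: infdist_nonneg)
      show "AE x in L. (\<lambda>n. max 0 (1 - real n * infdist x C)) \<longlonglongrightarrow> indicator C x"
      proof (intro always_eventually allI)
        fix x
        show "(\<lambda>n. max 0 (1 - real n * infdist x C)) \<longlonglongrightarrow> indicator C x"
        proof (cases "x \<in> C")
          case True
          then show ?thesis by simp
        next
          case False
          then have pos: "infdist x C > 0"
            using in_closed_iff_infdist_zero[OF C \<open>C \<noteq> {}\<close>, of x] infdist_nonneg[of x C] by linarith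
          obtain n0 :: nat where "1 / infdist x C < n0" using reals_Archimedean2 by blast
          then have n0: "1 < n0 * infdist x C" using pos by (simp add: field_simps)
          have "eventually (\<lambda>n. max 0 (1 - real n * infdist x C) = 0) sequentially"
            using eventually_ge_at_top[of n0]
          proof eventually_elim
            case (elim n)
            then have "n0 * infdist x C \<le> n * infdist x C" using pos by (intro mult_right_mono) auto
            then show ?case using n0 by simp
          qed
          then show ?thesis using False by (simp add: tendsto_eventually)
        qed
      qed
    qed auto
    then show ?thesis by simp
  qed
  show "emeasure M C = emeasure N C"
  proof (cases "C = {}")
    case False
    have "integral\<^sup>L M (\<lambda>x. max 0 (1 - real n * infdist x C)) = integral\<^sup>L N (\<lambda>x. max 0 (1 - real n * infdist x C))" for n
      by (intro eq continuous_intros) (auto simp: infdist_nonneg)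
    then have "measure M C = measure N C"
      using ind[OF M False] ind[OF N False] LIMSEQ_unique by fastforce
    then show ?thesis by (simp add: M.emeasure_eq_measure N.emeasure_eq_measure)
  qed simp
qed auto

lemma norm_orthogonal_matrix_vector:
  fixes Q :: "real^'n^'n"
  assumes "orthogonal_matrix Q"
  shows "norm (Q *v x) = norm x"
  using assms by (intro orthogonal_transformation_norm) (simp add: orthogonal_transformation_matrix)

text \<open>The norm on matrices is the Frobenius norm, so it suffices that
  \<open>transpose R\<close> preserves the norm of every row. Right multiplication thus becomes a
  linear isometry of the matrix space and preserves Lebesgue measure there.\<close>

lemma norm_matrix_mult_orthogonal:
  fixes A R :: "real^'n^'n"
  assumes "orthogonal_matrix R"
  shows "norm (A ** R) = norm A"
proof -
  have "(A ** R) $ i = transpose R *v (A $ i)" for i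
    by (simp add: vec_eq_iff matrix_matrix_mult_def matrix_vector_mult_def transpose_def mult.commute)
  moreover have "norm (transpose R *v x) = norm x" for x
    using assms by (intro norm_orthogonal_matrix_vector) simp
  ultimately show ?thesis by (simp add: norm_vec_def)
qed

lemma compact_orthogonal_matrices: "compact {Q :: real^'n^'n. orthogonal_matrix Q}"
proof -
  have "norm Q = norm (mat 1 :: real^'n^'n)" if "orthogonal_matrix Q" for Q :: "real^'n^'n"
    using norm_matrix_mult_orthogonal[OF that, of "mat 1"] by simp
  then have "bounded {Q :: real^'n^'n. orthogonal_matrix Q}" unfolding bounded_iff by auto
  moreover have "{Q :: real^'n^'n. orthogonal_matrix Q} = {Q. \<forall>i j. (\<Sum>k\<in>UNIV. Q $ k $ i * Q $ k $ j) = mat 1 $ i $ j}"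
    by (simp add: orthogonal_matrix vec_eq_iff matrix_matrix_mult_def transpose_def)
  moreover have "closed {Q :: real^'n^'n. \<forall>i j. (\<Sum>k\<in>UNIV. Q $ k $ i * Q $ k $ j) = (mat 1 :: real^'n^'n) $ i $ j}"
    by (intro closed_Collect_all closed_Collect_eq continuous_intros)
  ultimately show ?thesis by (simp add: compact_eq_bounded_closed)
qed

lemma linear_matrix_mult_right: "linear (\<lambda>A :: real^'n^'n. A ** R)"
  by (intro linearI)
     (simp_all add: vec_eq_iff matrix_matrix_mult_def algebra_simps sum.distrib sum_distrib_left)

text \<open>Haar measure as a weak limit of uniform distributions on shrinking neighbourhoods
  \<open>U n\<close> of the orthogonal group in matrix space. Right multiplication by
  \<open>R\<close> is a linear isometry mapping the group onto itself, hence preserves the distance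
  to it, so each of these distributions is already invariant and invariance survives the
  limit.\<close>

theorem orthogonal_haar_measure:
  obtains H :: "(real^'n^'n) measure"
  where "prob_space H" "sets H = sets borel" "AE Q in H. orthogonal_matrix Q"
    "\<And>R. orthogonal_matrix R \<Longrightarrow> distr H borel (\<lambda>Q. Q ** R) = H"
proof -
  define Or where "Or = {Q :: real^'n^'n. orthogonal_matrix Q}"
  have O: "compact Or" "closed Or" "Or \<noteq> {}" "bounded Or"
    using compact_imp_closed[OF compact_orthogonal_matrices[where 'n='n]]
      compact_imp_bounded[OF compact_orthogonal_matrices[where 'n='n]] compact_orthogonal_matrices[where 'n='n]
      orthogonal_matrix_id[where 'n='n] unfolding Or_def by auto
  define U where "U n = {A. infdist A Or < 1 / real (Suc n)}" for n
  have oU: "open (U n)" for n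
    unfolding U_def by (intro open_Collect_less continuous_intros)
  have OU: "Or \<subseteq> U n" for n by (auto simp: U_def)
  define C where "C = {A. infdist A Or \<le> 1}"
  have clC: "closed C" unfolding C_def by (intro closed_Collect_le continuous_intros)
  have bC: "bounded C"
  proof -
    obtain r where r: "\<And>Q. Q \<in> Or \<Longrightarrow> norm Q \<le> r" using O(4) by (auto simp: bounded_iff)
    have "norm A \<le> r + 1" if A: "A \<in> C" for A
    proof -
      obtain Q where Q: "Q \<in> Or" "infdist A Or = dist A Q" using infdist_attains_inf[OF O(2,3)] by metis
      have "norm A \<le> norm Q + dist A Q" by (metis dist_norm norm_triangle_sub)
      then show ?thesis using A Q r[OF Q(1)] by (simp add: C_def)
    qed
    then show ?thesis by (auto simp: bounded_iff)
  qed
  have UC: "U n \<subseteq> C" for n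
  proof
    fix A assume "A \<in> U n"
    moreover have "1 / real (Suc n) \<le> 1" by simp
    ultimately show "A \<in> C" unfolding U_def C_def mem_Collect_eq by linarith
  qed
  have Uf: "emeasure lborel (U n) \<noteq> \<infinity>" for n
    using emeasure_bounded_finite[OF bounded_subset[OF bC UC[of n]]] by (simp add: less_top)
  have U0: "emeasure lborel (U n) \<noteq> 0" for n
  proof
    assume "emeasure lborel (U n) = 0"
    then have "U n \<in> null_sets lborel" using oU by auto
    then have "negligible (U n)" by (simp add: negligible_iff_null_sets null_sets_completionI)
    then show False using open_not_negligible[OF oU] OU O(3) by blast
  qed
  define M where "M n = uniform_measure lborel (U n)" for n
  have pM: "prob_space (M n)" for n unfolding M_def using U0 Uf by (intro prob_space_uniform_measure)
  have sM: "sets (M n) = sets borel" for n by (simp add: M_def)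
  have AU: "AE A in M n. A \<in> U n" for n
    unfolding M_def using oU by (intro AE_uniform_measureI) auto
  have AC: "AE A in M n. A \<in> C" for n using AU[of n] UC[of n] by (auto elim: eventually_mono)
  have cC: "compact C" using clC bC by (simp add: compact_eq_bounded_closed)
  obtain r N where rN: "strict_mono r" "prob_space N \<and> sets N = sets borel \<and> (AE A in N. A \<in> C) \<and>
      (\<forall>\<phi> :: real^'n^'n \<Rightarrow> real. continuous_on UNIV \<phi> \<longrightarrow> (\<lambda>n. integral\<^sup>L (M (r n)) \<phi>) \<longlonglongrightarrow> integral\<^sup>L N \<phi>)"
    by (rule weakly_convergent_subsequence_on_compact[where M = M, OF cC pM sM AC]) blast
  then have r: "strict_mono r" and N: "prob_space N" "sets N = sets borel" "AE A in N. A \<in> C"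
    and lim: "\<And>\<phi> :: real^'n^'n \<Rightarrow> real. continuous_on UNIV \<phi> \<Longrightarrow> (\<lambda>n. integral\<^sup>L (M (r n)) \<phi>) \<longlonglongrightarrow> integral\<^sup>L N \<phi>"
    by blast+
  interpret N: prob_space N by (rule N)
  have [measurable_cong]: "sets N = sets borel" by (rule N)
  have AO: "AE Q in N. Q \<in> Or"
  proof -
    have c: "continuous_on UNIV (\<lambda>A. infdist A Or)" by (intro continuous_intros)
    then have m[measurable]: "(\<lambda>A. infdist A Or) \<in> borel_measurable borel" by (rule borel_measurable_continuous_onI)
    have bd: "integral\<^sup>L (M n) (\<lambda>A. infdist A Or) \<le> 1 / real (Suc n)" for n
    proof -
      interpret Mn: prob_space "M n" by (rule pM)
      have [measurable_cong]: "sets (M n) = sets borel" by (rule sM)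
      have "integral\<^sup>L (M n) (\<lambda>A. infdist A Or) \<le> integral\<^sup>L (M n) (\<lambda>A. 1 / real (Suc n))"
      proof (rule integral_mono_AE)
        show "integrable (M n) (\<lambda>A. infdist A Or)"
          using AC[of n] by (intro Mn.integrable_const_bound[of _ 1]) (auto simp: C_def infdist_nonneg elim: eventually_mono)
        show "AE A in M n. infdist A Or \<le> 1 / real (Suc n)" using AU[of n] by (auto simp: U_def elim: eventually_mono)
      qed simp
      then show ?thesis by (simp add: Mn.prob_space)
    qed
    have "(\<lambda>n. 1 / real (Suc (r n))) \<longlonglongrightarrow> 0"
      using LIMSEQ_subseq_LIMSEQ[OF LIMSEQ_Suc[OF lim_1_over_n] r] by (simp add: comp_def)
    then have "integral\<^sup>L N (\<lambda>A. infdist A Or) \<le> 0"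
      using lim[OF c] bd by (intro LIMSEQ_le[OF lim[OF c]]) auto
    moreover have "integral\<^sup>L N (\<lambda>A. infdist A Or) \<ge> 0" by (intro integral_nonneg_AE) (auto simp: infdist_nonneg)
    ultimately have "integral\<^sup>L N (\<lambda>A. infdist A Or) = 0" by simp
    moreover have "integrable N (\<lambda>A. infdist A Or)"
      using N(3) by (intro N.integrable_const_bound[of _ 1]) (auto simp: C_def infdist_nonneg elim: eventually_mono)
    ultimately have "AE A in N. infdist A Or = 0"
      by (subst (asm) integral_nonneg_eq_0_iff_AE) (auto simp: infdist_nonneg)
    then show ?thesis using in_closed_iff_infdist_zero[OF O(2,3)] by simp
  qed
  have inv: "distr N borel (\<lambda>Q. Q ** R) = N" if R: "orthogonal_matrix R" for R
  proof -
    define f where "f A = A ** R" for A :: "real^'n^'n"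
    have lf: "linear f" unfolding f_def by (rule linear_matrix_mult_right)
    have nf: "norm (f A) = norm A" for A unfolding f_def by (rule norm_matrix_mult_orthogonal[OF R])
    have fc: "continuous_on UNIV f" using lf by (simp add: linear_continuous_on linear_conv_bounded_linear)
    have [measurable]: "f \<in> borel_measurable borel" using lf by (rule borel_measurable_linear)
    have fO: "f Q \<in> Or \<longleftrightarrow> Q \<in> Or" for Q
    proof -
      have "f Q ** transpose R = Q" using R by (simp add: f_def orthogonal_matrix_def flip: matrix_mul_assoc)
      then show ?thesis using R orthogonal_matrix_mul[of Q R] orthogonal_matrix_mul[of "f Q" "transpose R"]
        by (auto simp: Or_def f_def)
    qed
    have df: "dist (f A) (f B) = dist A B" for A B
      using nf[of "A - B"] by (simp add: dist_norm linear_diff[OF lf])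
    have inf: "infdist (f A) Or = infdist A Or" for A
    proof (rule antisym)
      obtain Q where Q: "Q \<in> Or" "infdist A Or = dist A Q" using infdist_attains_inf[OF O(2,3)] by metis
      have "infdist (f A) Or \<le> dist (f A) (f Q)" using Q fO by (intro infdist_le) simp
      then show "infdist (f A) Or \<le> infdist A Or" by (simp add: Q df)
      obtain P where P: "P \<in> Or" "infdist (f A) Or = dist (f A) P" using infdist_attains_inf[OF O(2,3)] by metis
      have fP: "f (P ** transpose R) = P" using R by (simp add: f_def orthogonal_matrix_def flip: matrix_mul_assoc)
      have "infdist A Or \<le> dist A (P ** transpose R)" using P fO[of "P ** transpose R"] by (intro infdist_le) (simp add: fP)
      then show "infdist A Or \<le> infdist (f A) Or" using df[of A "P ** transpose R"] by (simp add: P fP)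
    qed
    have invM: "distr (M n) borel f = M n" for n
    proof -
      have "f -` U n \<inter> space lborel = U n" by (auto simp: U_def inf)
      moreover have "distr (uniform_measure lborel (f -` U n \<inter> space lborel)) borel (\<lambda>x. f x)
          = distr (uniform_measure (distr lborel borel f) (U n)) borel (\<lambda>x. x)"
        using oU[of n] by (intro distr_uniform_measure_vimage) simp_all
      ultimately have "distr (M n) borel f = distr (uniform_measure (distr lborel borel f) (U n)) borel (\<lambda>x. x)"
        by (simp only: M_def)
      also have "distr lborel borel f = lborel" by (rule lborel_distr_linear_isometry[OF lf nf refl])
      also have "distr (uniform_measure lborel (U n)) borel (\<lambda>x. x) = M n"
        unfolding M_def by (intro distr_id2) simp
      finally show ?thesis .
    qed
    show "distr N borel (\<lambda>Q. Q ** R) = N"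
      unfolding f_def[symmetric]
    proof (rule finite_measure_eqI_continuous)
      show "finite_measure (distr N borel f)" by (intro N.finite_measure_distr) simp
      show "finite_measure N" by unfold_locales
      fix \<phi> :: "real^'n^'n \<Rightarrow> real" assume \<phi>: "continuous_on UNIV \<phi>"
      have [measurable]: "\<phi> \<in> borel_measurable borel" using \<phi> by (rule borel_measurable_continuous_onI)
      have c: "continuous_on UNIV (\<lambda>A. \<phi> (f A))" using continuous_on_compose2[OF \<phi> fc] by simp
      have "integral\<^sup>L (M n) (\<lambda>A. \<phi> (f A)) = integral\<^sup>L (M n) \<phi>" for n
      proof -
        have [measurable_cong]: "sets (M n) = sets borel" by (rule sM)
        have "integral\<^sup>L (distr (M n) borel f) \<phi> = integral\<^sup>L (M n) (\<lambda>A. \<phi> (f A))"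
          by (subst integral_distr) auto
        then show ?thesis by (simp add: invM)
      qed
      then have "integral\<^sup>L N (\<lambda>A. \<phi> (f A)) = integral\<^sup>L N \<phi>"
        using lim[OF c] lim[OF \<phi>] LIMSEQ_unique by auto
      then show "integral\<^sup>L (distr N borel f) \<phi> = integral\<^sup>L N \<phi>"
        by (subst integral_distr) auto
    qed (simp_all add: N)
  qed
  show ?thesis using that[OF N(1,2) _ inv] AO by (simp add: Or_def)
qed

section \<open>Parallel sections of symmetric convex bodies\<close>

text \<open>With \<alpha> the maximum of \<open>A\<close> and \<beta> the minimum of
  \<open>B\<close>, the translates A + \<beta> and B + \<alpha> both lie in 2C and meet in at most
  the point \<alpha> + \<beta>, so their lengths add up.\<close>

lemma brunn_minkowski_real_compact:
  fixes A B C :: "real set"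
  assumes A: "compact A" "A \<noteq> {}" and B: "compact B" "B \<noteq> {}" and C: "C \<in> sets borel"
    and mid: "\<And>a b. a \<in> A \<Longrightarrow> b \<in> B \<Longrightarrow> (a + b) / 2 \<in> C"
  shows "emeasure lborel A + emeasure lborel B \<le> 2 * emeasure lborel C"
proof -
  obtain \<alpha> where \<alpha>: "\<alpha> \<in> A" "\<And>a. a \<in> A \<Longrightarrow> a \<le> \<alpha>" using compact_attains_sup[OF A] by blast
  obtain \<beta> where \<beta>: "\<beta> \<in> B" "\<And>b. b \<in> B \<Longrightarrow> \<beta> \<le> b" using compact_attains_inf[OF B] by blast
  have [measurable]: "A \<in> sets borel" "B \<in> sets borel" "C \<in> sets borel"
    using A B C by (auto intro: borel_compact)
  have shift: "emeasure lborel ((\<lambda>z. c + z) -` X) = emeasure lborel X" if [measurable]: "X \<in> sets borel" for c :: real and X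
    using lborel_distr_plus[of c] emeasure_distr[of "(+) c" lborel borel X] by simp
  define A' where "A' = (\<lambda>z. - \<beta> + z) -` A"
  define B' where "B' = (\<lambda>z. - \<alpha> + z) -` B"
  define C' where "C' = (\<lambda>z. z / 2) -` C"
  have [measurable]: "A' \<in> sets borel" "B' \<in> sets borel" "C' \<in> sets borel"
    unfolding A'_def B'_def C'_def by (rule measurable_sets_borel[of _ borel]; simp)+
  have C'2: "emeasure lborel C' = 2 * emeasure lborel C"
  proof -
    have "emeasure lborel C = emeasure (density (distr lborel borel (\<lambda>x. 0 + (1/2) * x)) (\<lambda>_. ennreal \<bar>1/2\<bar>)) C"
      by (subst lborel_real_affine[of "1/2" 0]) simp_all
    also have "\<dots> = ennreal (1/2) * emeasure lborel C'"
      by (simp add: emeasure_density nn_integral_cmult_indicator emeasure_distr C'_def vimage_def)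
    finally have "emeasure lborel C = ennreal (1/2) * emeasure lborel C'" .
    moreover have "ennreal 2 * ennreal (1/2) = 1" by (subst ennreal_mult[symmetric]) simp_all
    ultimately show ?thesis by (simp only: ennreal_numeral[symmetric] mult.assoc[symmetric] mult_1)
  qed
  have "A' \<inter> B' \<subseteq> {\<alpha> + \<beta>}"
    using \<alpha>(2) \<beta>(2) by (force simp: A'_def B'_def)
  then have "emeasure lborel (A' \<inter> B') = 0"
    by (metis emeasure_lborel_singleton subset_singleton_iff emeasure_empty)
  then have "A' \<inter> B' \<in> null_sets lborel" by auto
  then have "emeasure lborel A' + emeasure lborel B' = emeasure lborel (A' \<union> B')"
    by (intro emeasure_Un'[symmetric]) auto
  also have "\<dots> \<le> emeasure lborel C'"
  proof (rule emeasure_mono)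
    show "A' \<union> B' \<subseteq> C'"
      using mid[OF _ \<beta>(1)] mid[OF \<alpha>(1)] by (force simp: A'_def B'_def C'_def)
  qed simp
  finally show ?thesis
    unfolding C'2 A'_def B'_def by (subst (asm) (1 2) shift) simp_all
qed

lemma emeasure_inner_compact:
  fixes A :: "real set"
  assumes A: "A \<in> sets borel" and fin: "emeasure lborel A \<noteq> \<infinity>"
  shows "emeasure lborel A = (SUP K\<in>{K. K \<subseteq> A \<and> compact K}. emeasure lborel K)"
proof -
  \<comment> \<open>Restricted to \<open>A\<close>, Lebesgue measure has finite total mass, and
    inner regularity of finite measures applies.\<close>
  let ?M = "density lborel (indicator A)"
  have M: "emeasure ?M X = emeasure lborel (A \<inter> X)" if "X \<in> sets borel" for X
    using that A by (subst emeasure_density) (auto simp flip: indicator_inter_arith)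
  have "emeasure ?M A = (SUP K\<in>{K. K \<subseteq> A \<and> compact K}. emeasure ?M K)"
    using A fin by (intro inner_regular) (simp_all add: M)
  moreover have "(SUP K\<in>{K. K \<subseteq> A \<and> compact K}. emeasure ?M K) = (SUP K\<in>{K. K \<subseteq> A \<and> compact K}. emeasure lborel K)"
    by (intro SUP_cong refl) (auto simp: M borel_compact Int_absorb1)
  ultimately show ?thesis using A by (simp add: M)
qed

lemma brunn_minkowski_real:
  fixes A B C :: "real set"
  assumes A: "A \<in> sets borel" "A \<noteq> {}" "emeasure lborel A \<noteq> \<infinity>" 
    and B: "B \<in> sets borel" "B \<noteq> {}" "emeasure lborel B \<noteq> \<infinity>" and C: "C \<in> sets borel"
    and mid: "\<And>a b. a \<in> A \<Longrightarrow> b \<in> B \<Longrightarrow> (a + b) / 2 \<in> C"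
  shows "emeasure lborel A + emeasure lborel B \<le> 2 * emeasure lborel C"
proof -
  let ?KA = "{K. K \<subseteq> A \<and> compact K}" and ?KB = "{K. K \<subseteq> B \<and> compact K}"
  obtain a b where ab: "a \<in> A" "b \<in> B" using A B by blast
  have *: "emeasure lborel K + emeasure lborel L \<le> 2 * emeasure lborel C" if "K \<in> ?KA" "L \<in> ?KB" for K L
  proof -
    \<comment> \<open>A compact subset may be empty; adding a point of \<open>A\<close> and one of
      \<open>B\<close> keeps the compact case applicable.\<close>
    have "emeasure lborel (insert a K) + emeasure lborel (insert b L) \<le> 2 * emeasure lborel C"
      using that ab mid C by (intro brunn_minkowski_real_compact) (auto simp: subset_iff)
    moreover have "emeasure lborel K \<le> emeasure lborel (insert a K)" "emeasure lborel L \<le> emeasure lborel (insert b L)"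
      using that by (auto intro!: emeasure_mono borel_compact)
    ultimately show ?thesis by (meson add_mono order_trans)
  qed
  have "emeasure lborel A + emeasure lborel B = (SUP K\<in>?KA. emeasure lborel K) + (SUP L\<in>?KB. emeasure lborel L)"
    using emeasure_inner_compact A B by simp
  also have "\<dots> = (SUP K\<in>?KA. emeasure lborel K + (SUP L\<in>?KB. emeasure lborel L))"
    by (rule ennreal_SUP_add_left[symmetric]) auto
  also have "\<dots> = (SUP K\<in>?KA. SUP L\<in>?KB. emeasure lborel K + emeasure lborel L)"
    by (intro SUP_cong refl ennreal_SUP_add_right) auto
  also have "\<dots> \<le> 2 * emeasure lborel C" using * by (intro SUP_least) auto
  finally show ?thesis .
qed

lemma nn_integral_layer_cake:
  fixes F :: "'a::euclidean_space \<Rightarrow> real"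
  assumes [measurable]: "F \<in> borel_measurable borel"
  shows "(\<integral>\<^sup>+x. ennreal (F x) \<partial>lborel) = (\<integral>\<^sup>+s. indicator {0<..} s * emeasure lborel {x. s < F x} \<partial>lborel)"
proof -
  have "(\<integral>\<^sup>+x. ennreal (F x) \<partial>lborel) = (\<integral>\<^sup>+x. (\<integral>\<^sup>+s. indicator {0<..} s * indicator {..<F x} s \<partial>lborel) \<partial>lborel)"
  proof (rule nn_integral_cong)
    fix x
    have "(\<integral>\<^sup>+s. indicator {0<..} s * indicator {..<F x} s \<partial>lborel) = (\<integral>\<^sup>+s. indicator {0<..<F x} s \<partial>lborel)"
      by (rule nn_integral_cong) (auto simp: indicator_def)
    also have "\<dots> = ennreal (F x)"
      by (cases "0 \<le> F x") (auto simp: ennreal_neg)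
    finally show "ennreal (F x) = (\<integral>\<^sup>+s. indicator {0<..} s * indicator {..<F x} s \<partial>lborel)" by simp
  qed
  also have "\<dots> = (\<integral>\<^sup>+x. (\<integral>\<^sup>+s. indicator {0<..} s * indicator {(s, x). s < F x} (s, x) \<partial>lborel) \<partial>lborel)"
    by (intro nn_integral_cong) (auto simp: indicator_def)
  also have "\<dots> = (\<integral>\<^sup>+s. (\<integral>\<^sup>+x. indicator {0<..} s * indicator {(s, x). s < F x} (s, x) \<partial>lborel) \<partial>lborel)"
    by (rule lborel_pair.Fubini') measurable
  also have "\<dots> = (\<integral>\<^sup>+s. indicator {0<..} s * emeasure lborel {x. s < F x} \<partial>lborel)"
  proof (rule nn_integral_cong)
    fix s :: real
    have "(\<integral>\<^sup>+x. indicator {0<..} s * indicator {(s, x). s < F x} (s, x) \<partial>lborel)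
      = (\<integral>\<^sup>+x. indicator {0<..} s * indicator {x. s < F x} x \<partial>lborel)"
      by (rule nn_integral_cong) (auto simp: indicator_def)
    then show "(\<integral>\<^sup>+x. indicator {0<..} s * indicator {(s, x). s < F x} (s, x) \<partial>lborel) = indicator {0<..} s * emeasure lborel {x. s < F x}"
      by (simp add: nn_integral_cmult_indicator)
  qed
  finally show ?thesis .
qed

text \<open>When both suprema are 1, the sets \<open>{f > s}\<close> and \<open>{g > s}\<close> are
  nonempty for the same levels, all \<open>s < 1\<close>, and midpoints between them fall into
  \<open>{h > s}\<close>. The one-dimensional Brunn-Minkowski inequality is then integrated over
  \<open>s\<close>. This is where an arithmetic mean comes out instead of a geometric one.\<close>

lemma prekopa_leindler_normalized:
  fixes f g h :: "real \<Rightarrow> real"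
  assumes [measurable]: "f \<in> borel_measurable borel" "g \<in> borel_measurable borel" "h \<in> borel_measurable borel"
    and f: "integrable lborel f" "\<And>x. 0 \<le> f x" "\<And>x. f x \<le> 1" "\<And>s. s < 1 \<Longrightarrow> \<exists>x. s < f x"
    and g: "integrable lborel g" "\<And>x. 0 \<le> g x" "\<And>x. g x \<le> 1" "\<And>s. s < 1 \<Longrightarrow> \<exists>x. s < g x"
    and h: "integrable lborel h" "\<And>x. 0 \<le> h x"
    and mid: "\<And>x y. f x * g y \<le> (h ((x + y) / 2))\<^sup>2"
  shows "integral\<^sup>L lborel f + integral\<^sup>L lborel g \<le> 2 * integral\<^sup>L lborel h"
proof -
  have fin: "emeasure lborel {x. s < F x} \<noteq> \<infinity>" if F: "integrable lborel F" "s > 0" for s and F :: "real \<Rightarrow> real"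
  proof -
    have [measurable]: "F \<in> borel_measurable borel" using F(1) by auto
    have "ennreal s * emeasure lborel {x. s < F x} = (\<integral>\<^sup>+x. ennreal s * indicator {x. s < F x} x \<partial>lborel)"
      by (simp add: nn_integral_cmult_indicator)
    also have "\<dots> \<le> (\<integral>\<^sup>+x. ennreal (F x) \<partial>lborel)"
      by (intro nn_integral_mono) (auto simp: indicator_def intro!: ennreal_leI)
    also have "\<dots> < \<infinity>" using F(1) by (simp add: real_integrable_def less_top)
    finally show ?thesis using \<open>s > 0\<close> by (auto simp: ennreal_mult_eq_top_iff)
  qed
  have key: "emeasure lborel {x. s < f x} + emeasure lborel {x. s < g x} \<le> 2 * emeasure lborel {x. s < h x}" if s: "0 < s" for s
  proof (cases "s < 1")
    case True
    show ?thesis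
    proof (rule brunn_minkowski_real)
      show "{x. s < f x} \<noteq> {}" "{x. s < g x} \<noteq> {}" using f(4) g(4) True by auto
      show "emeasure lborel {x. s < f x} \<noteq> \<infinity>" "emeasure lborel {x. s < g x} \<noteq> \<infinity>" using fin f(1) g(1) s by auto
      fix a b assume "a \<in> {x. s < f x}" "b \<in> {x. s < g x}"
      then have "s * s < f a * g b" using s by (intro mult_strict_mono) auto
      also have "\<dots> \<le> (h ((a + b) / 2))\<^sup>2" by (rule mid)
      finally have "s\<^sup>2 < (h ((a + b) / 2))\<^sup>2" by (simp add: power2_eq_square)
      then show "(a + b) / 2 \<in> {x. s < h x}" using h(2) by (auto intro: power_less_imp_less_base)
    qed measurable
  next
    case False
    then have "{x. s < f x} = {}" "{x. s < g x} = {}" using f(3) g(3) by (auto simp: not_less intro: order_trans)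
    then show ?thesis by (simp only:) simp
  qed
  have "ennreal (integral\<^sup>L lborel f + integral\<^sup>L lborel g) = (\<integral>\<^sup>+x. f x \<partial>lborel) + (\<integral>\<^sup>+x. g x \<partial>lborel)"
    using f g by (simp add: nn_integral_eq_integral ennreal_plus)
  also have "\<dots> = (\<integral>\<^sup>+s. indicator {0<..} s * emeasure lborel {x. s < f x} + indicator {0<..} s * emeasure lborel {x. s < g x} \<partial>lborel)"
    by (simp add: nn_integral_layer_cake nn_integral_add)
  also have "\<dots> \<le> (\<integral>\<^sup>+s. 2 * (indicator {0<..} s * emeasure lborel {x. s < h x}) \<partial>lborel)"
    using key by (intro nn_integral_mono) (auto simp: indicator_def)
  also have "\<dots> = 2 * (\<integral>\<^sup>+s. indicator {0<..} s * emeasure lborel {x. s < h x} \<partial>lborel)"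
    by (intro nn_integral_cmult) measurable
  also have "\<dots> = 2 * (\<integral>\<^sup>+x. h x \<partial>lborel)"
    by (simp add: nn_integral_layer_cake)
  also have "\<dots> = ennreal (2 * integral\<^sup>L lborel h)"
    using h by (simp add: nn_integral_eq_integral ennreal_mult')
  finally show ?thesis using h by (simp add: ennreal_le_iff)
qed

text \<open>Dividing \<open>f\<close> and \<open>g\<close> by their suprema \<open>a\<close> and
  \<open>b\<close>, and \<open>h\<close> by \<open>sqrt (a * b)\<close>, preserves the midpoint
  inequality and reaches the normalized case; the inequality of arithmetic and geometric means
  returns to the product.\<close>

lemma prekopa_leindler_real:
  fixes f g h :: "real \<Rightarrow> real"
  assumes f: "integrable lborel f" "\<And>x. 0 \<le> f x" "\<And>x. f x \<le> B"
    and g: "integrable lborel g" "\<And>x. 0 \<le> g x" "\<And>x. g x \<le> B"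
    and h: "integrable lborel h" "\<And>x. 0 \<le> h x"
    and mid: "\<And>x y. f x * g y \<le> (h ((x + y) / 2))\<^sup>2"
  shows "integral\<^sup>L lborel f * integral\<^sup>L lborel g \<le> (integral\<^sup>L lborel h)\<^sup>2"
proof -
  define a where "a = Sup (range f)"
  define b where "b = Sup (range g)"
  have bdd: "bdd_above (range f)" "bdd_above (range g)" using f(3) g(3) by (auto intro!: bdd_aboveI2[where M = B])
  have fa: "f x \<le> a" for x unfolding a_def using bdd by (intro cSup_upper) auto
  have gb: "g x \<le> b" for x unfolding b_def using bdd by (intro cSup_upper) auto
  have a0: "0 \<le> a" "0 \<le> b" using fa[of 0] f(2)[of 0] gb[of 0] g(2)[of 0] by linarith+
  show ?thesis
  proof (cases "a = 0 \<or> b = 0")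
    case True
    then have "f = (\<lambda>x. 0) \<or> g = (\<lambda>x. 0)"
      using fa gb f(2) g(2) by (metis antisym ext)
    then show ?thesis by auto
  next
    case False
    then have ab: "a > 0" "b > 0" using a0 by auto
    define c where "c = sqrt (a * b)"
    have c: "c > 0" "c\<^sup>2 = a * b" using ab by (auto simp: c_def)
    have ex: "\<exists>x. s < F x / S" if "s < 1" "S = Sup (range F)" "S > 0" "bdd_above (range F)" for s S and F :: "real \<Rightarrow> real"
    proof -
      have "s * S < Sup (range F)" using that by simp
      then have "\<exists>x. s * S < F x" using less_cSup_iff[OF _ that(4)] by auto
      then show ?thesis using that(3) by (auto simp: field_simps)
    qed
    have "integral\<^sup>L lborel (\<lambda>x. f x / a) + integral\<^sup>L lborel (\<lambda>x. g x / b) \<le> 2 * integral\<^sup>L lborel (\<lambda>x. h x / c)"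
    proof (rule prekopa_leindler_normalized)
      show "f x / a * (g y / b) \<le> (h ((x + y) / 2) / c)\<^sup>2" for x y
        using mid[of x y] ab by (simp add: power_divide c(2) divide_right_mono)
      show "\<exists>x. s < f x / a" "\<exists>x. s < g x / b" if "s < 1" for s
        using ex[OF that a_def ab(1) bdd(1)] ex[OF that b_def ab(2) bdd(2)] by auto
    qed (use f g h ab c fa gb in \<open>auto simp: divide_le_eq_1\<close>)
    then have le: "integral\<^sup>L lborel f / a + integral\<^sup>L lborel g / b \<le> 2 * (integral\<^sup>L lborel h / c)"
      by simp
    define u v w where "u = integral\<^sup>L lborel f / a" and "v = integral\<^sup>L lborel g / b" and "w = integral\<^sup>L lborel h / c"
    have uv: "u \<ge> 0" "v \<ge> 0" using f g ab by (auto simp: u_def v_def intro!: divide_nonneg_nonneg integral_nonneg_AE)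
    have "4 * (u * v) \<le> (u + v)\<^sup>2" using zero_le_power2[of "u - v"] by (simp add: power2_eq_square algebra_simps)
    also have "\<dots> \<le> (2 * w)\<^sup>2" using le uv by (intro power_mono) (auto simp: u_def v_def w_def)
    finally have "u * v \<le> w\<^sup>2" by (simp add: power_mult_distrib)
    then have "(u * v) * (a * b) \<le> w\<^sup>2 * c\<^sup>2" unfolding c(2) using ab by (intro mult_right_mono) auto
    then show ?thesis using ab c(1) by (simp add: u_def v_def w_def power_divide)
  qed
qed

text \<open>Squares in place of logarithms admit the value 0. Boundedness and bounded support make
  marginals integrable and pass on to them, so that integrating out one variable can be
  repeated.\<close>

definition midpoint_log_concave :: "('a::euclidean_space \<Rightarrow> real) \<Rightarrow> bool" where
  "midpoint_log_concave \<phi> \<longleftrightarrow> \<phi> \<in> borel_measurable borel \<and> (\<forall>x. 0 \<le> \<phi> x) \<and>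
     (\<exists>B. \<forall>x. \<phi> x \<le> B) \<and> bounded {x. \<phi> x \<noteq> 0} \<and>
     (\<forall>x y. \<phi> x * \<phi> y \<le> (\<phi> ((1/2) *\<^sub>R (x + y)))\<^sup>2)"

text \<open>Prekopa's theorem for one integrated variable: the slices at \<open>z\<close>, at
  \<open>w\<close> and at their midpoint satisfy the hypothesis of
  \<open>prekopa_leindler_real\<close>.\<close>

lemma midpoint_log_concave_marginal:
  fixes \<phi> :: "real \<times> 'b::euclidean_space \<Rightarrow> real"
  assumes "midpoint_log_concave \<phi>"
  shows "midpoint_log_concave (\<lambda>z. \<integral>x. \<phi> (x, z) \<partial>lborel)" "integrable lborel (\<lambda>x. \<phi> (x, z))"
proof -
  obtain B where [measurable]: "\<phi> \<in> borel_measurable borel" and nn: "\<And>p. 0 \<le> \<phi> p" and B: "\<And>p. \<phi> p \<le> B"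
    and bd: "bounded {p. \<phi> p \<noteq> 0}" and mid: "\<And>p q. \<phi> p * \<phi> q \<le> (\<phi> ((1/2) *\<^sub>R (p + q)))\<^sup>2"
    using assms unfolding midpoint_log_concave_def by blast
  have [measurable]: "\<phi> \<in> borel_measurable (borel \<Otimes>\<^sub>M borel)" by (simp add: borel_prod)
  obtain D where D: "\<And>p. \<phi> p \<noteq> 0 \<Longrightarrow> norm p \<le> D" using bd by (auto simp: bounded_iff)
  have B0: "0 \<le> B" using nn[of undefined] B[of undefined] by linarith
  have D': "\<bar>x\<bar> \<le> \<bar>D\<bar> \<and> norm z \<le> \<bar>D\<bar>" if "\<phi> (x, z) \<noteq> 0" for x z
    using D[OF that] norm_fst_le[of x z] norm_snd_le[of z x] by auto
  have dom: "\<phi> (x, z) \<le> B * indicator {-\<bar>D\<bar>..\<bar>D\<bar>} x" for x z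
    using D'[of x z] B[of "(x, z)"] B0 by (cases "\<phi> (x, z) = 0") (auto simp: indicator_def)
  have idom: "integrable lborel (\<lambda>x. B * indicator {-\<bar>D\<bar>..\<bar>D\<bar>} x)" by simp
  show int: "integrable lborel (\<lambda>x. \<phi> (x, z))" for z
    by (rule Bochner_Integration.integrable_bound[OF idom]) (use dom[of _ z] nn in \<open>auto intro!: order_trans[OF _ abs_ge_self]\<close>)
  show "midpoint_log_concave (\<lambda>z. \<integral>x. \<phi> (x, z) \<partial>lborel)"
    unfolding midpoint_log_concave_def
  proof (intro conjI allI)
    show "(\<lambda>z. \<integral>x. \<phi> (x, z) \<partial>lborel) \<in> borel_measurable borel" by measurable
    show "0 \<le> (\<integral>x. \<phi> (x, z) \<partial>lborel)" for z using nn by simp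
    have "(\<integral>x. \<phi> (x, z) \<partial>lborel) \<le> (\<integral>x. B * indicator {-\<bar>D\<bar>..\<bar>D\<bar>} x \<partial>lborel)" for z
      using dom by (intro integral_mono int idom) auto
    then show "\<exists>B. \<forall>z. (\<integral>x. \<phi> (x, z) \<partial>lborel) \<le> B" by blast
    have "norm z \<le> \<bar>D\<bar>" if "(\<integral>x. \<phi> (x, z) \<partial>lborel) \<noteq> 0" for z
    proof (rule ccontr)
      assume "\<not> norm z \<le> \<bar>D\<bar>"
      then have "(\<lambda>x. \<phi> (x, z)) = (\<lambda>x. 0)" using D' by blast
      then show False using that by simp
    qed
    then show "bounded {z. (\<integral>x. \<phi> (x, z) \<partial>lborel) \<noteq> 0}" by (auto simp: bounded_iff)
    show "(\<integral>x. \<phi> (x, z) \<partial>lborel) * (\<integral>x. \<phi> (x, w) \<partial>lborel) \<le> (\<integral>x. \<phi> (x, (1/2) *\<^sub>R (z + w)) \<partial>lborel)\<^sup>2" for z w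
    proof (rule prekopa_leindler_real[where B = B])
      show "\<phi> (x, z) * \<phi> (y, w) \<le> (\<phi> ((x + y) / 2, (1/2) *\<^sub>R (z + w)))\<^sup>2" for x y
        using mid[of "(x, z)" "(y, w)"] by simp
    qed (use int nn B in auto)
  qed
qed

text \<open>Integrating the indicator of \<open>C\<close> over three coordinates, one at a time,
  leaves the section volume as a midpoint log-concave function of \<open>t\<close>. By symmetry of
  \<open>C\<close> it is even, and the midpoint inequality for \<open>t\<close> and
  \<open>- t\<close> compares it with its value at 0.\<close>

lemma section_volume_le_central:
  fixes C :: "(real \<times> real \<times> real \<times> real) set"
  assumes C: "compact C" "convex C" "\<And>p. p \<in> C \<Longrightarrow> - p \<in> C"
  defines "S \<equiv> \<lambda>t. {(x, y, z). (x, y, z, t) \<in> C}"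
  shows "measure lborel (S t) \<le> measure lborel (S 0)"
proof -
  define \<phi> where "\<phi> = (indicator C :: _ \<Rightarrow> real)"
  have [measurable]: "C \<in> sets borel" using C by (simp add: borel_compact)
  have m0: "midpoint_log_concave \<phi>"
    unfolding midpoint_log_concave_def \<phi>_def
  proof (intro conjI allI)
    show "\<exists>B. \<forall>x. indicat_real C x \<le> B" by (intro exI[of _ 1]) (auto simp: indicator_def)
    have "{x. indicat_real C x \<noteq> 0} = C" by (auto simp: indicator_def)
    then show "bounded {x. indicat_real C x \<noteq> 0}" using C by (simp add: compact_imp_bounded)
    fix p q
    show "indicat_real C p * indicat_real C q \<le> (indicat_real C ((1/2) *\<^sub>R (p + q)))\<^sup>2"
    proof (cases "p \<in> C \<and> q \<in> C")
      case True
      then have "(1/2) *\<^sub>R p + (1/2) *\<^sub>R q \<in> C" using C(2) by (intro convexD) auto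
      then show ?thesis by (simp add: scaleR_add_right indicator_def)
    qed (auto simp: indicator_def)
  qed (auto simp: indicator_def)
  define \<phi>1 where "\<phi>1 p = (\<integral>x. \<phi> (x, p) \<partial>lborel)" for p
  define \<phi>2 where "\<phi>2 p = (\<integral>y. \<phi>1 (y, p) \<partial>lborel)" for p
  define \<phi>3 where "\<phi>3 t = (\<integral>z. \<phi>2 (z, t) \<partial>lborel)" for t
  have m1: "midpoint_log_concave \<phi>1" unfolding \<phi>1_def by (rule midpoint_log_concave_marginal[OF m0])
  have m2: "midpoint_log_concave \<phi>2" unfolding \<phi>2_def by (rule midpoint_log_concave_marginal[OF m1])
  have m3: "midpoint_log_concave \<phi>3" unfolding \<phi>3_def by (rule midpoint_log_concave_marginal[OF m2])
  have Sm[measurable]: "S t \<in> sets borel" for t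
  proof -
    have "S t = (\<lambda>p. (fst p, fst (snd p), snd (snd p), t)) -` C" by (force simp: S_def)
    moreover have "\<dots> \<in> sets borel"
      by (intro measurable_sets_borel[of _ borel] borel_measurable_continuous_onI continuous_intros) simp
    ultimately show ?thesis by simp
  qed
  have Sb: "bounded (S t)" for t
  proof -
    obtain r where r: "\<And>p. p \<in> C \<Longrightarrow> norm p \<le> r" using compact_imp_bounded[OF C(1)] by (auto simp: bounded_iff)
    have "norm p \<le> r" if "p \<in> S t" for p
    proof -
      obtain x y z where p: "p = (x, y, z)" "(x, y, z, t) \<in> C" using \<open>p \<in> S t\<close> by (auto simp: S_def)
      have "norm p \<le> norm (x, y, z, t)" unfolding p norm_Pair by (auto simp: norm_Pair)
      then show ?thesis using r[OF p(2)] by simp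
    qed
    then show ?thesis unfolding bounded_iff by blast
  qed
  have Sint: "integrable lborel (indicator (S t) :: _ \<Rightarrow> real)" for t
    using emeasure_bounded_finite[OF Sb[of t]] by (intro integrable_real_indicator) simp_all
  have vol: "measure lborel (S t) = \<phi>3 t" for t
  proof -
    have "measure lborel (S t) = (\<integral>p. indicator (S t) p \<partial>(lborel \<Otimes>\<^sub>M (lborel \<Otimes>\<^sub>M lborel)))"
      by (simp add: lborel_prod)
    also have "\<dots> = (\<integral>q. (\<integral>x. indicator (S t) (x, q) \<partial>lborel) \<partial>(lborel \<Otimes>\<^sub>M lborel))"
      using Sint[of t] lborel_pair.integral_snd[of "\<lambda>x q. indicator (S t) (x, q) :: real"]
      by (simp add: lborel_prod case_prod_beta)
    also have "\<dots> = (\<integral>q. \<phi>1 (fst q, snd q, t) \<partial>(lborel \<Otimes>\<^sub>M lborel))"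
      by (intro Bochner_Integration.integral_cong) (auto simp: \<phi>1_def \<phi>_def S_def indicator_def)
    also have "\<dots> = (\<integral>z. (\<integral>y. \<phi>1 (y, z, t) \<partial>lborel) \<partial>lborel)"
    proof -
      have [measurable]: "\<phi>1 \<in> borel_measurable borel" using m1 by (simp add: midpoint_log_concave_def)
      obtain B where B: "\<And>p. 0 \<le> \<phi>1 p" "\<And>p. \<phi>1 p \<le> B" using m1 by (auto simp: midpoint_log_concave_def)
      obtain D where D: "\<And>p. \<phi>1 p \<noteq> 0 \<Longrightarrow> norm p \<le> D" using m1 by (auto simp: midpoint_log_concave_def bounded_iff)
      have "integrable lborel (\<lambda>q::real \<times> real. B * indicator (cball 0 D) q)"
        by (rule integrable_indicator_cball)
      then have "integrable lborel (\<lambda>q. \<phi>1 (fst q, snd q, t))"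
      proof (rule Bochner_Integration.integrable_bound)
        have "(\<lambda>q::real \<times> real. (fst q, snd q, t)) \<in> borel_measurable borel"
          by (intro borel_measurable_continuous_onI continuous_intros)
        then show "(\<lambda>q. \<phi>1 (fst q, snd q, t)) \<in> borel_measurable lborel"
          using measurable_compose[of _ borel borel \<phi>1 borel] by simp
        have "norm (y, z) \<le> D" if "\<phi>1 (y, z, t) \<noteq> 0" for y z
        proof -
          have "norm (y, z) \<le> norm (y, z, t)" by (simp add: norm_Pair)
          then show ?thesis using D[OF that] by linarith
        qed
        then show "AE q in lborel. norm (\<phi>1 (fst q, snd q, t)) \<le> norm (B * indicator (cball 0 D) q)"
        proof (intro always_eventually allI)
          fix q :: "real \<times> real"
          show "norm (\<phi>1 (fst q, snd q, t)) \<le> norm (B * indicator (cball 0 D) q)"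
          proof (cases "\<phi>1 (fst q, snd q, t) = 0")
            case False
            then have "q \<in> cball 0 D" using \<open>\<And>y z. \<phi>1 (y, z, t) \<noteq> 0 \<Longrightarrow> norm (y, z) \<le> D\<close>[of "fst q" "snd q"] by simp
            then show ?thesis using B order_trans[OF B] by simp
          qed simp
        qed
      qed
      then show ?thesis
        using lborel_pair.integral_snd[of "\<lambda>y z. \<phi>1 (y, z, t)"] by (simp add: lborel_prod case_prod_beta')
    qed
    also have "\<dots> = \<phi>3 t" by (simp add: \<phi>3_def \<phi>2_def)
    finally show ?thesis .
  qed
  have "S (- t) = uminus -` S t"
    using C(3) by (auto simp: S_def) (metis minus_minus uminus_Pair)+
  then have "\<phi>3 (- t) = \<phi>3 t"
    using lborel_distr_linear_isometry[of "uminus :: real \<times> real \<times> real \<Rightarrow> _"]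
      measure_distr[of "uminus :: real \<times> real \<times> real \<Rightarrow> _" lborel borel "S t"]
    by (simp add: vol[symmetric] linear_uminus)
  moreover have "\<phi>3 t * \<phi>3 (- t) \<le> (\<phi>3 0)\<^sup>2"
    using m3 unfolding midpoint_log_concave_def by (metis add.right_inverse scaleR_zero_right)
  ultimately have "(\<phi>3 t)\<^sup>2 \<le> (\<phi>3 0)\<^sup>2" by (simp add: power2_eq_square)
  then show ?thesis
    unfolding vol using m3 by (auto simp: midpoint_log_concave_def intro: power2_le_imp_le)
qed

section \<open>Averaging differences of parallel sections over the orthogonal group\<close>

lemma borel_measurable_matrix_vector_mult [measurable (raw)]:
  fixes A :: "'a \<Rightarrow> real^'n^'n" and x :: "'a \<Rightarrow> real^'n"
  assumes "A \<in> borel_measurable M" "x \<in> borel_measurable M"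
  shows "(\<lambda>w. A w *v x w) \<in> borel_measurable M"
proof -
  have "continuous_on UNIV (\<lambda>p :: (real^'n^'n) \<times> (real^'n). fst p *v snd p)"
    unfolding matrix_vector_mult_def by (rule continuous_on_vec_lambda) (intro continuous_intros)
  then have "(\<lambda>p :: (real^'n^'n) \<times> (real^'n). fst p *v snd p) \<in> borel_measurable borel"
    by (rule borel_measurable_continuous_onI)
  from measurable_compose[OF borel_measurable_Pair[OF assms] this] show ?thesis by simp
qed

lemma continuous_on_matrix_vector_mult [continuous_intros]:
  fixes A :: "'a::topological_space \<Rightarrow> real^'n^'n" and x :: "'a \<Rightarrow> real^'n"
  assumes "continuous_on S A" "continuous_on S x"
  shows "continuous_on S (\<lambda>w. A w *v x w)"
  unfolding matrix_vector_mult_def by (rule continuous_on_vec_lambda) (intro continuous_intros assms)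

text \<open>The reflection in the hyperplane orthogonal to \<open>u - v\<close>; for
  \<open>u = v\<close> the quotient is a division by 0, hence 0, and the map is the identity. These
  reflections are the only orthogonal maps that the invariance of Haar measure is applied to: one
  always suffices to move a unit vector to another while fixing what is orthogonal to both.\<close>

definition swap_reflection :: "'a::real_inner \<Rightarrow> 'a \<Rightarrow> 'a \<Rightarrow> 'a" where
  "swap_reflection u v x = x - (2 * ((u - v) \<bullet> x) / ((u - v) \<bullet> (u - v))) *\<^sub>R (u - v)"

lemma linear_swap_reflection: "linear (swap_reflection u v)"
proof -
  define d where "d = u - v"
  show ?thesis
    unfolding swap_reflection_def d_def[symmetric]
    by (intro linearI)
       (simp_all add: inner_add_right distrib_left add_divide_distrib scaleR_left.add scaleR_right_diff_distrib mult.left_commute)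
qed

lemma norm_swap_reflection: "norm (swap_reflection u v x) = norm x"
proof (cases "u = v")
  case False
  define d where "d = u - v"
  define c where "c = 2 * (d \<bullet> x) / (d \<bullet> d)"
  have "d \<bullet> d \<noteq> 0" using False by (simp add: d_def)
  then have c: "c * (d \<bullet> d) = 2 * (d \<bullet> x)" by (simp add: c_def)
  have "(x - c *\<^sub>R d) \<bullet> (x - c *\<^sub>R d) = x \<bullet> x - 2 * (c * (d \<bullet> x)) + c * (c * (d \<bullet> d))"
    by (simp add: inner_diff_left inner_diff_right inner_commute algebra_simps)
  then have "(x - c *\<^sub>R d) \<bullet> (x - c *\<^sub>R d) = x \<bullet> x" unfolding c by simp
  then show ?thesis unfolding swap_reflection_def d_def[symmetric] c_def[symmetric] by (simp add: norm_eq_sqrt_inner)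
qed (simp add: swap_reflection_def)

lemma swap_reflection_swap:
  assumes "norm u = norm v"
  shows "swap_reflection u v u = v"
proof (cases "u = v")
  case False
  have uv: "u \<bullet> u = v \<bullet> v" using assms by (simp add: dot_square_norm)
  have "(u - v) \<bullet> (u - v) = 2 * ((u - v) \<bullet> u)"
    by (simp add: inner_diff_left inner_diff_right inner_commute uv)
  moreover have "(u - v) \<bullet> (u - v) \<noteq> 0" using False by simp
  ultimately have "2 * ((u - v) \<bullet> u) / ((u - v) \<bullet> (u - v)) = 1" by (metis divide_self)
  then show ?thesis unfolding swap_reflection_def by (simp only:) simp
qed (simp add: swap_reflection_def)

lemma swap_reflection_fix: "(u - v) \<bullet> x = 0 \<Longrightarrow> swap_reflection u v x = x"
  by (simp add: swap_reflection_def)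

text \<open>An isometric embedding carries a reflection of the parameter space to one of the ambient
  space. A rotation of \<open>b1\<close> within the span of the section thus acts on the parameters
  of the section by an isometry.\<close>

lemma swap_reflection_linear_isometry:
  assumes "linear J" "\<And>x. norm (J x) = norm x"
  shows "J (swap_reflection u v x) = swap_reflection (J u) (J v) (J x)"
proof -
  have "J x \<bullet> J y = x \<bullet> y" for x y by (rule linear_isometry_inner[OF assms])
  moreover have "J u - J v = J (u - v)" by (simp add: linear_diff[OF assms(1)])
  ultimately show ?thesis
    unfolding swap_reflection_def
    by (simp only:) (subst linear_diff[OF assms(1)], subst linear_scale[OF assms(1)], rule refl)
qed

lemma orthogonal_matrix_linear_isometry:
  fixes f :: "real^'n \<Rightarrow> real^'n"
  assumes "linear f" "\<And>x. norm (f x) = norm x"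
  shows "orthogonal_matrix (matrix f)" "matrix f *v x = f x"
proof -
  have "orthogonal_transformation f" using assms by (simp add: orthogonal_transformation)
  then show "orthogonal_matrix (matrix f)" by (simp only: orthogonal_transformation_matrix)
  show "matrix f *v x = f x" using assms(1) by (simp add: matrix_works)
qed

section \<open>Fubini and scaling for bounded functions of bounded support\<close>

lemma integrable_bounded_support:
  fixes k :: "'a \<times> 'b::euclidean_space \<Rightarrow> real"
  assumes "prob_space M" and [measurable]: "k \<in> borel_measurable (M \<Otimes>\<^sub>M lborel)"
    and B: "\<And>w p. \<bar>k (w, p)\<bar> \<le> B" and R: "\<And>w p. norm p > R \<Longrightarrow> k (w, p) = 0"
  shows "integrable (M \<Otimes>\<^sub>M lborel) k"
proof -
  interpret M: prob_space M by fact
  interpret pair_sigma_finite M "lborel :: 'b measure" by unfold_locales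
  have "integrable (M \<Otimes>\<^sub>M lborel) (\<lambda>q. \<bar>B\<bar> * indicator (space M \<times> cball (0::'b) R) q)"
  proof (intro integrable_mult_right integrable_real_indicator)
    show "emeasure (M \<Otimes>\<^sub>M lborel) (space M \<times> cball (0::'b) R) < \<infinity>"
      using emeasure_bounded_finite[OF bounded_cball[of "0::'b" R]]
      by (subst lborel.emeasure_pair_measure_Times) (simp_all add: M.emeasure_space_1)
  qed simp
  then show ?thesis
  proof (rule Bochner_Integration.integrable_bound)
    show "AE q in M \<Otimes>\<^sub>M lborel. norm (k q) \<le> norm (\<bar>B\<bar> * indicator (space M \<times> cball (0::'b) R) q)"
    proof (rule AE_I2)
      fix q assume "q \<in> space (M \<Otimes>\<^sub>M (lborel :: 'b measure))"
      then obtain w p where q: "q = (w, p)" "w \<in> space M" by (auto simp: space_pair_measure)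
      show "norm (k q) \<le> norm (\<bar>B\<bar> * indicator (space M \<times> cball (0::'b) R) q)"
        using B[of w p] R[of p w] q by (cases "norm p > R") (auto simp: indicator_def)
    qed
  qed simp
qed

lemma integral_swap_bounded_support:
  fixes k :: "'a \<times> 'b::euclidean_space \<Rightarrow> real"
  assumes M: "prob_space M" and k: "k \<in> borel_measurable (M \<Otimes>\<^sub>M lborel)"
    and B: "\<And>w p. \<bar>k (w, p)\<bar> \<le> B" and R: "\<And>w p. norm p > R \<Longrightarrow> k (w, p) = 0"
  shows "(\<integral>w. (\<integral>p. k (w, p) \<partial>lborel) \<partial>M) = (\<integral>p. (\<integral>w. k (w, p) \<partial>M) \<partial>lborel)"
proof -
  interpret M: prob_space M by fact
  interpret pair_sigma_finite M "lborel :: 'b measure" by unfold_locales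
  show ?thesis
    using Fubini_integral[of "\<lambda>w p. k (w, p)"] integrable_bounded_support[OF assms]
    by (simp add: case_prod_beta')
qed

lemma integrable_lborel_bounded_support:
  fixes k :: "'b::euclidean_space \<Rightarrow> real"
  assumes [measurable]: "k \<in> borel_measurable borel"
    and B: "\<And>p. \<bar>k p\<bar> \<le> B" and R: "\<And>p. norm p > R \<Longrightarrow> k p = 0"
  shows "integrable lborel k"
proof -
  have "integrable lborel (\<lambda>q::'b. \<bar>B\<bar> * indicator (cball 0 R) q)"
    by (rule integrable_indicator_cball)
  then show ?thesis
  proof (rule Bochner_Integration.integrable_bound)
    show "AE q in lborel. norm (k q) \<le> norm (\<bar>B\<bar> * indicator (cball 0 R) q)"
    proof (rule AE_I2)
      fix p show "norm (k p) \<le> norm (\<bar>B\<bar> * indicator (cball 0 R) p)"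
        using B[of p] R[of p] by (cases "norm p > R") (auto simp: indicator_def)
    qed
  qed simp
qed

lemma integral_lborel_pair_bounded_support:
  fixes k :: "'a::euclidean_space \<times> 'b::euclidean_space \<Rightarrow> real"
  assumes "k \<in> borel_measurable borel"
    and "\<And>p. \<bar>k p\<bar> \<le> B" and "\<And>p. norm p > R \<Longrightarrow> k p = 0"
  shows "(\<integral>p. k p \<partial>lborel) = (\<integral>x. (\<integral>w. k (x, w) \<partial>lborel) \<partial>lborel)"
  using lborel_pair.integral_fst[of "\<lambda>x w. k (x, w)"] integrable_lborel_bounded_support[OF assms]
  by (simp add: lborel_prod case_prod_beta')

lemma integral_lborel_scale:
  fixes g :: "'a::euclidean_space \<Rightarrow> real"
  assumes [measurable]: "g \<in> borel_measurable borel" and t: "t > 0"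
  shows "(\<integral>w. g w \<partial>lborel) = t ^ DIM('a) * (\<integral>w. g (t *\<^sub>R w) \<partial>lborel)"
proof -
  have "(\<integral>w. g w \<partial>lborel) = (\<integral>w. g w \<partial>density (distr lborel borel (\<lambda>x. 0 + t *\<^sub>R x)) (\<lambda>_. ennreal (\<bar>t\<bar> ^ DIM('a))))"
    using t by (subst lborel_affine[of t 0]) simp_all
  also have "\<dots> = t ^ DIM('a) * (\<integral>w. g (t *\<^sub>R w) \<partial>lborel)"
    using t by (subst integral_real_density) (auto simp: integral_distr)
  finally show ?thesis .
qed

text \<open>The area of a disc is linear in its squared radius, so under planar Lebesgue measure the
  squared norm is distributed as a multiple of length on the half-line. Translating this
  distribution by t^2 gives the same measure as cutting off its part below t^2, that is, discarding
  the disc of radius \<open>t\<close>.\<close>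

lemma integral_plane_shift:
  fixes g :: "real \<Rightarrow> real"
  assumes [measurable]: "g \<in> borel_measurable borel" and t: "t \<ge> 0"
  shows "(\<integral>w. g ((norm (w::real \<times> real))\<^sup>2 + t\<^sup>2) \<partial>lborel)
    = (\<integral>w. g ((norm (w::real \<times> real))\<^sup>2) * indicator {w. t \<le> norm w} w \<partial>lborel)"
proof -
  define \<mu>1 where "\<mu>1 = distr (lborel :: (real \<times> real) measure) borel (\<lambda>w. (norm w)\<^sup>2 + t\<^sup>2)"
  define \<mu>2 where "\<mu>2 = distr (density (lborel :: (real \<times> real) measure) (\<lambda>w. ennreal (indicator {w. t \<le> norm w} w))) borel (\<lambda>w. (norm w)\<^sup>2)"
  define c where "c = unit_ball_vol 2"
  have c0: "c \<ge> 0" by (simp add: c_def)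
  have cb: "emeasure lborel {w::real \<times> real. (norm w)\<^sup>2 \<le> s} = ennreal (c * s)" if "0 \<le> s" for s
  proof -
    have "{w::real \<times> real. (norm w)\<^sup>2 \<le> s} = cball 0 (sqrt s)"
      using that by (auto simp: real_le_rsqrt) (metis norm_ge_zero real_sqrt_le_iff real_sqrt_abs abs_norm_cancel sqrt_le_D)
    then show ?thesis using that by (simp add: emeasure_cball c_def)
  qed
  \<comment> \<open>For s below t^2 the argument of \<open>ennreal\<close> is negative or 0 and is
    truncated to 0, so one formula covers both ranges.\<close>
  have m1: "emeasure \<mu>1 {..s} = ennreal (c * (s - t\<^sup>2))" for s
  proof -
    have "emeasure \<mu>1 {..s} = emeasure lborel {w::real \<times> real. (norm w)\<^sup>2 \<le> s - t\<^sup>2}"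
      unfolding \<mu>1_def by (subst emeasure_distr) (auto intro!: arg_cong2[where f=emeasure])
    also have "\<dots> = ennreal (c * (s - t\<^sup>2))"
    proof (cases "0 \<le> s - t\<^sup>2")
      case True
      then show ?thesis by (rule cb)
    next
      case False
      then have e: "{w::real \<times> real. (norm w)\<^sup>2 \<le> s - t\<^sup>2} = {}"
        by (auto simp: not_le) (smt (verit) zero_le_power2)
      have "c * (s - t\<^sup>2) \<le> 0" using False c0 by (intro mult_nonneg_nonpos) auto
      then show ?thesis unfolding e by (simp add: ennreal_neg)
    qed
    finally show ?thesis .
  qed
  have m2: "emeasure \<mu>2 {..s} = ennreal (c * (s - t\<^sup>2))" for s
  proof -
    have "emeasure \<mu>2 {..s} = emeasure lborel ({w::real \<times> real. t \<le> norm w} \<inter> {w. (norm w)\<^sup>2 \<le> s})"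
    proof -
      have "emeasure \<mu>2 {..s} = (\<integral>\<^sup>+w. ennreal (indicator {w. t \<le> norm w} w) * indicator {w::real \<times> real. (norm w)\<^sup>2 \<le> s} w \<partial>lborel)"
        unfolding \<mu>2_def by (subst emeasure_distr) (auto simp: emeasure_density vimage_def)
      also have "\<dots> = (\<integral>\<^sup>+w. indicator ({w::real \<times> real. t \<le> norm w} \<inter> {w. (norm w)\<^sup>2 \<le> s}) w \<partial>lborel)"
        by (rule nn_integral_cong) (auto simp: indicator_def)
      finally show ?thesis by simp
    qed
    also have "\<dots> = ennreal (c * (s - t\<^sup>2))"
    proof (cases "t\<^sup>2 \<le> s")
      case True
      have "emeasure lborel {w::real \<times> real. norm w < t} = ennreal (c * t\<^sup>2)"
      proof -
        have "{w::real \<times> real. norm w < t} = ball 0 t" by auto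
        then show ?thesis using t by (simp add: emeasure_ball c_def power2_eq_square)
      qed
      moreover have "{w::real \<times> real. t \<le> norm w} \<inter> {w. (norm w)\<^sup>2 \<le> s} = {w. (norm w)\<^sup>2 \<le> s} - {w. norm w < t}" by auto
      moreover have "norm w < t \<Longrightarrow> (norm w)\<^sup>2 \<le> s" for w :: "real \<times> real"
        using True power_mono[of "norm w" t 2] by auto
      ultimately have "emeasure lborel ({w::real \<times> real. t \<le> norm w} \<inter> {w. (norm w)\<^sup>2 \<le> s}) = ennreal (c * s) - ennreal (c * t\<^sup>2)"
        using cb[OF order_trans[OF zero_le_power2 True]] t by (simp only:, subst emeasure_Diff) auto
      also have "\<dots> = ennreal (c * (s - t\<^sup>2))"
        using True t c0 by (simp add: ennreal_minus right_diff_distrib)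
      finally show ?thesis .
    next
      case False
      have "\<not> (norm w)\<^sup>2 \<le> s" if "t \<le> norm w" for w :: "real \<times> real"
        using False power_mono[OF that t, of 2] by linarith
      then have e: "{w::real \<times> real. t \<le> norm w} \<inter> {w. (norm w)\<^sup>2 \<le> s} = {}" by blast
      have "c * (s - t\<^sup>2) \<le> 0" using False c0 by (intro mult_nonneg_nonpos) auto
      then show ?thesis unfolding e by (simp add: ennreal_neg)
    qed
    finally show ?thesis .
  qed
  have "\<mu>1 = \<mu>2"
  proof (rule measure_eqI_generator_eq[of "range (\<lambda>s::real. {..s})" UNIV \<mu>1 \<mu>2 "\<lambda>n. {..real n}"])
    show "Int_stable (range (\<lambda>s::real. {..s}))" by (auto simp: Int_stable_def)
    show "sets \<mu>1 = sigma_sets UNIV (range atMost)" "sets \<mu>2 = sigma_sets UNIV (range atMost)"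
      by (simp_all add: \<mu>1_def \<mu>2_def borel_eq_atMost)
    show "(\<Union>n::nat. {..real n}) = UNIV" using real_arch_simple by auto
  qed (auto simp: m1 m2)
  then have "integral\<^sup>L \<mu>1 g = integral\<^sup>L \<mu>2 g" by simp
  moreover have "integral\<^sup>L \<mu>1 g = (\<integral>w. g ((norm (w::real \<times> real))\<^sup>2 + t\<^sup>2) \<partial>lborel)"
    unfolding \<mu>1_def by (subst integral_distr) auto
  moreover have "integral\<^sup>L \<mu>2 g = (\<integral>w. g ((norm (w::real \<times> real))\<^sup>2) * indicator {w. t \<le> norm w} w \<partial>lborel)"
    unfolding \<mu>2_def by (subst integral_distr) (auto simp: integral_real_density mult.commute)
  ultimately show ?thesis by simp
qed

lemma
  fixes c :: real
  shows cylinder_sets [measurable]: "{p :: 'a::euclidean_space \<times> 'b::euclidean_space. norm (snd p) < c} \<in> sets borel"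
      "{p :: 'a \<times> 'b. c \<le> norm (snd p)} \<in> sets borel"
    and bounded_cylinder_sets [measurable]: "{p :: real \<times> 'b. \<bar>fst p\<bar> \<le> c \<and> norm (snd p) < d} \<in> sets borel"
proof -
  show 1: "{p :: 'a \<times> 'b. norm (snd p) < c} \<in> sets borel" for c
    by (intro borel_open open_Collect_less continuous_intros)
  show "{p :: 'a \<times> 'b. c \<le> norm (snd p)} \<in> sets borel"
    by (intro borel_closed closed_Collect_le continuous_intros)
  have "{p :: real \<times> 'b. \<bar>fst p\<bar> \<le> c} \<in> sets borel"
    by (intro borel_closed closed_Collect_le continuous_intros)
  moreover have "{p :: real \<times> 'b. norm (snd p) < d} \<in> sets borel"
    by (intro borel_open open_Collect_less continuous_intros)
  ultimately have "{p :: real \<times> 'b. \<bar>fst p\<bar> \<le> c} \<inter> {p. norm (snd p) < d} \<in> sets borel" by (rule sets.Int)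
  then show "{p :: real \<times> 'b. \<bar>fst p\<bar> \<le> c \<and> norm (snd p) < d} \<in> sets borel" by (simp add: Int_def)
qed

text \<open>\<open>J\<close> embeds the space of the sections and \<open>e\<close> is the direction
  of the shift; together they stand for four orthonormal vectors. \<open>\<rho>\<close> is
  characterized by strict inequalities, which leaves out only the points at distance exactly
  \<open>\<rho>\<close>, a null set in the limit of the cylinders.\<close>

locale orthogonal_average = prob_space H for H :: "(real^'n^'n) measure" +
  fixes K :: "(real^'n) set" and J :: "real \<times> real \<times> real \<Rightarrow> real^'n" and e :: "real^'n"
    and R :: real and \<rho> :: "real^'n \<Rightarrow> real"
  assumes sets_H [measurable_cong]: "sets H = sets borel"
    and orth_H: "AE Q in H. orthogonal_matrix Q"
    and inv_H: "\<And>R. orthogonal_matrix R \<Longrightarrow> distr H borel (\<lambda>Q. Q ** R) = H"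
    and convex_K: "convex K" and compact_K: "compact K" and sym_K: "\<And>x. x \<in> K \<Longrightarrow> - x \<in> K"
    and K_bound: "\<And>x. x \<in> K \<Longrightarrow> norm x \<le> R"
    and rho_measurable [measurable]: "\<rho> \<in> borel_measurable borel"
    and rho_pos: "\<And>u. norm u = 1 \<Longrightarrow> 0 < \<rho> u"
    and rho_in: "\<And>u x. norm u = 1 \<Longrightarrow> \<bar>x\<bar> < \<rho> u \<Longrightarrow> x *\<^sub>R u \<in> interior K"
    and rho_out: "\<And>u x. norm u = 1 \<Longrightarrow> \<rho> u < \<bar>x\<bar> \<Longrightarrow> x *\<^sub>R u \<notin> K"
    and linear_J: "linear J" and norm_J: "\<And>p. norm (J p) = norm p"
    and norm_e: "norm e = 1" and J_e: "\<And>p. J p \<bullet> e = 0"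
begin

definition "b1 = J (1, 0, 0)"
definition "b2 = J (0, 1, 0)"

text \<open>For orthogonal \<open>Q\<close> the ball is redundant; it makes \<open>section_vol\<close> bounded on all matrices, so
  that Fubini's theorem applies without null sets.\<close>

definition section_vol :: "real \<Rightarrow> real^'n^'n \<Rightarrow> real" where
  "section_vol t Q = (\<integral>p. indicator K (Q *v (J p + t *\<^sub>R e)) * indicator {p. norm p \<le> R} p \<partial>lborel)"

definition weighted_vol :: "(real^'n \<Rightarrow> real) \<Rightarrow> real \<Rightarrow> real" where
  "weighted_vol f t = (\<integral>Q. f (Q *v b1) * section_vol t Q \<partial>H)"

text \<open>The last parameter is the squared distance from the axis, so that a shift by
  \<open>t\<close> along \<open>e\<close> adds t^2 to it; the root restores a representative vector
  in the direction \<open>b2\<close>.\<close>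

definition two_point :: "(real^'n \<Rightarrow> real) \<Rightarrow> real \<Rightarrow> real \<Rightarrow> real" where
  "two_point f x s = (\<integral>Q. f (Q *v b1) * indicator K (Q *v (x *\<^sub>R b1 + sqrt s *\<^sub>R b2)) \<partial>H)"

text \<open>Scaling only the transversal coordinates turns the cylinder of radius \<open>t\<close>
  into one of radius 1. For orthogonal \<open>Q\<close>, \<open>cylinder_vol t Q\<close> below is
  therefore the volume cut out of the cylinder of radius \<open>t\<close> divided by t^2, written as
  an integral over a fixed set, where dominated convergence applies.\<close>

definition stretch :: "real \<Rightarrow> real \<times> real \<times> real \<Rightarrow> real^'n" where
  "stretch t p = J (fst p, t *\<^sub>R snd p)"

definition cylinder_vol :: "real \<Rightarrow> real^'n^'n \<Rightarrow> real" where
  "cylinder_vol t Q = (\<integral>p. indicator K (Q *v stretch t p) * indicator {p. \<bar>fst p\<bar> \<le> R \<and> norm (snd p) < 1} p \<partial>lborel)"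

lemma K_borel [measurable]: "K \<in> sets borel" using compact_K by (rule borel_compact)
lemma J_borel [measurable]: "J \<in> borel_measurable borel" using linear_J by (rule borel_measurable_linear)

lemma stretch_measurable [measurable]: "stretch t \<in> borel_measurable borel"
proof -
  have "(\<lambda>p :: real \<times> real \<times> real. (fst p, t *\<^sub>R snd p)) \<in> borel_measurable borel"
    by (intro borel_measurable_continuous_onI continuous_intros)
  from measurable_compose[OF this J_borel] show ?thesis by (simp add: stretch_def[abs_def])
qed

lemma rho_le: "norm u = 1 \<Longrightarrow> \<rho> u \<le> R"
proof (rule ccontr)
  assume u: "norm u = 1" and "\<not> \<rho> u \<le> R"
  then obtain x where x: "max R 0 < x" "x < \<rho> u" using dense[of "max R 0" "\<rho> u"] rho_pos[OF u] by auto
  then have "x *\<^sub>R u \<in> K" using rho_in[OF u, of x] interior_subset by auto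
  then show False using K_bound[of "x *\<^sub>R u"] u x by simp
qed

lemma J_decomp: "J (x, y, z) = x *\<^sub>R b1 + (y *\<^sub>R b2 + z *\<^sub>R J (0, 0, 1))"
proof -
  have "(x, y, z) = x *\<^sub>R (1, 0, 0) + (y *\<^sub>R (0, 1, 0) + z *\<^sub>R (0, 0, 1 :: real))" by simp
  then show ?thesis unfolding b1_def b2_def by (metis linear_add[OF linear_J] linear_scale[OF linear_J])
qed

lemma J_inner: "J p \<bullet> J q = p \<bullet> q"
  by (rule linear_isometry_inner[OF linear_J norm_J])

lemma e_J: "e \<bullet> J p = 0" using J_e[of p] by (simp add: inner_commute)

lemma norm_shift: "(norm (J p + t *\<^sub>R e))\<^sup>2 = (norm p)\<^sup>2 + t\<^sup>2"
proof -
  have "(norm (J p + t *\<^sub>R e))\<^sup>2 = (norm (J p))\<^sup>2 + t\<^sup>2 * (norm e)\<^sup>2"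
    unfolding power2_norm_eq_inner by (simp add: inner_add_left inner_add_right J_e e_J power2_eq_square)
  then show ?thesis by (simp add: norm_J norm_e)
qed

lemma section_support:
  assumes "orthogonal_matrix Q" "Q *v (J p + t *\<^sub>R e) \<in> K"
  shows "norm p \<le> R"
proof -
  have "norm (J p + t *\<^sub>R e) \<le> R"
    using K_bound[OF assms(2)] by (simp add: norm_orthogonal_matrix_vector[OF assms(1)])
  moreover have "norm p \<le> norm (J p + t *\<^sub>R e)"
    by (rule power2_le_imp_le) (simp_all add: norm_shift)
  ultimately show ?thesis by simp
qed

lemma bounded_cylinder_support:
  fixes p :: "real \<times> real \<times> real"
  assumes "norm p > R + 1"
  shows "\<not> (\<bar>fst p\<bar> \<le> R \<and> norm (snd p) < 1)"
proof -
  have "norm p \<le> norm (fst p) + norm (snd p)" by (metis norm_Pair_le prod.collapse)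
  then show ?thesis using assms by auto
qed

lemma integral_H_mult:
  fixes \<phi> :: "real^'n^'n \<Rightarrow> real"
  assumes "orthogonal_matrix P" and [measurable]: "\<phi> \<in> borel_measurable borel"
  shows "(\<integral>Q. \<phi> (Q ** P) \<partial>H) = (\<integral>Q. \<phi> Q \<partial>H)"
proof -
  have [measurable]: "(\<lambda>Q. Q ** P) \<in> borel_measurable H"
    using borel_measurable_linear[OF linear_matrix_mult_right[of P]] by simp
  have "(\<integral>Q. \<phi> Q \<partial>distr H borel (\<lambda>Q. Q ** P)) = (\<integral>Q. \<phi> (Q ** P) \<partial>H)"
    by (rule integral_distr) simp_all
  then show ?thesis by (simp add: inv_H[OF assms(1)])
qed

text \<open>Reflections fixing \<open>b1\<close> act transitively on the vectors of a given length orthogonal to \<open>b1\<close>.\<close>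

lemma two_point_shift:
  assumes [measurable]: "f \<in> borel_measurable borel"
  shows "(\<integral>Q. f (Q *v b1) * indicator K (Q *v (J p + t *\<^sub>R e)) \<partial>H) = two_point f (fst p) ((norm (snd p))\<^sup>2 + t\<^sup>2)"
proof -
  obtain x y z where p: "p = (x, y, z)" by (cases p)
  define r where "r = sqrt ((norm (snd p))\<^sup>2 + t\<^sup>2)"
  define w where "w = J (0, y, z) + t *\<^sub>R e"
  have w: "norm w = r"
    using norm_shift[of "(0, y, z)" t] by (simp add: r_def p w_def norm_Pair real_sqrt_unique[symmetric])
  have dec: "J p + t *\<^sub>R e = x *\<^sub>R b1 + w"
    using J_decomp[of x y z] J_decomp[of 0 y z] by (simp add: p w_def)
  have b2: "norm b2 = 1" "norm b1 = 1" by (simp_all add: b1_def b2_def norm_J norm_Pair)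
  define h where "h = swap_reflection (r *\<^sub>R b2) w"
  have h: "linear h" "norm (h v) = norm v" for v by (simp_all add: h_def linear_swap_reflection norm_swap_reflection)
  have r0: "r \<ge> 0" by (simp add: r_def)
  have hw: "h (r *\<^sub>R b2) = w" unfolding h_def by (rule swap_reflection_swap) (simp add: w b2 r0)
  have "b2 \<bullet> b1 = 0" "w \<bullet> b1 = 0"
    unfolding b1_def b2_def w_def by (simp_all add: J_inner inner_add_left e_J)
  then have hb: "h b1 = b1" unfolding h_def by (intro swap_reflection_fix) (simp add: inner_diff_left)
  define P where "P = matrix h"
  have P: "orthogonal_matrix P" "P *v v = h v" for v
    unfolding P_def using orthogonal_matrix_linear_isometry[OF h] by auto
  let ?\<phi> = "\<lambda>Q. f (Q *v b1) * indicator K (Q *v (x *\<^sub>R b1 + r *\<^sub>R b2))"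
  have "two_point f x (r\<^sup>2) = (\<integral>Q. ?\<phi> Q \<partial>H)"
    unfolding two_point_def using r0 by simp
  also have "\<dots> = (\<integral>Q. ?\<phi> (Q ** P) \<partial>H)"
    by (rule integral_H_mult[OF P(1), symmetric]) measurable
  also have "\<dots> = (\<integral>Q. f (Q *v b1) * indicator K (Q *v (J p + t *\<^sub>R e)) \<partial>H)"
    unfolding dec by (simp add: matrix_vector_mul_assoc[symmetric] P hb linear_add[OF h(1)] linear_scale[OF h(1), of x] hw)
  finally show ?thesis by (simp add: p r_def)
qed

section \<open>Exact identities for averages with a bounded Borel weight\<close>

context
  fixes f :: "real^'n \<Rightarrow> real" and B :: real
  assumes f_borel [measurable]: "f \<in> borel_measurable borel" and f_bound: "\<And>x. \<bar>f x\<bar> \<le> B"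
begin

lemma B_nonneg: "0 \<le> B" using f_bound[of 0] by linarith

lemma f_ind_bound: "\<bar>f x * indicator X y * indicator Y z\<bar> \<le> B" "\<bar>f x * indicator X y\<bar> \<le> B"
  using f_bound[of x] B_nonneg by (auto simp: indicator_def)

lemma two_point_measurable [measurable]: "(\<lambda>q. two_point f (fst q) (snd q)) \<in> borel_measurable (borel \<Otimes>\<^sub>M borel)"
  unfolding two_point_def by measurable

lemma two_point_compose [measurable (raw)]:
  assumes [measurable]: "X \<in> borel_measurable M" "S \<in> borel_measurable M"
  shows "(\<lambda>w. two_point f (X w) (S w)) \<in> borel_measurable M"
proof -
  have "(\<lambda>w. (X w, S w)) \<in> measurable M (borel \<Otimes>\<^sub>M borel)" by measurable
  from measurable_compose[OF this two_point_measurable] show ?thesis by simp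
qed

lemma two_point_norm_measurable [measurable]:
  "(\<lambda>p. two_point f (fst p) ((norm (snd p :: real \<times> real))\<^sup>2 + c)) \<in> borel_measurable borel"
  by (intro two_point_compose borel_measurable_continuous_onI continuous_intros)

lemma two_point_bound: "\<bar>two_point f x s\<bar> \<le> B"
proof -
  have "\<bar>two_point f x s\<bar> \<le> (\<integral>Q. B \<partial>H)"
    unfolding two_point_def
  proof (rule order_trans[OF integral_abs_bound integral_mono])
    show "integrable H (\<lambda>Q. \<bar>f (Q *v b1) * indicator K (Q *v (x *\<^sub>R b1 + sqrt s *\<^sub>R b2))\<bar>)"
      by (intro integrable_abs integrable_const_bound[of _ B] AE_I2) (simp_all add: f_ind_bound(2))
  qed (simp_all add: f_ind_bound(2))
  then show ?thesis by (simp add: prob_space)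
qed

lemma two_point_support:
  fixes p :: "real \<times> real \<times> real"
  assumes "norm p > R"
  shows "two_point f (fst p) ((norm (snd p))\<^sup>2 + t\<^sup>2) = 0"
proof -
  have "(\<integral>Q. f (Q *v b1) * indicator K (Q *v (J p + t *\<^sub>R e)) \<partial>H) = 0"
  proof (rule integral_eq_zero_AE)
    show "AE Q in H. f (Q *v b1) * indicator K (Q *v (J p + t *\<^sub>R e)) = 0"
      using orth_H
    proof eventually_elim
      case (elim Q)
      then show ?case using section_support[OF elim, of p t] assms by (auto simp: indicator_def)
    qed
  qed
  then show ?thesis using two_point_shift[OF f_borel, of p t] by simp
qed

lemma weighted_vol_eq:
  "weighted_vol f t = (\<integral>p. two_point f (fst p) ((norm (snd p :: real \<times> real))\<^sup>2 + t\<^sup>2) \<partial>lborel)"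
proof -
  have "weighted_vol f t = (\<integral>Q. (\<integral>p. f (Q *v b1) * indicator K (Q *v (J p + t *\<^sub>R e)) * indicator {p. norm p \<le> R} p \<partial>lborel) \<partial>H)"
    unfolding weighted_vol_def section_vol_def by (simp add: mult.assoc)
  also have "\<dots> = (\<integral>p. (\<integral>Q. f (Q *v b1) * indicator K (Q *v (J p + t *\<^sub>R e)) * indicator {p. norm p \<le> R} p \<partial>H) \<partial>lborel)"
  proof -
    define k where "k = (\<lambda>(Q, p). f (Q *v b1) * indicator K (Q *v (J p + t *\<^sub>R e)) * indicator {p. norm p \<le> R} p)"
    have "k \<in> borel_measurable (H \<Otimes>\<^sub>M lborel)" unfolding k_def by measurable
    then have "(\<integral>Q. (\<integral>p. k (Q, p) \<partial>lborel) \<partial>H) = (\<integral>p. (\<integral>Q. k (Q, p) \<partial>H) \<partial>lborel)"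
      by (rule integral_swap_bounded_support[OF prob_space_axioms, where B = B and R = R])
         (auto simp: k_def f_ind_bound(1))
    then show ?thesis by (simp add: k_def)
  qed
  also have "\<dots> = (\<integral>p. two_point f (fst p) ((norm (snd p :: real \<times> real))\<^sup>2 + t\<^sup>2) \<partial>lborel)"
  proof (rule Bochner_Integration.integral_cong[OF refl])
    fix p :: "real \<times> real \<times> real"
    show "(\<integral>Q. f (Q *v b1) * indicator K (Q *v (J p + t *\<^sub>R e)) * indicator {p. norm p \<le> R} p \<partial>H) = two_point f (fst p) ((norm (snd p))\<^sup>2 + t\<^sup>2)"
      using two_point_support[of p t] by (cases "norm p > R") (simp_all add: two_point_shift)
  qed
  finally show ?thesis .
qed

text \<open>An identity for every \<open>t > 0\<close>, not an asymptotic statement. On each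
  transversal plane \<open>integral_plane_shift\<close> trades the shift for a removed disc, so the
  difference is the integral over the cylinder of radius \<open>t\<close>; rescaling the plane to
  the unit disc gives the factor t^2.\<close>

lemma weighted_vol_diff:
  assumes t: "t > 0"
  shows "weighted_vol f 0 - weighted_vol f t = t\<^sup>2 * (\<integral>Q. f (Q *v b1) * cylinder_vol t Q \<partial>H)"
proof -
  define g where "g p = two_point f (fst p) ((norm (snd p))\<^sup>2)" for p :: "real \<times> real \<times> real"
  have [measurable]: "g \<in> borel_measurable borel"
    using two_point_norm_measurable[of 0] by (simp add: g_def[abs_def])
  have gB: "\<bar>g p\<bar> \<le> B" for p unfolding g_def by (rule two_point_bound)
  have gR: "g p = 0" if "norm p > R" for p using two_point_support[OF that, of 0] by (simp add: g_def)
  have gB': "\<bar>g p * indicator X q\<bar> \<le> B" for p q X using gB[of p] B_nonneg by (auto simp: indicator_def)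
  have gi: "integrable lborel (\<lambda>p. g p * indicator {p. t \<le> norm (snd p)} p)"
    using gB' gR by (intro integrable_lborel_bounded_support[of _ B R]) auto
  have "weighted_vol f t = (\<integral>x. (\<integral>w. two_point f (fst (x, w)) ((norm (snd (x, w :: real \<times> real)))\<^sup>2 + t\<^sup>2) \<partial>lborel) \<partial>lborel)"
    unfolding weighted_vol_eq
    by (rule integral_lborel_pair_bounded_support[where B = B and R = R])
       (rule two_point_norm_measurable two_point_bound two_point_support, assumption?)+
  then have "weighted_vol f t = (\<integral>x. (\<integral>w. two_point f x ((norm (w :: real \<times> real))\<^sup>2 + t\<^sup>2) \<partial>lborel) \<partial>lborel)"
    by simp
  also have "\<dots> = (\<integral>x. (\<integral>w. g (x, w) * indicator {p. t \<le> norm (snd p)} (x, w) \<partial>lborel) \<partial>lborel)"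
  proof (rule Bochner_Integration.integral_cong[OF refl])
    fix x
    have "(\<lambda>s. two_point f x s) \<in> borel_measurable borel" by measurable
    from integral_plane_shift[OF this, of t]
    show "(\<integral>w. two_point f x ((norm (w :: real \<times> real))\<^sup>2 + t\<^sup>2) \<partial>lborel) = (\<integral>w. g (x, w) * indicator {p. t \<le> norm (snd p)} (x, w) \<partial>lborel)"
      using t by (simp add: g_def indicator_def)
  qed
  also have "\<dots> = (\<integral>p. g p * indicator {p. t \<le> norm (snd p)} p \<partial>lborel)"
    using gB' gR by (intro integral_lborel_pair_bounded_support[of _ B R, symmetric]) auto
  finally have At: "weighted_vol f t = (\<integral>p. g p * indicator {p. t \<le> norm (snd p)} p \<partial>lborel)" .
  have A0: "weighted_vol f 0 = (\<integral>p. g p \<partial>lborel)" by (simp add: weighted_vol_eq g_def)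
  have "weighted_vol f 0 - weighted_vol f t = (\<integral>p. g p - g p * indicator {p. t \<le> norm (snd p)} p \<partial>lborel)"
    unfolding At A0 using gi gB gR
    by (intro Bochner_Integration.integral_diff[symmetric] integrable_lborel_bounded_support[of g B R]) auto
  also have "\<dots> = (\<integral>p. g p * indicator {p. norm (snd p) < t} p \<partial>lborel)"
    by (intro Bochner_Integration.integral_cong) (auto simp: indicator_def)
  also have "\<dots> = (\<integral>x. (\<integral>w. g (x, w) * indicator {w. norm w < t} w \<partial>lborel) \<partial>lborel)"
  proof -
    have "(\<integral>p. g p * indicator {p. norm (snd p) < t} p \<partial>lborel) = (\<integral>x. (\<integral>w. g (x, w) * indicator {p. norm (snd p) < t} (x, w) \<partial>lborel) \<partial>lborel)"
      by (rule integral_lborel_pair_bounded_support[where B = B and R = R]) (simp_all add: gB' gR)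
    then show ?thesis by (simp add: indicator_def)
  qed
  also have "\<dots> = (\<integral>x. t\<^sup>2 * (\<integral>w. g (x, t *\<^sub>R w) * indicator {w. norm w < 1} w \<partial>lborel) \<partial>lborel)"
  proof (rule Bochner_Integration.integral_cong[OF refl])
    fix x
    have "(\<lambda>w. g (x, w) * indicator {w. norm w < t} w) \<in> borel_measurable borel" by measurable
    from integral_lborel_scale[OF this t]
    show "(\<integral>w. g (x, w) * indicator {w. norm w < t} w \<partial>lborel) = t\<^sup>2 * (\<integral>w. g (x, t *\<^sub>R w) * indicator {w. norm w < 1} w \<partial>lborel)"
      using t by (simp add: indicator_def power2_eq_square)
  qed
  also have "\<dots> = t\<^sup>2 * (\<integral>x. (\<integral>w. g (x, t *\<^sub>R w) * indicator {w. norm w < 1} w \<partial>lborel) \<partial>lborel)"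
    by simp
  also have "(\<integral>x. (\<integral>w. g (x, t *\<^sub>R w) * indicator {w. norm w < 1} w \<partial>lborel) \<partial>lborel)
      = (\<integral>p. g (fst p, t *\<^sub>R snd p) * indicator {p. norm (snd p) < 1} p \<partial>lborel)"
  proof -
    \<comment> \<open>The axial coordinate is bounded by \<open>R\<close> and the rescaled
      transversal one by 1, hence the radius \<open>R + 1\<close>.\<close>
    have "g (fst p, t *\<^sub>R snd p) * indicator {p. norm (snd p) < 1} p = 0" if "norm p > R + 1" for p
    proof (cases "norm (snd p) < 1")
      case True
      have "norm p \<le> norm (fst p) + norm (snd p)" by (metis norm_Pair_le prod.collapse)
      then have "R < norm (fst p)" using that True by simp
      also have "\<dots> \<le> norm (fst p, t *\<^sub>R snd p)" by (rule norm_fst_le)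
      finally show ?thesis using gR by simp
    qed simp
    moreover have "(\<lambda>p. g (fst p, t *\<^sub>R snd p)) \<in> borel_measurable borel"
    proof -
      have "(\<lambda>p :: real \<times> real \<times> real. (fst p, t *\<^sub>R snd p)) \<in> borel_measurable borel"
        by (intro borel_measurable_continuous_onI continuous_intros)
      from measurable_compose[OF this \<open>g \<in> borel_measurable borel\<close>] show ?thesis by simp
    qed
    ultimately have "(\<integral>p. g (fst p, t *\<^sub>R snd p) * indicator {p. norm (snd p) < 1} p \<partial>lborel)
       = (\<integral>x. (\<integral>w. g (fst (x, w), t *\<^sub>R snd (x, w)) * indicator {p. norm (snd p) < 1} (x, w) \<partial>lborel) \<partial>lborel)"
      by (intro integral_lborel_pair_bounded_support[where B = B and R = "R + 1"] borel_measurable_times) (simp_all add: gB')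
    then show ?thesis by (simp add: indicator_def)
  qed
  \<comment> \<open>The bound on \<open>fst p\<close> may be inserted because \<open>g\<close>
    vanishes beyond it. It gives the integrand bounded support for every matrix \<open>Q\<close>,
    orthogonal or not, before the integrals are interchanged.\<close>
  also have "\<dots> = (\<integral>p. (\<integral>Q. f (Q *v b1) * indicator K (Q *v stretch t p) * indicator {p. \<bar>fst p\<bar> \<le> R \<and> norm (snd p) < 1} p \<partial>H) \<partial>lborel)"
  proof (rule Bochner_Integration.integral_cong[OF refl])
    fix p :: "real \<times> real \<times> real"
    let ?p = "(fst p, t *\<^sub>R snd p)"
    have e: "g ?p = (\<integral>Q. f (Q *v b1) * indicator K (Q *v stretch t p) \<partial>H)"
      using two_point_shift[OF f_borel, of ?p 0] by (simp add: g_def stretch_def)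
    have "g ?p = 0" if "R < \<bar>fst p\<bar>"
      using gR[of ?p] that norm_fst_le[of "fst p" "t *\<^sub>R snd p"] by simp
    then show "g ?p * indicator {p. norm (snd p) < 1} p
        = (\<integral>Q. f (Q *v b1) * indicator K (Q *v stretch t p) * indicator {p. \<bar>fst p\<bar> \<le> R \<and> norm (snd p) < 1} p \<partial>H)"
      using e by (cases "R < \<bar>fst p\<bar>") (auto simp: indicator_def)
  qed
  also have "\<dots> = (\<integral>Q. (\<integral>p. f (Q *v b1) * indicator K (Q *v stretch t p) * indicator {p. \<bar>fst p\<bar> \<le> R \<and> norm (snd p) < 1} p \<partial>lborel) \<partial>H)"
  proof -
    define k where "k = (\<lambda>(Q, p). f (Q *v b1) * indicator K (Q *v stretch t p) * indicator {p. \<bar>fst p\<bar> \<le> R \<and> norm (snd p) < 1} p)"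
    have "k \<in> borel_measurable (H \<Otimes>\<^sub>M lborel)" unfolding k_def by measurable
    then have "(\<integral>Q. (\<integral>p. k (Q, p) \<partial>lborel) \<partial>H) = (\<integral>p. (\<integral>Q. k (Q, p) \<partial>H) \<partial>lborel)"
    proof (rule integral_swap_bounded_support[OF prob_space_axioms, where B = B and R = "R + 1"])
      show "\<bar>k (Q, p)\<bar> \<le> B" for Q p by (simp add: k_def f_ind_bound(1))
      show "k (Q, p) = 0" if "norm p > R + 1" for Q p using bounded_cylinder_support[OF that] by (simp add: k_def)
    qed
    then show ?thesis by (simp add: k_def)
  qed
  also have "\<dots> = (\<integral>Q. f (Q *v b1) * cylinder_vol t Q \<partial>H)"
    by (simp add: cylinder_vol_def mult.assoc)
  finally show ?thesis .
qed

end

section \<open>Shrinking cylinders and the limit of the difference quotients\<close>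

lemma cylinder_vol_measurable [measurable]: "cylinder_vol t \<in> borel_measurable borel"
  unfolding cylinder_vol_def by measurable

lemma section_vol_measurable [measurable]: "section_vol t \<in> borel_measurable borel"
  unfolding section_vol_def by measurable

lemma bounded_cylinder_integrable:
  "integrable lborel (indicator {p :: real \<times> real \<times> real. \<bar>fst p\<bar> \<le> R \<and> norm (snd p) < 1} :: _ \<Rightarrow> real)"
proof (rule integrable_lborel_bounded_support[of _ 1 "R + 1"])
  show "\<bar>indicator {p. \<bar>fst p\<bar> \<le> R \<and> norm (snd p) < 1} p\<bar> \<le> (1::real)" for p :: "real \<times> real \<times> real"
    by (simp add: indicator_def)
  show "indicator {p. \<bar>fst p\<bar> \<le> R \<and> norm (snd p) < 1} p = (0::real)" if "norm p > R + 1" for p :: "real \<times> real \<times> real"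
    using bounded_cylinder_support[OF that] by (simp add: indicator_def)
qed simp

definition "disc_area = measure lborel {w :: real \<times> real. norm w < 1}"

lemma disc_area_pos: "disc_area > 0"
proof -
  have "{w :: real \<times> real. norm w < 1} = ball 0 1" by auto
  then show ?thesis
    using unit_ball_vol_pos[of 2] by (simp add: disc_area_def measure_def emeasure_ball)
qed

lemma norm_b1: "norm b1 = 1" by (simp add: b1_def norm_J norm_Pair)

text \<open>As \<open>t\<close> tends to 0, the point \<open>Q *v stretch t p\<close> tends to the
  multiple \<open>fst p\<close> of the unit vector \<open>Q *v b1\<close>. It is eventually inside
  or outside \<open>K\<close> according to whether \<open>\<bar>fst p\<bar>\<close> is below or
  above \<open>\<rho>\<close>, and the two remaining hyperplanes are null. What is left is a
  cylinder of length \<open>2 * \<rho>\<close> over the unit disc.\<close>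

lemma cylinder_vol_tendsto:
  assumes Q: "orthogonal_matrix Q" and t: "t \<longlonglongrightarrow> 0"
  shows "(\<lambda>n. cylinder_vol (t n) Q) \<longlonglongrightarrow> 2 * disc_area * \<rho> (Q *v b1)"
proof -
  define u where "u = Q *v b1"
  have u: "norm u = 1" by (simp add: u_def norm_orthogonal_matrix_vector[OF Q] norm_b1)
  let ?C = "{p :: real \<times> real \<times> real. \<bar>fst p\<bar> \<le> R \<and> norm (snd p) < 1}"
  let ?F = "\<lambda>n p. indicator K (Q *v stretch (t n) p) * indicator ?C p :: real"
  let ?L = "\<lambda>p :: real \<times> real \<times> real. indicator {x. \<bar>x\<bar> < \<rho> u} (fst p) * indicator {w. norm w < 1} (snd p) :: real"
  have null: "AE p in lborel. \<bar>fst (p :: real \<times> real \<times> real)\<bar> \<noteq> \<rho> u"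
  proof -
    have "emeasure (lborel \<Otimes>\<^sub>M lborel) ({\<rho> u, - \<rho> u} \<times> (UNIV :: (real \<times> real) set)) = emeasure lborel {\<rho> u, - \<rho> u} * emeasure lborel (UNIV :: (real \<times> real) set)"
      by (rule lborel.emeasure_pair_measure_Times) simp_all
    also have "emeasure lborel {\<rho> u, - \<rho> u} = 0" by (simp add: emeasure_lborel_countable)
    finally have "{\<rho> u, - \<rho> u} \<times> (UNIV :: (real \<times> real) set) \<in> null_sets lborel"
      by (auto intro!: borel_closed closed_Times simp: null_sets_def lborel_prod)
    then show ?thesis by (rule AE_I') (auto simp: abs_if split: if_splits)
  qed
  have "(\<lambda>n. cylinder_vol (t n) Q) \<longlonglongrightarrow> (\<integral>p. ?L p \<partial>lborel)"
    unfolding cylinder_vol_def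
  proof (rule integral_dominated_convergence[where w = "indicator ?C"])
    show "integrable lborel (indicator ?C :: _ \<Rightarrow> real)" by (rule bounded_cylinder_integrable)
    have "(\<lambda>p :: real \<times> real \<times> real. indicator {x. \<bar>x\<bar> < \<rho> u} (fst p) :: real) \<in> borel_measurable borel"
      "(\<lambda>p :: real \<times> real \<times> real. indicator {w. norm w < 1} (snd p) :: real) \<in> borel_measurable borel"
      by (rule measurable_compose[of _ borel borel], intro borel_measurable_continuous_onI continuous_intros, simp)+
    then show "?L \<in> borel_measurable lborel" by simp
    show "?F n \<in> borel_measurable lborel" for n
      by measurable
    show "AE p in lborel. norm (?F n p) \<le> (indicator ?C p :: real)" for n
      by (intro always_eventually) (auto simp: indicator_def)
    show "AE p in lborel. (\<lambda>n. ?F n p) \<longlonglongrightarrow> ?L p"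
      using null
    proof eventually_elim
      case (elim p)
      have "stretch (t n) p = fst p *\<^sub>R b1 + t n *\<^sub>R J (0, snd p)" for n
        using J_decomp[of "fst p" "t n *\<^sub>R fst (snd p)" "t n *\<^sub>R snd (snd p)"] J_decomp[of 0 "fst (snd p)" "snd (snd p)"]
        by (simp add: stretch_def scaleR_add_right scaleR_prod_def)
      then have eq: "Q *v stretch (t n) p = fst p *\<^sub>R u + t n *\<^sub>R (Q *v J (0, snd p))" for n
        by (simp add: u_def matrix_vector_right_distrib matrix_vector_mult_scaleR)
      have lim: "(\<lambda>n. Q *v stretch (t n) p) \<longlonglongrightarrow> fst p *\<^sub>R u"
        unfolding eq using tendsto_add[OF tendsto_const tendsto_scaleR[OF t tendsto_const], of "fst p *\<^sub>R u" "Q *v J (0, snd p)"] by simp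
      show ?case
      proof (cases "\<bar>fst p\<bar> < \<rho> u")
        case True
        then have "fst p *\<^sub>R u \<in> interior K" by (rule rho_in[OF u])
        then have "eventually (\<lambda>n. Q *v stretch (t n) p \<in> interior K) sequentially"
          using topological_tendstoD[OF lim open_interior] by blast
        then have "eventually (\<lambda>n. ?F n p = ?L p) sequentially"
          by eventually_elim (use interior_subset True rho_le[OF u] in \<open>auto simp: indicator_def\<close>)
        then show ?thesis by (rule tendsto_eventually)
      next
        case False
        then have "fst p *\<^sub>R u \<in> - K" using rho_out[OF u, of "fst p"] elim by auto
        then have "eventually (\<lambda>n. Q *v stretch (t n) p \<in> - K) sequentially"
          using topological_tendstoD[OF lim, of "- K"] compact_imp_closed[OF compact_K] by (simp add: open_Compl)
        then have "eventually (\<lambda>n. ?F n p = ?L p) sequentially"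
          by eventually_elim (use False in \<open>auto simp: indicator_def\<close>)
        then show ?thesis by (rule tendsto_eventually)
      qed
    qed
  qed
  also have "(\<integral>p. ?L p \<partial>lborel) = (\<integral>x. (\<integral>w. ?L (x, w) \<partial>lborel) \<partial>lborel)"
  proof (rule integral_lborel_pair_bounded_support[where B = 1 and R = "R + 1"])
    have "(\<lambda>p :: real \<times> real \<times> real. indicator {x. \<bar>x\<bar> < \<rho> u} (fst p) :: real) \<in> borel_measurable borel"
      "(\<lambda>p :: real \<times> real \<times> real. indicator {w. norm w < 1} (snd p) :: real) \<in> borel_measurable borel"
      by (rule measurable_compose[of _ borel borel], intro borel_measurable_continuous_onI continuous_intros, simp)+
    then show "?L \<in> borel_measurable borel" by simp
    show "\<bar>?L p\<bar> \<le> 1" for p by (auto simp: indicator_def)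
    show "?L p = 0" if "norm p > R + 1" for p
      using bounded_cylinder_support[OF that] rho_le[OF u] by (auto simp: indicator_def)
  qed
  also have "\<dots> = (\<integral>x. indicator {- \<rho> u<..<\<rho> u} x * disc_area \<partial>lborel)"
  proof (rule Bochner_Integration.integral_cong[OF refl])
    fix x
    have "indicator {x. \<bar>x\<bar> < \<rho> u} x = (indicator {- \<rho> u<..<\<rho> u} x :: real)" by (auto simp: indicator_def)
    then show "(\<integral>w. ?L (x, w) \<partial>lborel) = indicator {- \<rho> u<..<\<rho> u} x * disc_area"
      by (simp add: disc_area_def)
  qed
  also have "\<dots> = 2 * disc_area * \<rho> u" using rho_pos[OF u] by simp
  finally show ?thesis by (simp add: u_def)
qed

lemma orth_H_integrable:
  fixes \<phi> :: "real^'n^'n \<Rightarrow> real"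
  assumes [measurable]: "\<phi> \<in> borel_measurable borel" and "\<And>Q. orthogonal_matrix Q \<Longrightarrow> \<bar>\<phi> Q\<bar> \<le> B"
  shows "integrable H \<phi>"
  using orth_H by (intro integrable_const_bound[of _ B]) (auto elim!: eventually_mono intro: assms(2))

theorem weighted_vol_diff_tendsto:
  assumes f[measurable]: "f \<in> borel_measurable borel" and fB: "\<And>x. \<bar>f x\<bar> \<le> B"
    and t: "t \<longlonglongrightarrow> 0" "\<And>n. t n > 0"
  shows "(\<lambda>n. (weighted_vol f 0 - weighted_vol f (t n)) / (t n)\<^sup>2) \<longlonglongrightarrow>
    2 * disc_area * (\<integral>Q. f (Q *v b1) * \<rho> (Q *v b1) \<partial>H)"
proof -
  have "(weighted_vol f 0 - weighted_vol f (t n)) / (t n)\<^sup>2 = (\<integral>Q. f (Q *v b1) * cylinder_vol (t n) Q \<partial>H)" for n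
    using weighted_vol_diff[OF f fB t(2), of n] t(2)[of n] by simp
  moreover have "(\<lambda>n. \<integral>Q. f (Q *v b1) * cylinder_vol (t n) Q \<partial>H) \<longlonglongrightarrow> (\<integral>Q. f (Q *v b1) * (2 * disc_area * \<rho> (Q *v b1)) \<partial>H)"
  proof (rule integral_dominated_convergence)
    let ?c = "measure lborel {p :: real \<times> real \<times> real. \<bar>fst p\<bar> \<le> R \<and> norm (snd p) < 1}"
    have cyl: "\<bar>cylinder_vol s Q\<bar> \<le> ?c" for s Q
    proof -
      have "\<bar>cylinder_vol s Q\<bar> \<le> (\<integral>p. indicator {p :: real \<times> real \<times> real. \<bar>fst p\<bar> \<le> R \<and> norm (snd p) < 1} p \<partial>lborel)"
        unfolding cylinder_vol_def
        by (rule order_trans[OF integral_abs_bound], rule Bochner_Integration.integral_mono_AE'[OF bounded_cylinder_integrable])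
           (auto simp: indicator_def)
      then show ?thesis by simp
    qed
    show "AE Q in H. norm (f (Q *v b1) * cylinder_vol (t n) Q) \<le> B * ?c" for n
      using fB cyl order_trans[OF abs_ge_zero fB] by (intro always_eventually) (auto simp: abs_mult intro!: mult_mono)
    show "AE Q in H. (\<lambda>n. f (Q *v b1) * cylinder_vol (t n) Q) \<longlonglongrightarrow> f (Q *v b1) * (2 * disc_area * \<rho> (Q *v b1))"
      using orth_H by eventually_elim (intro tendsto_intros cylinder_vol_tendsto t)
  qed simp_all
  moreover have "(\<integral>Q. f (Q *v b1) * (2 * disc_area * \<rho> (Q *v b1)) \<partial>H) = 2 * disc_area * (\<integral>Q. f (Q *v b1) * \<rho> (Q *v b1) \<partial>H)"
    unfolding mult.left_commute[of _ "2 * disc_area"] by (rule integral_mult_right_zero)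
  ultimately show ?thesis by simp
qed

text \<open>The reflection swapping \<open>b1\<close> and \<open>J q\<close> fixes \<open>e\<close>
  and maps the range of \<open>J\<close> to itself, so it permutes the points of the section at
  height \<open>t\<close> isometrically and leaves its volume unchanged. Only the argument of
  \<open>f\<close> moves.\<close>

lemma weighted_vol_rotate:
  assumes [measurable]: "f \<in> borel_measurable borel" and q: "norm q = 1"
  shows "(\<integral>Q. f (Q *v J q) * section_vol t Q \<partial>H) = weighted_vol f t"
proof -
  define h where "h = swap_reflection b1 (J q)"
  define h' where "h' = swap_reflection (1, 0, 0) q"
  have h: "linear h" "norm (h v) = norm v" for v by (simp_all add: h_def linear_swap_reflection norm_swap_reflection)
  have h': "linear h'" "norm (h' v) = norm v" for v by (simp_all add: h'_def linear_swap_reflection norm_swap_reflection)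
  have hb: "h b1 = J q" unfolding h_def by (rule swap_reflection_swap) (simp add: norm_b1 norm_J q)
  have he: "h e = e" unfolding h_def by (rule swap_reflection_fix) (simp add: inner_diff_left b1_def J_e)
  have hJ: "h (J p) = J (h' p)" for p
    unfolding h_def h'_def b1_def by (rule swap_reflection_linear_isometry[OF linear_J norm_J, symmetric])
  define P where "P = matrix h"
  have P: "orthogonal_matrix P" "P *v v = h v" for v
    unfolding P_def using orthogonal_matrix_linear_isometry[OF h] by auto
  have sv: "section_vol t (Q ** P) = section_vol t Q" for Q
  proof -
    have [measurable]: "h' \<in> borel_measurable borel" using h'(1) by (rule borel_measurable_linear)
    let ?k = "\<lambda>p. indicator K (Q *v (J p + t *\<^sub>R e)) * indicator {p. norm p \<le> R} p :: real"
    have "section_vol t (Q ** P) = (\<integral>p. ?k (h' p) \<partial>lborel)"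
      unfolding section_vol_def
      by (simp add: matrix_vector_mul_assoc[symmetric] P linear_add[OF h(1)] linear_scale[OF h(1)] he hJ indicator_def h'(2))
    also have "\<dots> = (\<integral>p. ?k p \<partial>distr lborel borel h')"
      by (subst integral_distr) simp_all
    finally show ?thesis
      by (simp add: lborel_distr_linear_isometry[OF h'] section_vol_def)
  qed
  have "weighted_vol f t = (\<integral>Q. f ((Q ** P) *v b1) * section_vol t (Q ** P) \<partial>H)"
    unfolding weighted_vol_def by (rule integral_H_mult[OF P(1), symmetric]) measurable
  then show ?thesis by (simp add: sv matrix_vector_mul_assoc[symmetric] P hb)
qed

section \<open>Brunn's theorem for rotated sections\<close>

lemma section_vol_eq_measure:
  assumes "orthogonal_matrix Q"
  shows "section_vol t Q = measure lborel {p. Q *v (J p + t *\<^sub>R e) \<in> K}"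
proof -
  have [measurable]: "{p. Q *v (J p + t *\<^sub>R e) \<in> K} \<in> sets borel" by measurable
  have "section_vol t Q = (\<integral>p. indicator {p. Q *v (J p + t *\<^sub>R e) \<in> K} p \<partial>lborel)"
    unfolding section_vol_def using section_support[OF assms]
    by (intro Bochner_Integration.integral_cong) (auto simp: indicator_def)
  then show ?thesis by simp
qed

lemma section_vol_mono:
  assumes Q: "orthogonal_matrix Q"
  shows "section_vol t Q \<le> section_vol 0 Q"
proof -
  \<comment> \<open>Joining \<open>J\<close> and \<open>e\<close> gives an isometric embedding of
    four-dimensional space; pulled back along it, \<open>K\<close> is a symmetric convex body whose
    slices in the last coordinate are the parallel sections.\<close>
  define T where "T v = Q *v (J (fst v, fst (snd v), fst (snd (snd v))) + snd (snd (snd v)) *\<^sub>R e)" for v :: "real \<times> real \<times> real \<times> real"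
  define C where "C = T -` K"
  have linT: "linear T"
  proof (rule linearI)
    show "T (v + w) = T v + T w" for v w
      using linear_add[OF linear_J, of "(fst v, fst (snd v), fst (snd (snd v)))" "(fst w, fst (snd w), fst (snd (snd w)))"]
      by (simp add: T_def scaleR_left.add matrix_vector_right_distrib)
    show "T (c *\<^sub>R v) = c *\<^sub>R T v" for c v
      using linear_scale[OF linear_J, of c "(fst v, fst (snd v), fst (snd (snd v)))"]
      by (simp add: T_def matrix_vector_mult_scaleR matrix_vector_right_distrib scaleR_add_right)
  qed
  have normT: "norm (T v) = norm v" for v
  proof -
    have "(norm (T v))\<^sup>2 = (norm v)\<^sup>2"
      by (cases v) (simp add: T_def norm_orthogonal_matrix_vector[OF Q] norm_shift norm_Pair)
    then show ?thesis by simp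
  qed
  have cT: "continuous_on UNIV T" using linT by (simp add: linear_continuous_on linear_conv_bounded_linear)
  have "compact C"
  proof -
    have "closed C" unfolding C_def using cT compact_imp_closed[OF compact_K] by (rule closed_vimage[rotated])
    moreover have "bounded C"
      unfolding bounded_iff C_def using K_bound normT by (metis vimageE)
    ultimately show ?thesis by (simp add: compact_eq_bounded_closed)
  qed
  moreover have "convex C" unfolding C_def using linT convex_K by (rule convex_linear_vimage)
  moreover have "- p \<in> C" if "p \<in> C" for p using that sym_K linear_neg[OF linT] by (simp add: C_def)
  ultimately have "measure lborel {(x, y, z). (x, y, z, t) \<in> C} \<le> measure lborel {(x, y, z). (x, y, z, 0) \<in> C}"
    by (rule section_volume_le_central)
  moreover have "{(x, y, z). (x, y, z, s) \<in> C} = {p. Q *v (J p + s *\<^sub>R e) \<in> K}" for s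
    by (auto simp: C_def T_def)
  ultimately show ?thesis by (simp add: section_vol_eq_measure[OF Q])
qed

end

section \<open>Radial functions and volume in polar coordinates\<close>

lemma emeasure_dilate:
  fixes h :: "'k::euclidean_space \<Rightarrow> real"
  assumes [measurable]: "h \<in> borel_measurable borel" and c: "c > 0" and [measurable]: "Measurable.pred borel P"
  shows "emeasure lborel {x. norm x < c \<and> P (h (sgn x))} = ennreal (c ^ DIM('k)) * emeasure lborel {x. norm x < 1 \<and> P (h (sgn x))}"
proof -
  let ?A = "{x. norm x < c \<and> P (h (sgn x))}" and ?A1 = "{x :: 'k. norm x < 1 \<and> P (h (sgn x))}"
  have [measurable]: "?A \<in> sets borel" "?A1 \<in> sets borel" by measurable
  have "emeasure lborel ?A = emeasure (density (distr lborel borel (\<lambda>x. 0 + c *\<^sub>R x)) (\<lambda>_. ennreal (\<bar>c\<bar> ^ DIM('k)))) ?A"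
    using c by (subst lborel_affine[of c 0]) simp_all
  also have "\<dots> = ennreal (c ^ DIM('k)) * emeasure lborel ((\<lambda>x. c *\<^sub>R x) -` ?A)"
    using c by (simp add: emeasure_density nn_integral_cmult_indicator emeasure_distr)
  also have "(\<lambda>x. c *\<^sub>R x) -` ?A = ?A1" using c by (auto simp: sgn_scaleR)
  finally show ?thesis .
qed

lemma emeasure_polar_simple:
  fixes h :: "'k::euclidean_space \<Rightarrow> real"
  assumes [measurable]: "h \<in> borel_measurable borel" and fin: "finite (range h)" and nn: "\<And>x. 0 \<le> h x"
  shows "emeasure lborel {x. norm x < h (sgn x)} = (\<integral>\<^sup>+x. ennreal (h (sgn x) ^ DIM('k)) * indicator {x. norm x < 1} x \<partial>lborel)"
proof -
  have "emeasure lborel {x. norm x < h (sgn x)} = (\<integral>\<^sup>+x. (\<Sum>c\<in>range h. indicator {x. norm x < c \<and> h (sgn x) = c} x) \<partial>lborel)"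
  proof -
    have "(\<Sum>c\<in>range h. indicator {x. norm x < c \<and> h (sgn x) = c} x) = (indicator {x. norm x < h (sgn x)} x :: ennreal)" for x
    proof -
      have "(\<Sum>c\<in>range h. indicator {x. norm x < c \<and> h (sgn x) = c} x) = (\<Sum>c\<in>range h. if c = h (sgn x) then indicator {x. norm x < h (sgn x)} x else 0 :: ennreal)"
        by (intro sum.cong refl) (auto simp: indicator_def)
      then show ?thesis using fin by simp
    qed
    moreover have "{x :: 'k. norm x < h (sgn x)} \<in> sets borel" by measurable
    ultimately show ?thesis by simp
  qed
  also have "\<dots> = (\<Sum>c\<in>range h. emeasure lborel {x. norm x < c \<and> h (sgn x) = c})"
    by (subst nn_integral_sum) simp_all
  also have "\<dots> = (\<Sum>c\<in>range h. ennreal (c ^ DIM('k)) * emeasure lborel {x. norm x < 1 \<and> h (sgn x) = c})"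
  proof (rule sum.cong[OF refl])
    fix c assume "c \<in> range h"
    then have "c \<ge> 0" using nn by auto
    then consider "c = 0" | "c > 0" by linarith
    then show "emeasure lborel {x. norm x < c \<and> h (sgn x) = c} = ennreal (c ^ DIM('k)) * emeasure lborel {x. norm x < 1 \<and> h (sgn x) = c}"
    proof cases
      case 1
      then have "{x. norm x < c \<and> h (sgn x) = c} = {}" by auto
      then show ?thesis using 1 by simp
    next
      case 2
      then show ?thesis by (rule emeasure_dilate[OF assms(1), where P = "\<lambda>y. y = c"]) simp
    qed
  qed
  also have "\<dots> = (\<integral>\<^sup>+x. (\<Sum>c\<in>range h. ennreal (c ^ DIM('k)) * indicator {x. norm x < 1 \<and> h (sgn x) = c} x) \<partial>lborel)"
    by (subst nn_integral_sum) (simp_all add: nn_integral_cmult_indicator)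
  also have "\<dots> = (\<integral>\<^sup>+x. ennreal (h (sgn x) ^ DIM('k)) * indicator {x. norm x < 1} x \<partial>lborel)"
  proof (rule nn_integral_cong)
    fix x :: 'k
    have "(\<Sum>c\<in>range h. ennreal (c ^ DIM('k)) * indicator {x. norm x < 1 \<and> h (sgn x) = c} x)
       = (\<Sum>c\<in>range h. if c = h (sgn x) then ennreal (h (sgn x) ^ DIM('k)) * indicator {x. norm x < 1} x else 0)"
      by (intro sum.cong refl) (auto simp: indicator_def)
    then show "(\<Sum>c\<in>range h. ennreal (c ^ DIM('k)) * indicator {x. norm x < 1 \<and> h (sgn x) = c} x) = ennreal (h (sgn x) ^ DIM('k)) * indicator {x. norm x < 1} x"
      using fin by simp
  qed
  finally show ?thesis .
qed

text \<open>Polar coordinates with the uniform distribution on the ball in the role of surface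
  measure. On a cone of directions where \<open>h\<close> is constant the formula is homogeneity of
  Lebesgue measure; finitely many cones give functions of finite range, and monotone limits give the
  rest.\<close>

theorem emeasure_polar:
  fixes h :: "'k::euclidean_space \<Rightarrow> real"
  assumes [measurable]: "h \<in> borel_measurable borel" and nn: "\<And>x. 0 \<le> h x"
  shows "emeasure lborel {x. norm x < h (sgn x)} = (\<integral>\<^sup>+x. ennreal (h (sgn x) ^ DIM('k)) * indicator {x. norm x < 1} x \<partial>lborel)"
proof -
  obtain g where g: "\<And>i. simple_function borel (g i)" "incseq g" "\<And>i x. 0 \<le> g i x"
    and bdd: "\<And>x. bdd_above (range (\<lambda>i. g i x))" and sup: "h = (SUP i. g i)"
    using borel_measurable_implies_simple_function_sequence_real[OF assms] by blast
  have lim: "(\<lambda>i. g i x) \<longlonglongrightarrow> h x" for x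
  proof -
    have "incseq (\<lambda>i. g i x)" using g(2) by (auto simp: incseq_def le_fun_def)
    moreover have "h x = (SUP i. g i x)" by (simp add: sup image_comp)
    ultimately show ?thesis using bdd[of x] by (simp add: LIMSEQ_incseq_SUP)
  qed
  have gm[measurable]: "g i \<in> borel_measurable borel" for i
    using borel_measurable_simple_function[OF g(1)] .
  have gf: "finite (range (g i))" for i using simple_functionD(1)[OF g(1), of i] by simp
  have mono: "g i x \<le> g j x" if "i \<le> j" for i j x using g(2) that by (auto simp: incseq_def le_fun_def)
  have le: "g i x \<le> h x" for i x
    using mono by (intro incseq_le[OF _ lim]) (auto simp: incseq_def)
  have "(\<lambda>i. emeasure lborel {x. norm x < g i (sgn x)}) \<longlonglongrightarrow> emeasure lborel (\<Union>i. {x :: 'k. norm x < g i (sgn x)})"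
    by (rule Lim_emeasure_incseq) (auto simp: incseq_def intro: mono less_le_trans)
  \<comment> \<open>The strict inequality makes this exact: a point with
    \<open>norm x < h (sgn x)\<close> is caught by some \<open>g i\<close> even when
    \<open>h\<close> itself is never attained.\<close>
  also have "(\<Union>i. {x :: 'k. norm x < g i (sgn x)}) = {x. norm x < h (sgn x)}"
  proof (intro set_eqI iffI)
    fix x :: 'k assume "x \<in> {x. norm x < h (sgn x)}"
    then have "eventually (\<lambda>i. norm x < g i (sgn x)) sequentially" using order_tendstoD(1)[OF lim] by auto
    then show "x \<in> (\<Union>i. {x. norm x < g i (sgn x)})" by (auto simp: eventually_sequentially)
  qed (auto intro: less_le_trans le)
  finally have 1: "(\<lambda>i. emeasure lborel {x. norm x < g i (sgn x)}) \<longlonglongrightarrow> emeasure lborel {x. norm x < h (sgn x)}" .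
  have 2: "(\<lambda>i. \<integral>\<^sup>+x. ennreal (g i (sgn x) ^ DIM('k)) * indicator {x. norm x < 1} x \<partial>lborel)
     \<longlonglongrightarrow> (\<integral>\<^sup>+x. ennreal (h (sgn x) ^ DIM('k)) * indicator {x. norm x < 1} x \<partial>lborel)"
  proof (rule nn_integral_LIMSEQ)
    show "incseq (\<lambda>i x. ennreal (g i (sgn x) ^ DIM('k)) * indicator {x. norm x < 1} x)"
      by (auto simp: incseq_def le_fun_def intro!: mult_right_mono ennreal_leI power_mono mono g(3))
    show "(\<lambda>i. ennreal (g i (sgn x) ^ DIM('k)) * indicator {x. norm x < 1} x) \<longlonglongrightarrow> ennreal (h (sgn x) ^ DIM('k)) * indicator {x. norm x < 1} x" for x :: 'k
    proof (cases "norm x < 1")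
      case True
      then show ?thesis by (simp add: tendsto_ennrealI tendsto_power lim)
    qed simp
  qed simp
  have "emeasure lborel {x. norm x < g i (sgn x)} = (\<integral>\<^sup>+x. ennreal (g i (sgn x) ^ DIM('k)) * indicator {x. norm x < 1} x \<partial>lborel)" for i
    by (rule emeasure_polar_simple[OF gm gf g(3)])
  then show ?thesis using LIMSEQ_unique[OF 1] 2 by simp
qed

section \<open>Radial functions of compact star-shaped sets\<close>

locale star_shaped =
  fixes K :: "(real^'n) set"
  assumes compact: "compact K" and zero: "0 \<in> K" and star: "\<And>x t. x \<in> K \<Longrightarrow> t \<in> {0..1} \<Longrightarrow> t *\<^sub>R x \<in> K"
begin

lemma ray: 
  assumes "x \<noteq> 0"
  shows "{r. 0 \<le> r \<and> r *\<^sub>R x \<in> K} = {0..radial K x}"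
proof -
  let ?S = "{r. 0 \<le> r \<and> r *\<^sub>R x \<in> K}"
  obtain B where B: "\<And>y. y \<in> K \<Longrightarrow> norm y \<le> B" using compact_imp_bounded[OF compact] by (auto simp: bounded_iff)
  have bdd: "bdd_above ?S"
  proof (rule bdd_aboveI)
    fix r assume "r \<in> ?S"
    then have "r * norm x \<le> B" using B[of "r *\<^sub>R x"] by simp
    then show "r \<le> B / norm x" using assms by (simp add: field_simps)
  qed
  have "closed ?S"
  proof -
    have "?S = {0..} \<inter> (\<lambda>r. r *\<^sub>R x) -` K" by auto
    then show ?thesis using compact_imp_closed[OF compact]
      by (auto intro!: closed_Int continuous_closed_vimage continuous_intros)
  qed
  moreover have "0 \<in> ?S" using zero by simp
  ultimately have S: "radial K x \<in> ?S" unfolding radial_def using bdd by (intro closed_contains_Sup) auto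
  show ?thesis
  proof (intro set_eqI iffI)
    fix r assume "r \<in> ?S"
    then show "r \<in> {0..radial K x}" using bdd by (auto simp: radial_def intro: cSup_upper)
  next
    fix r assume r: "r \<in> {0..radial K x}"
    show "r \<in> ?S"
    proof (cases "radial K x = 0")
      case True
      then show ?thesis using r zero by auto
    next
      case False
      then have "(r / radial K x) *\<^sub>R (radial K x *\<^sub>R x) \<in> K" using r S star[of "radial K x *\<^sub>R x" "r / radial K x"] by auto
      then show ?thesis using r False by simp
    qed
  qed
qed

lemma radial_nonneg:
  assumes "x \<noteq> 0"
  shows "0 \<le> radial K x"
proof -
  have "0 \<in> {r. 0 \<le> r \<and> r *\<^sub>R x \<in> K}" using zero by simp
  then show ?thesis unfolding ray[OF assms] by simp
qed

lemma mem_iff: "x \<noteq> 0 \<Longrightarrow> 0 \<le> r \<Longrightarrow> r *\<^sub>R x \<in> K \<longleftrightarrow> r \<le> radial K x"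
  using ray[of x] by (auto simp: set_eq_iff)

lemma mem_iff_norm: "x \<noteq> 0 \<Longrightarrow> x \<in> K \<longleftrightarrow> norm x \<le> radial K (sgn x)"
  using mem_iff[of "sgn x" "norm x"] by (simp add: sgn_zero_iff sgn_div_norm)

lemma radial_eq_sgn:
  assumes "x \<noteq> 0"
  shows "radial K x = radial K (sgn x) / norm x"
proof -
  have "r \<le> radial K x \<longleftrightarrow> r \<le> radial K (sgn x) / norm x" if "0 \<le> r" for r
  proof -
    have "r *\<^sub>R x = (r * norm x) *\<^sub>R sgn x" using assms by (simp add: sgn_div_norm)
    then show ?thesis
      using mem_iff[OF assms that] mem_iff[of "sgn x" "r * norm x"] that assms by (simp add: sgn_zero_iff field_simps)
  qed
  moreover have "0 \<le> radial K x" "0 \<le> radial K (sgn x) / norm x"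
    using radial_nonneg assms by (simp_all add: sgn_zero_iff)
  ultimately show ?thesis by (meson antisym order.refl)
qed

lemma indicator_sphere_radial_borel:
  assumes "continuous_on (sphere 0 1) (radial K)"
  shows "(\<lambda>x. indicator (sphere 0 1) x * radial K x) \<in> borel_measurable borel"
proof -
  have "sphere (0 :: real^'n) 1 \<in> sets borel" by (intro borel_closed) simp
  from borel_measurable_continuous_on_indicator[OF this assms] show ?thesis by simp
qed

text \<open>Continuity is given on the sphere only. Off 0 the radial function is homogeneous of
  degree -1 and so determined by its values there; the point 0 is split off,
  \<open>radial K 0\<close> being the supremum of an unbounded set.\<close>

lemma radial_borel:
  assumes "continuous_on (sphere 0 1) (radial K)"
  shows "radial K \<in> borel_measurable borel"
proof -
  let ?g = "\<lambda>x. indicator (sphere 0 1) x * radial K x"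
  have [measurable]: "?g \<in> borel_measurable borel" by (rule indicator_sphere_radial_borel[OF assms])
  have "radial K = (\<lambda>x. if x = 0 then radial K 0 else ?g (sgn x) / norm x)"
    using radial_eq_sgn by (auto simp: fun_eq_iff indicator_def norm_sgn)
  moreover have "(\<lambda>x. if x = 0 then radial K 0 else ?g (sgn x) / norm x) \<in> borel_measurable borel"
    by measurable
  ultimately show ?thesis by simp
qed

lemma measure_linear_isometry:
  fixes T :: "'k::euclidean_space \<Rightarrow> real^'n"
  assumes c: "continuous_on (sphere 0 1) (radial K)" and lin: "linear T" and iso: "\<And>x. norm (T x) = norm x"
  shows "measure lborel (T -` K) = (LINT x:cball 0 1|lborel. radial K (sgn (T x)) ^ DIM('k))"
proof -
  have [measurable]: "T \<in> borel_measurable borel" using lin by (rule borel_measurable_linear)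
  have [measurable]: "K \<in> sets borel" using compact by (rule borel_compact)
  have [measurable]: "T -` K \<in> sets borel" by (rule measurable_sets_borel[of _ borel]) simp_all
  have T0: "T x = 0 \<longleftrightarrow> x = 0" for x using iso[of x] by (metis norm_eq_zero)
  have Ts: "T (sgn x) = sgn (T x)" for x by (simp add: sgn_div_norm linear_scale[OF lin] iso)
  have "compact (radial K ` sphere 0 1)" using c by (rule compact_continuous_image) simp
  then obtain M where M: "\<And>u. norm u = 1 \<Longrightarrow> \<bar>radial K u\<bar> \<le> M" 
    using compact_imp_bounded by (force simp: bounded_iff)
  \<comment> \<open>Cut off outside the sphere, the radial function becomes nonnegative and bounded
    everywhere, in particular at 0.\<close>
  define \<rho> where "\<rho> x = indicator (sphere 0 1) x * radial K x" for x
  have [measurable]: "\<rho> \<in> borel_measurable borel" unfolding \<rho>_def by (rule indicator_sphere_radial_borel[OF c])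
  have rn: "0 \<le> \<rho> x" for x
  proof (cases "norm x = 1")
    case True
    then have "x \<noteq> 0" by auto
    then show ?thesis using radial_nonneg[of x] by (simp add: \<rho>_def indicator_def)
  qed (simp add: \<rho>_def)
  have rs: "\<rho> (T (sgn x)) = radial K (sgn (T x))" if "x \<noteq> 0" for x
    using that by (simp add: \<rho>_def Ts norm_sgn T0)
  define V where "V = (\<integral>\<^sup>+x. ennreal (\<rho> (T (sgn x)) ^ DIM('k)) * indicator {x. norm x < 1} x \<partial>lborel)"
  have polar: "emeasure lborel {x. norm x < s * \<rho> (T (sgn x))} = ennreal (s ^ DIM('k)) * V" if "s > 0" for s
  proof -
    have "(\<integral>\<^sup>+x. ennreal ((s * \<rho> (T (sgn x))) ^ DIM('k)) * indicator {x. norm x < 1} x \<partial>lborel) = ennreal (s ^ DIM('k)) * V"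
    proof -
      have "ennreal ((s * \<rho> (T (sgn x))) ^ DIM('k)) = ennreal (s ^ DIM('k)) * ennreal (\<rho> (T (sgn x)) ^ DIM('k))" for x
        using that rn by (subst ennreal_mult[symmetric]) (simp_all add: power_mult_distrib)
      then show ?thesis unfolding V_def by (simp only: mult.assoc) (rule nn_integral_cmult, measurable)
    qed
    then show ?thesis using emeasure_polar[of "\<lambda>x. s * \<rho> (T x)"] that rn by simp
  qed
  have lower: "V \<le> emeasure lborel (T -` K)"
  proof -
    have "{x. norm x < 1 * \<rho> (T (sgn x))} \<subseteq> T -` K"
    proof
      fix x assume x: "x \<in> {x. norm x < 1 * \<rho> (T (sgn x))}"
      show "x \<in> T -` K"
      proof (cases "x = 0")
        case False
        then show ?thesis using x mem_iff_norm[of "T x"] by (simp add: T0 iso rs)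
      qed (simp add: T0 zero linear_0[OF lin])
    qed
    then have "emeasure lborel {x. norm x < 1 * \<rho> (T (sgn x))} \<le> emeasure lborel (T -` K)"
      by (intro emeasure_mono) auto
    then show ?thesis using polar[of 1] by simp
  qed
  have upper: "emeasure lborel (T -` K) \<le> ennreal (s ^ DIM('k)) * V" if "s > 1" for s
  proof -
    have "T -` K \<subseteq> {0} \<union> {x. norm x < s * \<rho> (T (sgn x))}"
    proof
      fix x assume x: "x \<in> T -` K"
      show "x \<in> {0} \<union> {x. norm x < s * \<rho> (T (sgn x))}"
      proof (cases "x = 0")
        case False
        then have "norm x \<le> \<rho> (T (sgn x))" using x mem_iff_norm[of "T x"] by (simp add: T0 iso rs)
        moreover have "0 < norm x" using False by simp
        ultimately have "0 < \<rho> (T (sgn x))" by linarith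
        then have "\<rho> (T (sgn x)) < s * \<rho> (T (sgn x))" using that by simp
        with \<open>norm x \<le> \<rho> (T (sgn x))\<close> show ?thesis by simp
      qed simp
    qed
    then have "emeasure lborel (T -` K) \<le> emeasure lborel ({0} \<union> {x. norm x < s * \<rho> (T (sgn x))})"
      by (intro emeasure_mono) auto
    also have "\<dots> \<le> emeasure lborel {0::'k} + emeasure lborel {x. norm x < s * \<rho> (T (sgn x))}"
      by (intro emeasure_subadditive) auto
    finally show ?thesis using polar[of s] that by simp
  qed
  have r1: "\<rho> x \<le> \<bar>M\<bar>" for x using M[of x] by (auto simp: \<rho>_def indicator_def)
  have int: "integrable lborel (\<lambda>x. \<rho> (T (sgn x)) ^ DIM('k) * indicator {x. norm x < 1} x)"
  proof (rule Bochner_Integration.integrable_bound)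
    show "integrable lborel (\<lambda>x::'k. \<bar>M\<bar> ^ DIM('k) * indicator {x. norm x < 1} x)"
    proof (intro integrable_mult_right integrable_real_indicator)
      have "{x::'k. norm x < 1} = ball 0 1" by auto
      then show "emeasure lborel {x::'k. norm x < 1} < \<infinity>" by (simp add: emeasure_ball)
    qed simp
    show "AE x in lborel. norm (\<rho> (T (sgn x)) ^ DIM('k) * indicator {x. norm x < 1} x) \<le> norm (\<bar>M\<bar> ^ DIM('k) * indicator {x. norm x < 1} x)"
      using rn r1 by (intro always_eventually) (auto simp: indicator_def intro!: power_mono)
  qed simp
  define I where "I = (\<integral>x. \<rho> (T (sgn x)) ^ DIM('k) * indicator {x. norm x < 1} x \<partial>lborel)"
  have V: "V = ennreal I"
  proof -
    have "V = (\<integral>\<^sup>+x. ennreal (\<rho> (T (sgn x)) ^ DIM('k) * indicator {x. norm x < 1} x) \<partial>lborel)"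
      unfolding V_def by (rule nn_integral_cong) (simp add: indicator_def)
    also have "\<dots> = ennreal I"
      unfolding I_def using rn by (intro nn_integral_eq_integral[OF int]) simp
    finally show ?thesis .
  qed
  have I0: "0 \<le> I" unfolding I_def using rn by (intro integral_nonneg_AE) simp
  have bd: "bounded (T -` K)"
    using compact_imp_bounded[OF compact] iso unfolding bounded_iff by (metis vimageE)
  then have fin: "emeasure lborel (T -` K) = ennreal (measure lborel (T -` K))"
    using emeasure_bounded_finite[OF bd] by (intro emeasure_eq_ennreal_measure) (simp add: less_top)
  have "I \<le> measure lborel (T -` K)" using lower by (simp add: V fin)
  moreover have "measure lborel (T -` K) \<le> I"
  proof -
    have "measure lborel (T -` K) \<le> (1 + 1 / real (Suc n)) ^ DIM('k) * I" for n
      using upper[of "1 + 1 / real (Suc n)"] I0 by (simp add: V fin flip: ennreal_mult)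
    moreover have "(\<lambda>n. (1 + 1 / real (Suc n)) ^ DIM('k) * I) \<longlonglongrightarrow> (1 + 0) ^ DIM('k) * I"
      by (intro tendsto_intros LIMSEQ_Suc[OF lim_1_over_n])
    ultimately show ?thesis by (intro LIMSEQ_le_const) auto
  qed
  moreover have "I = (LINT x:cball 0 1|lborel. radial K (sgn (T x)) ^ DIM('k))"
  proof -
    have sph: "AE x in lborel. norm x \<noteq> 1 \<and> x \<noteq> (0::'k)"
    proof -
      have "sphere (0::'k) 1 \<in> null_sets lborel"
        using negligible_sphere[of "0::'k" 1] by (simp add: negligible_iff_null_sets null_sets_completion_iff)
      then have "AE x in lborel. x \<notin> sphere (0::'k) 1" by (rule AE_not_in)
      then show ?thesis using AE_lborel_singleton[of "0::'k"] by eventually_elim auto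
    qed
    have [measurable]: "radial K \<in> borel_measurable borel" by (rule radial_borel[OF c])
    have "(\<lambda>x. radial K (sgn (T x))) \<in> borel_measurable borel" by measurable
    then have m: "(\<lambda>x. indicator (cball 0 1) x *\<^sub>R radial K (sgn (T x)) ^ DIM('k)) \<in> borel_measurable lborel"
      by (intro borel_measurable_scaleR borel_measurable_power borel_measurable_indicator) simp_all
    show ?thesis
      unfolding I_def set_lebesgue_integral_def
    proof (rule integral_cong_AE)
      show "AE x in lborel. \<rho> (T (sgn x)) ^ DIM('k) * indicator {x. norm x < 1} x = indicator (cball 0 1) x *\<^sub>R radial K (sgn (T x)) ^ DIM('k)"
        using sph by eventually_elim (auto simp: rs indicator_def)
    qed (use m in simp_all)
  qed
  ultimately show ?thesis by simp
qed

end

lemma star_body_star_shaped: "star_body K \<Longrightarrow> star_shaped K"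
  by (auto simp: star_body_def star_shaped_def)

section \<open>Convex bodies and star bodies\<close>

locale symmetric_convex_body =
  fixes K :: "(real^'n) set"
  assumes convex: "convex K" and compact: "compact K" and interior: "interior K \<noteq> {}" and symmetric: "uminus ` K = K"
begin

lemma uminus_mem: "x \<in> K \<Longrightarrow> - x \<in> K" using symmetric by (metis imageI)

lemma uminus_interior: "x \<in> interior K \<Longrightarrow> - x \<in> interior K"
  using interior_negations[of K] symmetric by (metis imageI)

lemma zero_interior: "0 \<in> interior K"
proof -
  obtain x where x: "x \<in> interior K" using interior by blast
  then have "(1/2) *\<^sub>R x + (1/2) *\<^sub>R (- x) \<in> interior K"
    using uminus_interior convex by (intro convexD convex_interior) auto
  then show ?thesis by simp
qed

sublocale star_shaped K
proof
  show "compact K" by (rule compact)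
  show "0 \<in> K" using zero_interior interior_subset by blast
  fix x t assume "x \<in> K" "t \<in> {0..1::real}"
  then have "t *\<^sub>R x + (1 - t) *\<^sub>R 0 \<in> K" using \<open>0 \<in> K\<close> convex by (intro convexD) auto
  then show "t *\<^sub>R x \<in> K" by simp
qed

lemma radial_pos:
  assumes "x \<noteq> 0"
  shows "0 < radial K x"
proof -
  obtain d where d: "d > 0" "cball 0 d \<subseteq> K" using zero_interior by (auto simp: mem_interior_cball)
  have "(d / norm x) *\<^sub>R x \<in> K" using d assms by (intro subsetD[OF d(2)]) auto
  then have "d / norm x \<le> radial K x" using mem_iff[OF assms, of "d / norm x"] d by simp
  moreover have "0 < d / norm x" using d assms by simp
  ultimately show ?thesis by linarith
qed

lemma scaled_in_interior:
  assumes "x \<noteq> 0" "\<bar>r\<bar> < radial K x"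
  shows "r *\<^sub>R x \<in> interior K"
proof -
  have pos: "s *\<^sub>R x \<in> interior K" if "0 \<le> s" "s < radial K x" for s
  proof -
    let ?\<rho> = "radial K x"
    have \<rho>: "?\<rho> > 0" by (rule radial_pos[OF assms(1)])
    have "?\<rho> *\<^sub>R x \<in> K" using mem_iff[OF assms(1), of ?\<rho>] \<rho> by simp
    then have "?\<rho> *\<^sub>R x - (1 - s / ?\<rho>) *\<^sub>R (?\<rho> *\<^sub>R x - 0) \<in> interior K"
      using that \<rho> by (intro mem_interior_convex_shrink[OF convex zero_interior]) auto
    moreover have "?\<rho> *\<^sub>R x - (1 - s / ?\<rho>) *\<^sub>R (?\<rho> *\<^sub>R x - 0) = s *\<^sub>R x"
      using \<rho> by (simp add: algebra_simps)
    ultimately show ?thesis by simp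
  qed
  show ?thesis
  proof (cases "0 \<le> r")
    case True
    then show ?thesis using pos assms by simp
  next
    case False
    then have "(- r) *\<^sub>R x \<in> interior K" using assms(2) by (intro pos) auto
    then show ?thesis using uminus_interior[of "(- r) *\<^sub>R x"] by simp
  qed
qed

lemma scaled_notin:
  assumes "x \<noteq> 0" "radial K x < \<bar>r\<bar>"
  shows "r *\<^sub>R x \<notin> K"
proof
  assume "r *\<^sub>R x \<in> K"
  then have "\<bar>r\<bar> *\<^sub>R x \<in> K" using uminus_mem[of "r *\<^sub>R x"] by (auto simp: abs_if)
  then show False using mem_iff[OF assms(1), of "\<bar>r\<bar>"] assms(2) by simp
qed

lemma radial_uminus:
  assumes "x \<noteq> 0"
  shows "radial K (- x) = radial K x"
proof -
  have "r *\<^sub>R (- x) \<in> K \<longleftrightarrow> r *\<^sub>R x \<in> K" for r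
    using uminus_mem[of "r *\<^sub>R x"] uminus_mem[of "- (r *\<^sub>R x)"] by auto
  then show ?thesis by (simp only: radial_def)
qed

text \<open>Each semicontinuity is tested on a single multiple of \<open>u\<close>: slightly
  shortened it lies in the open interior of \<open>K\<close>, lengthened in the open complement, and
  both persist for nearby directions.\<close>

lemma radial_continuous: "continuous_on (sphere 0 1) (radial K)"
  unfolding continuous_on_def
proof
  fix u :: "real^'n" assume "u \<in> sphere 0 1"
  then have u: "u \<noteq> 0" by auto
  have ev: "eventually (\<lambda>v. v \<noteq> 0) (at u within sphere 0 1)"
    unfolding eventually_at_filter by (rule always_eventually) auto
  have lim: "((\<lambda>v. c *\<^sub>R v) \<longlongrightarrow> c *\<^sub>R u) (at u within sphere 0 1)" for c :: real
    by (intro tendsto_intros)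
  show "(radial K \<longlongrightarrow> radial K u) (at u within sphere 0 1)"
  proof (rule order_tendstoI)
    fix a assume a: "a < radial K u"
    \<comment> \<open>\<open>a\<close> may be negative, whereas membership on the ray is
      characterized for nonnegative multiples; hence the maximum with 0.\<close>
    define c where "c = (max 0 a + radial K u) / 2"
    have c: "0 \<le> c" "a < c" "c < radial K u" using a radial_pos[OF u] by (auto simp: c_def)
    then have "c *\<^sub>R u \<in> interior K" using u by (intro scaled_in_interior) auto
    then have "eventually (\<lambda>v. c *\<^sub>R v \<in> interior K) (at u within sphere 0 1)"
      using topological_tendstoD[OF lim open_interior] by blast
    then show "eventually (\<lambda>v. a < radial K v) (at u within sphere 0 1)"
      using ev
    proof eventually_elim
      case (elim v)
      then have "c \<le> radial K v" using mem_iff[of v c] c interior_subset by blast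
      then show ?case using c by simp
    qed
  next
    fix a assume a: "radial K u < a"
    have a0: "0 < a" using a radial_pos[OF u] by simp
    have "a *\<^sub>R u \<in> - K" using scaled_notin[OF u, of a] a a0 by simp
    then have "eventually (\<lambda>v. a *\<^sub>R v \<in> - K) (at u within sphere 0 1)"
      using topological_tendstoD[OF lim, of "- K"] compact_imp_closed[OF compact] by (simp add: open_Compl)
    then show "eventually (\<lambda>v. radial K v < a) (at u within sphere 0 1)"
      using ev by eventually_elim (use mem_iff a0 in \<open>force simp: not_le\<close>)
  qed
qed

end

section \<open>Star bodies with a prescribed radial function\<close>

lemma radial_star_of:
  fixes h :: "real^'n \<Rightarrow> real"
  assumes "norm u = 1" "0 \<le> h u" and even: "h (- u) = h u"
  shows "radial (star_of h) u = h u"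
proof -
  have "r *\<^sub>R u \<in> star_of h \<longleftrightarrow> r \<le> h u" if "0 \<le> r" for r
  proof
    assume "r *\<^sub>R u \<in> star_of h"
    then obtain s \<theta> where s: "r *\<^sub>R u = s *\<^sub>R \<theta>" "norm \<theta> = 1" "0 \<le> s" "s \<le> h \<theta>" by (auto simp: star_of_def)
    have "\<bar>r\<bar> * norm u = \<bar>s\<bar> * norm \<theta>" by (metis s(1) norm_scaleR)
    then have rs: "r = s" using s(2,3) assms(1) that by simp
    show "r \<le> h u"
    proof (cases "r = 0")
      case False
      then have "u = \<theta>" using s(1) rs by simp
      then show ?thesis using s rs by simp
    qed (simp add: assms)
  next
    assume "r \<le> h u"
    then show "r *\<^sub>R u \<in> star_of h" using that assms by (auto simp: star_of_def)
  qed
  then have "{r. 0 \<le> r \<and> r *\<^sub>R u \<in> star_of h} = {0..h u}" by auto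
  then show ?thesis using assms by (simp add: radial_def)
qed

lemma star_body_star_of:
  fixes h :: "real^'n \<Rightarrow> real"
  assumes c: "continuous_on (sphere 0 1) h" and nn: "\<And>u. norm u = 1 \<Longrightarrow> 0 \<le> h u"
    and even: "\<And>u. norm u = 1 \<Longrightarrow> h (- u) = h u"
  shows "star_body (star_of h)"
proof -
  \<comment> \<open>Rescaling the radial parameter to [0, 1] exhibits the body as a continuous image
    of a fixed compact product.\<close>
  have img: "star_of h = (\<lambda>(s, \<theta>). (s * h \<theta>) *\<^sub>R \<theta>) ` ({0..1} \<times> sphere 0 1)"
  proof (intro set_eqI iffI)
    fix x assume "x \<in> star_of h"
    then obtain r \<theta> where r: "x = r *\<^sub>R \<theta>" "norm \<theta> = 1" "0 \<le> r" "r \<le> h \<theta>" by (auto simp: star_of_def)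
    show "x \<in> (\<lambda>(s, \<theta>). (s * h \<theta>) *\<^sub>R \<theta>) ` ({0..1} \<times> sphere 0 1)"
    proof (cases "h \<theta> = 0")
      case True
      then show ?thesis using r by (intro image_eqI[of _ _ "(0, \<theta>)"]) auto
    next
      case False
      then show ?thesis using r by (intro image_eqI[of _ _ "(r / h \<theta>, \<theta>)"]) auto
    qed
  next
    fix x assume "x \<in> (\<lambda>(s, \<theta>). (s * h \<theta>) *\<^sub>R \<theta>) ` ({0..1} \<times> sphere 0 1)"
    then obtain s \<theta> where s: "x = (s * h \<theta>) *\<^sub>R \<theta>" "norm \<theta> = 1" "0 \<le> s" "s \<le> 1" by auto
    have "s * h \<theta> \<le> 1 * h \<theta>" using s nn by (intro mult_right_mono) auto
    then show "x \<in> star_of h" unfolding star_of_def using s nn[of \<theta>] by (auto intro!: exI[of _ "s * h \<theta>"] exI[of _ \<theta>])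
  qed
  have "compact (star_of h)"
    unfolding img
  proof (rule compact_continuous_image)
    show "continuous_on ({0..1} \<times> sphere 0 1) (\<lambda>(s, \<theta>). (s * h \<theta>) *\<^sub>R \<theta>)"
      unfolding case_prod_beta
      by (intro continuous_intros continuous_on_compose2[OF c]) auto
  qed (intro compact_Times compact_Icc compact_sphere)
  moreover have "0 \<in> star_of h"
  proof -
    obtain \<theta> :: "real^'n" where "norm \<theta> = 1" using vector_choose_size[of 1] by auto
    then show ?thesis unfolding star_of_def using nn[of \<theta>] by (auto intro!: exI[of _ 0] exI[of _ \<theta>])
  qed
  moreover have "t *\<^sub>R x \<in> star_of h" if x: "x \<in> star_of h" and t: "t \<in> {0..1}" for x t
  proof -
    obtain r \<theta> where r: "x = r *\<^sub>R \<theta>" "norm \<theta> = 1" "0 \<le> r" "r \<le> h \<theta>" using x by (auto simp: star_of_def)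
    have "t * r \<le> 1 * r" using t r by (intro mult_right_mono) auto
    then show ?thesis unfolding star_of_def using r t by (auto intro!: exI[of _ "t * r"] exI[of _ \<theta>])
  qed
  moreover have neg: "- x \<in> star_of h" if x: "x \<in> star_of h" for x
  proof -
    obtain r \<theta> where r: "x = r *\<^sub>R \<theta>" "norm \<theta> = 1" "0 \<le> r" "r \<le> h \<theta>" using x by (auto simp: star_of_def)
    then show ?thesis unfolding star_of_def using even[of \<theta>] by (auto intro!: exI[of _ r] exI[of _ "- \<theta>"])
  qed
  moreover have "uminus ` star_of h = star_of h"
    using neg by (auto intro!: image_eqI[of _ uminus "- _"])
  moreover have "continuous_on (sphere 0 1) (radial (star_of h))"
    using c by (rule continuous_on_eq) (simp add: radial_star_of nn even)
  ultimately show ?thesis by (simp add: star_body_def)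
qed

section \<open>The Radon transform on projection matrices\<close>

locale frame =
  fixes j :: "'k::euclidean_space \<Rightarrow> real^'n"
  assumes lin: "linear j" and iso: "\<And>q. norm (j q) = norm q"
begin

text \<open>A sum of rank-one matrices v v^T over the images v of an orthonormal basis: the
  orthogonal projection onto the span of the frame whenever \<open>A\<close> is isometric on the
  range of \<open>j\<close>. Being polynomial in \<open>A\<close>, it is defined and continuous on
  all matrices.\<close>

definition frame_proj :: "real^'n^'n \<Rightarrow> real^'n^'n" where
  "frame_proj A = (\<chi> i l. \<Sum>b\<in>Basis. (A *v j b) $ i * (A *v j b) $ l)"

definition isometric :: "real^'n^'n \<Rightarrow> bool" where
  "isometric A \<longleftrightarrow> (\<forall>q. norm (A *v j q) = norm q)"

lemma linear_frame: "linear (\<lambda>q. A *v j q)"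
  by (intro linearI) (simp_all add: linear_add[OF lin] linear_scale[OF lin] matrix_vector_right_distrib matrix_vector_mult_scaleR)

lemma frame_inner:
  assumes "isometric A"
  shows "(A *v j p) \<bullet> (A *v j q) = p \<bullet> q"
  using assms by (intro linear_isometry_inner linear_frame) (simp add: isometric_def)

lemma frame_proj_mult: "frame_proj A *v x = (\<Sum>b\<in>Basis. (x \<bullet> (A *v j b)) *\<^sub>R (A *v j b))"
proof -
  have "(frame_proj A *v x) $ i = (\<Sum>b\<in>Basis. (x \<bullet> (A *v j b)) *\<^sub>R (A *v j b)) $ i" for i
  proof -
    have "(frame_proj A *v x) $ i = (\<Sum>l\<in>UNIV. \<Sum>b\<in>Basis. (A *v j b) $ i * (A *v j b) $ l * x $ l)"
      by (simp add: frame_proj_def matrix_vector_mult_def[of "\<chi> i l. _ i l"] sum_distrib_right)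
    also have "\<dots> = (\<Sum>b\<in>Basis. (\<Sum>l\<in>UNIV. (A *v j b) $ i * (A *v j b) $ l * x $ l))" by (rule sum.swap)
    also have "\<dots> = (\<Sum>b\<in>Basis. (x \<bullet> (A *v j b)) *\<^sub>R (A *v j b)) $ i"
      unfolding sum_component vector_scaleR_component inner_vec_def
      by (intro sum.cong refl) (simp add: sum_distrib_right sum_distrib_left mult_ac)
    finally show ?thesis .
  qed
  then show ?thesis by (simp add: vec_eq_iff)
qed

lemma frame_proj_frame:
  assumes "isometric A"
  shows "frame_proj A *v (A *v j q) = A *v j q"
proof -
  have "frame_proj A *v (A *v j q) = (\<Sum>b\<in>Basis. (q \<bullet> b) *\<^sub>R (A *v j b))"
    by (simp add: frame_proj_mult frame_inner[OF assms])
  also have "\<dots> = A *v j (\<Sum>b\<in>Basis. (q \<bullet> b) *\<^sub>R b)"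
    by (simp add: linear_sum[OF linear_frame] linear_scale[OF linear_frame])
  finally show ?thesis by (simp add: euclidean_representation)
qed

lemma range_frame_proj:
  assumes "isometric A"
  shows "range (\<lambda>x. frame_proj A *v x) = range (\<lambda>q. A *v j q)"
proof
  show "range (\<lambda>q. A *v j q) \<subseteq> range (\<lambda>x. frame_proj A *v x)"
    using frame_proj_frame[OF assms] by (metis image_subsetI rangeI)
  have "frame_proj A *v x = A *v j (\<Sum>b\<in>Basis. (x \<bullet> (A *v j b)) *\<^sub>R b)" for x
    by (simp add: frame_proj_mult linear_sum[OF linear_frame] linear_scale[OF linear_frame])
  then show "range (\<lambda>x. frame_proj A *v x) \<subseteq> range (\<lambda>q. A *v j q)" by auto
qed

lemma frame_proj_in_proj_grass:
  assumes "isometric A"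
  shows "frame_proj A \<in> proj_grass (DIM('k))"
proof -
  have "(frame_proj A ** frame_proj A) *v x = frame_proj A *v x" for x
  proof -
    have "frame_proj A *v x \<in> range (\<lambda>q. A *v j q)" using range_frame_proj[OF assms] by blast
    then show ?thesis using frame_proj_frame[OF assms] by (auto simp: matrix_vector_mul_assoc[symmetric])
  qed
  then have "frame_proj A ** frame_proj A = frame_proj A" by (simp add: matrix_eq)
  moreover have "transpose (frame_proj A) = frame_proj A"
    by (simp add: transpose_def frame_proj_def vec_eq_iff mult.commute)
  moreover have "dim (range (\<lambda>x. frame_proj A *v x)) = DIM('k)"
    unfolding range_frame_proj[OF assms]
    using assms by (intro dim_range_linear_isometry linear_frame) (simp add: isometric_def)
  ultimately show ?thesis by (simp add: proj_grass_def)
qed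

text \<open>The vector \<open>P *v x - x\<close> is orthogonal to the range of \<open>P\<close>,
  hence to that of \<open>P'\<close>, and is therefore annihilated by \<open>P'\<close>. On vectors
  already in the common range both matrices are the identity.\<close>

lemma proj_grass_unique:
  fixes P P' :: "real^'n^'n"
  assumes P: "P ** P = P" "transpose P = P" and P': "P' ** P' = P'" "transpose P' = P'"
    and r: "range (\<lambda>x. P *v x) = range (\<lambda>x. P' *v x)"
  shows "P = P'"
proof -
  have id: "Q *v (Q *v x) = Q *v x" if "Q ** Q = Q" for Q :: "real^'n^'n" and x
    using that by (simp add: matrix_vector_mul_assoc)
  have sa: "(Q *v x) \<bullet> y = x \<bullet> (Q *v y)" if "transpose Q = Q" for Q :: "real^'n^'n" and x y
    using dot_lmul_matrix[of x Q y] that by (metis transpose_matrix_vector)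
  have "P *v x = P' *v x" for x
  proof -
    have "P *v x \<in> range (\<lambda>x. P' *v x)" "P' *v x \<in> range (\<lambda>x. P *v x)" using r by auto
    then have a: "P' *v (P *v x) = P *v x" "P *v (P' *v x) = P' *v x" using id P P' by auto
    have "P' *v (P *v x) = P' *v x"
    proof -
      define d where "d = P *v x - x"
      have "(P' *v d) \<bullet> (P' *v d) = d \<bullet> (P' *v (P' *v d))" by (rule sa[OF P'(2)])
      also have "P' *v (P' *v d) = P *v (P' *v d)"
      proof -
        have "P' *v d \<in> range (\<lambda>x. P *v x)" using r by auto
        then show ?thesis using id[OF P(1)] id[OF P'(1)] by auto
      qed
      also have "d \<bullet> (P *v (P' *v d)) = (P *v d) \<bullet> (P' *v d)" by (rule sa[OF P(2), symmetric])
      also have "P *v d = 0" by (simp add: d_def matrix_vector_mult_diff_distrib id[OF P(1)])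
      finally have "P' *v d = 0" by simp
      then show ?thesis by (simp add: d_def matrix_vector_mult_diff_distrib)
    qed
    then show ?thesis using a by simp
  qed
  then show ?thesis by (simp add: matrix_eq)
qed

text \<open>The isometry condition controls \<open>A\<close> only on the range of \<open>j\<close>;
  the bound on the columns confines the other directions and makes the set compact, while a matrix
  over every projection is still present.\<close>

definition isometric_set :: "(real^'n^'n) set" where
  "isometric_set = {A. isometric A \<and> (\<forall>l. norm (A *v axis l 1) \<le> 1)}"

lemma compact_isometric_set: "compact isometric_set"
proof -
  have "norm A \<le> real CARD('n) * real CARD('n)" if "A \<in> isometric_set" for A
  proof -
    have ent: "\<bar>A $ i $ l\<bar> \<le> 1" for i l
    proof -
      have "A $ i $ l = (A *v axis l 1) $ i" by (simp add: matrix_vector_mult_basis column_def)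
      then show ?thesis using that component_le_norm_cart[of "A *v axis l 1" i] by (auto simp: isometric_set_def intro: order_trans)
    qed
    have "norm A \<le> (\<Sum>i\<in>UNIV. norm (A $ i))" unfolding norm_vec_def by (rule L2_set_le_sum) simp
    also have "\<dots> \<le> (\<Sum>i\<in>(UNIV :: 'n set). real CARD('n))"
    proof (rule sum_mono)
      fix i
      have "norm (A $ i) \<le> (\<Sum>l\<in>UNIV. \<bar>A $ i $ l\<bar>)" by (rule norm_le_l1_cart)
      also have "\<dots> \<le> (\<Sum>l\<in>(UNIV :: 'n set). 1)" by (intro sum_mono ent)
      finally show "norm (A $ i) \<le> real CARD('n)" by simp
    qed
    finally show ?thesis by simp
  qed
  then have "bounded isometric_set" by (auto simp: bounded_iff)
  moreover have "closed isometric_set"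
    unfolding isometric_set_def isometric_def
    by (intro closed_Collect_conj closed_Collect_all closed_Collect_eq closed_Collect_le continuous_intros)
  ultimately show ?thesis by (simp add: compact_eq_bounded_closed)
qed

lemma frame_proj_surj: "frame_proj ` isometric_set = proj_grass (DIM('k))"
proof
  show "frame_proj ` isometric_set \<subseteq> proj_grass (DIM('k))"
    using frame_proj_in_proj_grass by (auto simp: isometric_set_def)
  show "proj_grass (DIM('k)) \<subseteq> frame_proj ` isometric_set"
  proof
    fix P :: "real^'n^'n" assume "P \<in> proj_grass (DIM('k))"
    then have P: "P ** P = P" "transpose P = P" "dim (range (\<lambda>x. P *v x)) = DIM('k)" by (auto simp: proj_grass_def)
    have "subspace (range (\<lambda>x. P *v x))" by (intro linear_subspace_image) simp_all
    then obtain T where T: "linear T" "T ` (UNIV :: 'k set) = range (\<lambda>x. P *v x)" "\<And>q. norm (T q) = norm q"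
      using isometry_subspaces[of "UNIV :: 'k set" "range (\<lambda>x. P *v x)"] P(3) by auto
    \<comment> \<open>The adjoint of \<open>j\<close>: a left inverse of norm at most 1. Composed
      with an isometry \<open>T\<close> onto the range of \<open>P\<close> it gives a frame of that
      range whose columns satisfy the bound.\<close>
    define c where "c x = (\<Sum>b\<in>Basis. (x \<bullet> j b) *\<^sub>R b)" for x
    have jj: "j p \<bullet> j q = p \<bullet> q" for p q by (rule linear_isometry_inner[OF lin iso])
    have cj: "c (j q) = q" for q by (simp add: c_def jj euclidean_representation)
    have linc: "linear c"
      unfolding c_def by (intro linearI) (simp_all add: inner_add_left scaleR_left.add sum.distrib scaleR_sum_right)
    have cb: "c x \<bullet> b = x \<bullet> j b" if "b \<in> Basis" for x b
      using that by (simp add: c_def inner_sum_left inner_Basis if_distrib sum.delta cong: if_cong)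
    have cn: "norm (c x) \<le> norm x" for x
    proof -
      have "c x \<bullet> c x = (\<Sum>b\<in>Basis. (c x \<bullet> b) * (x \<bullet> j b))"
        using cb by (subst euclidean_inner) simp
      also have "\<dots> = x \<bullet> j (\<Sum>b\<in>Basis. (c x \<bullet> b) *\<^sub>R b)"
        by (simp add: linear_sum[OF lin] linear_scale[OF lin] inner_sum_right)
      also have "\<dots> = x \<bullet> j (c x)" by (simp add: euclidean_representation)
      also have "\<dots> \<le> norm x * norm (c x)" using norm_cauchy_schwarz[of x "j (c x)"] by (simp add: iso)
      finally have "norm (c x) * norm (c x) \<le> norm x * norm (c x)" by (simp add: dot_square_norm power2_eq_square)
      then show ?thesis by (cases "c x = 0") auto
    qed
    define A where "A = matrix (\<lambda>x. T (c x))"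
    have lTc: "linear (\<lambda>x. T (c x))" using linear_compose[OF linc T(1)] by (simp add: comp_def)
    have A: "A *v x = T (c x)" for x unfolding A_def using lTc by (simp add: matrix_works)
    have iA: "isometric A" by (simp add: isometric_def A cj T(3))
    moreover have "norm (A *v axis l 1) \<le> 1" for l
      using cn[of "axis l 1"] by (simp add: A T(3) norm_axis_1)
    ultimately have "A \<in> isometric_set" by (simp add: isometric_set_def)
    moreover have "frame_proj A = P"
    proof (rule proj_grass_unique)
      show "range (\<lambda>x. frame_proj A *v x) = range (\<lambda>x. P *v x)"
        unfolding range_frame_proj[OF iA] using T(2) by (simp add: A cj)
    qed (use P frame_proj_in_proj_grass[OF iA] in \<open>auto simp: proj_grass_def\<close>)
    ultimately show "P \<in> frame_proj ` isometric_set" by blast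
  qed
qed

lemma continuous_frame_proj: "continuous_on S frame_proj"
proof -
  have "continuous_on S (\<lambda>A. A *v j b)" for b by (intro continuous_intros)
  then show ?thesis
    unfolding frame_proj_def by (intro continuous_on_vec_lambda continuous_on_sum continuous_on_mult continuous_on_component)
qed

text \<open>The Radon transform of \<open>F\<close> at the span of the frame when \<open>A\<close>
  is isometric on the range of \<open>j\<close>, but given by a formula for every matrix. For
  bounded continuous \<open>F\<close> it is continuous on the whole matrix space, as a test function
  for weak convergence has to be.\<close>

definition frame_average :: "(real^'n \<Rightarrow> real) \<Rightarrow> real^'n^'n \<Rightarrow> real" where
  "frame_average F A = (LINT q:cball 0 1|lborel. F (A *v j (sgn q))) / measure lborel (cball (0::'k) 1)"

lemma j_borel [measurable]: "j \<in> borel_measurable borel" using lin by (rule borel_measurable_linear)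

lemma radon_frame_proj:
  fixes F f :: "real^'n \<Rightarrow> real"
  assumes A: "isometric A" and f: "f \<in> borel_measurable borel" and [measurable]: "F \<in> borel_measurable borel"
    and eq: "\<And>u. norm u = 1 \<Longrightarrow> F u = f u"
  shows "radon f (range (\<lambda>x. frame_proj A *v x)) = frame_average F A"
proof -
  have n: "norm (A *v j q) = norm q" for q using A by (simp add: isometric_def)
  have [measurable]: "f \<in> borel_measurable borel" by (rule f)
  have "radon f (range (\<lambda>x. frame_proj A *v x)) = (LINT q:cball 0 1|lborel. f (sgn (A *v j q))) / measure lborel (cball (0::'k) 1)"
    unfolding radon_def range_frame_proj[OF A] by (rule integral_sphere_measure[OF linear_frame n f])
  also have "(LINT q:cball 0 1|lborel. f (sgn (A *v j q))) = (LINT q:cball 0 1|lborel. F (A *v j (sgn q)))"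
    unfolding set_lebesgue_integral_def
  proof (rule integral_cong_AE)
    show "AE q in lborel. indicator (cball 0 1) q *\<^sub>R f (sgn (A *v j q)) = indicator (cball 0 1) q *\<^sub>R F (A *v j (sgn q))"
      using AE_lborel_singleton[of "0::'k"]
    proof eventually_elim
      case (elim q)
      have "A *v j (sgn q) = sgn (A *v j q)"
        by (simp add: sgn_div_norm n linear_scale[OF linear_frame])
      moreover have "norm (A *v j (sgn q)) = 1" using elim by (simp add: n norm_sgn)
      ultimately show ?case using eq by simp
    qed
    have "(\<lambda>q. f (sgn (A *v j q))) \<in> borel_measurable borel" "(\<lambda>q. F (A *v j (sgn q))) \<in> borel_measurable borel" by measurable
    then show "(\<lambda>q. indicator (cball 0 1) q *\<^sub>R f (sgn (A *v j q))) \<in> borel_measurable lborel"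
      "(\<lambda>q. indicator (cball 0 1) q *\<^sub>R F (A *v j (sgn q))) \<in> borel_measurable lborel"
      by (intro borel_measurable_scaleR borel_measurable_indicator; simp)+
  qed
  finally show ?thesis by (simp add: frame_average_def)
qed

lemma frame_average_bound:
  fixes F :: "real^'n \<Rightarrow> real"
  assumes B: "\<And>x. \<bar>F x\<bar> \<le> B"
  shows "\<bar>frame_average F A\<bar> \<le> B"
proof -
  have c: "0 < measure lborel (cball (0 :: 'k) 1)" by (simp add: content_cball)
  have i: "integrable lborel (\<lambda>q::'k. B * indicator (cball 0 1) q)"
    by (rule integrable_indicator_cball)
  have "\<bar>LINT q:cball 0 1|lborel. F (A *v j (sgn q))\<bar> \<le> (\<integral>q. B * indicator (cball (0::'k) 1) q \<partial>lborel)"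
    unfolding set_lebesgue_integral_def
    using B order_trans[OF abs_ge_zero B]
    by (intro order_trans[OF integral_abs_bound] Bochner_Integration.integral_mono_AE'[OF i]) (auto simp: indicator_def)
  then show ?thesis using c by (simp add: frame_average_def field_simps)
qed

lemma continuous_frame_average:
  fixes F :: "real^'n \<Rightarrow> real"
  assumes F: "continuous_on UNIV F" and B: "\<And>x. \<bar>F x\<bar> \<le> B"
  shows "continuous_on UNIV (frame_average F)"
proof -
  have [measurable]: "F \<in> borel_measurable borel" using F by (rule borel_measurable_continuous_onI)
  have "(\<lambda>n. frame_average F (X n)) \<longlonglongrightarrow> frame_average F A" if X: "X \<longlonglongrightarrow> A" for X A
    unfolding frame_average_def set_lebesgue_integral_def
  proof (intro tendsto_divide tendsto_const integral_dominated_convergence[where w = "\<lambda>q. B * indicator (cball 0 1) q"])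
    have m: "(\<lambda>q. F (A *v j (sgn q))) \<in> borel_measurable borel" for A by measurable
    show "(\<lambda>q. indicator (cball 0 1) q *\<^sub>R F (A *v j (sgn q))) \<in> borel_measurable lborel"
      "(\<lambda>q. indicator (cball 0 1) q *\<^sub>R F (X n *v j (sgn q))) \<in> borel_measurable lborel" for n
      using m by (intro borel_measurable_scaleR borel_measurable_indicator; simp)+
    show "integrable lborel (\<lambda>q::'k. B * indicator (cball 0 1) q)"
      by (rule integrable_indicator_cball)
    show "AE q in lborel. (\<lambda>n. indicator (cball 0 1) q *\<^sub>R F (X n *v j (sgn q))) \<longlonglongrightarrow> indicator (cball 0 1) q *\<^sub>R F (A *v j (sgn q))"
    proof (intro always_eventually allI tendsto_scaleR tendsto_const)
      fix q
      have "continuous_on UNIV (\<lambda>A. F (A *v j (sgn q)))"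
        by (rule continuous_on_compose2[OF F]) (auto intro!: continuous_intros)
      then show "(\<lambda>n. F (X n *v j (sgn q))) \<longlonglongrightarrow> F (A *v j (sgn q))"
        using X by (rule continuous_on_tendsto_compose) auto
    qed
    show "AE q in lborel. norm (indicator (cball 0 1) q *\<^sub>R F (X n *v j (sgn q))) \<le> B * indicator (cball 0 1) q" for n
      using B by (intro always_eventually) (auto simp: indicator_def)
    have "0 < measure lborel (cball (0::'k) 1)" by (simp add: content_cball)
    then show "measure lborel (cball (0::'k) 1) \<noteq> 0" by linarith
  qed
  then show ?thesis by (simp add: continuous_on_sequentially comp_def)
qed

text \<open>On \<^term>\<open>proj_grass\<close> the Radon transform of a continuous function has compact sublevel sets,
  being induced by a continuous function on a compact set of frames.\<close>

lemma radon_proj_grass_borel: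
  fixes F f :: "real^'n \<Rightarrow> real"
  assumes F: "continuous_on UNIV F" and B: "\<And>x. \<bar>F x\<bar> \<le> B" and f: "f \<in> borel_measurable borel"
    and eq: "\<And>u. norm u = 1 \<Longrightarrow> F u = f u"
  shows "(\<lambda>P. indicator (proj_grass (DIM('k))) P * radon f (range (\<lambda>x. P *v x))) \<in> borel_measurable borel"
proof (rule borel_measurableI_le)
  fix c :: real
  let ?G = "proj_grass (DIM('k)) :: (real^'n^'n) set"
  have Fm: "F \<in> borel_measurable borel" using F by (rule borel_measurable_continuous_onI)
  have av: "radon f (range (\<lambda>x. frame_proj A *v x)) = frame_average F A" if "A \<in> isometric_set" for A
    using that by (intro radon_frame_proj f Fm eq) (auto simp: isometric_set_def)
  have "{P \<in> space borel. indicator ?G P * radon f (range (\<lambda>x. P *v x)) \<le> c}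
     = frame_proj ` (isometric_set \<inter> {A. radon f (range (\<lambda>x. frame_proj A *v x)) \<le> c}) \<union> (if 0 \<le> c then - ?G else {})"
    unfolding frame_proj_surj[symmetric] by (auto simp: indicator_def split: if_splits)
  moreover have "isometric_set \<inter> {A. radon f (range (\<lambda>x. frame_proj A *v x)) \<le> c} = isometric_set \<inter> {A. frame_average F A \<le> c}"
    using av by auto
  moreover have "compact (frame_proj ` (isometric_set \<inter> {A. frame_average F A \<le> c}))"
    by (intro compact_continuous_image continuous_frame_proj compact_Int_closed compact_isometric_set
        closed_Collect_le continuous_frame_average[OF F B] continuous_intros)
  moreover have "compact ?G"
    unfolding frame_proj_surj[symmetric] by (intro compact_continuous_image continuous_frame_proj compact_isometric_set)
  moreover have "- ?G \<in> sets borel" using \<open>compact ?G\<close> by (intro borel_comp borel_compact)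
  ultimately show "{P \<in> space borel. indicator ?G P * radon f (range (\<lambda>x. P *v x)) \<le> c} \<in> sets borel"
    by (simp add: sets.Un borel_compact)
qed

lemma proj_grass_borel: "(proj_grass (DIM('k)) :: (real^'n^'n) set) \<in> sets borel"
  unfolding frame_proj_surj[symmetric]
  by (intro borel_compact compact_continuous_image continuous_frame_proj compact_isometric_set)

end

section \<open>The representing measure\<close>

context orthogonal_average
begin

lemma section_vol_bound: "\<bar>section_vol t Q\<bar> \<le> measure lborel (cball (0 :: real \<times> real \<times> real) R)"
proof -
  have i: "integrable lborel (indicator (cball (0 :: real \<times> real \<times> real) R) :: _ \<Rightarrow> real)"
    using integrable_indicator_cball[of 1] by simp
  have "\<bar>section_vol t Q\<bar> \<le> (\<integral>p. indicator (cball (0 :: real \<times> real \<times> real) R) p \<partial>lborel)"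
    unfolding section_vol_def
    by (rule order_trans[OF integral_abs_bound], rule Bochner_Integration.integral_mono_AE'[OF i]) (auto simp: indicator_def)
  then show ?thesis by simp
qed

lemma integral_rotate:
  fixes g :: "real^'n \<Rightarrow> real"
  assumes [measurable]: "g \<in> borel_measurable borel" and u: "norm u = 1"
  shows "(\<integral>Q. g (Q *v u) \<partial>H) = (\<integral>Q. g (Q *v b1) \<partial>H)"
proof -
  define h where "h = swap_reflection b1 u"
  have h: "linear h" "norm (h v) = norm v" for v by (simp_all add: h_def linear_swap_reflection norm_swap_reflection)
  have hb: "h b1 = u" unfolding h_def by (rule swap_reflection_swap) (simp add: norm_b1 u)
  define P where "P = matrix h"
  have P: "orthogonal_matrix P" "P *v v = h v" for v
    unfolding P_def using orthogonal_matrix_linear_isometry[OF h] by auto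
  have "(\<integral>Q. g ((Q ** P) *v b1) \<partial>H) = (\<integral>Q. g (Q *v b1) \<partial>H)"
    by (rule integral_H_mult[OF P(1)]) measurable
  then show ?thesis by (simp add: matrix_vector_mul_assoc[symmetric] P hb)
qed

text \<open>The orbit of a fixed unit vector is uniformly distributed. Average
  \<open>g (Q *v sgn x)\<close> over both \<open>Q\<close> and the unit ball: integrating over
  \<open>x\<close> first uses that \<open>Q\<close> preserves Lebesgue measure, integrating over
  \<open>Q\<close> first uses \<open>integral_rotate\<close>.\<close>

lemma integral_H_sphere_measure:
  fixes g :: "real^'n \<Rightarrow> real"
  assumes g[measurable]: "g \<in> borel_measurable borel" and B: "\<And>x. \<bar>g x\<bar> \<le> B"
  shows "(\<integral>Q. g (Q *v b1) \<partial>H) = integral\<^sup>L (sphere_measure (UNIV :: (real^'n) set)) g"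
proof -
  let ?c = "measure lborel (cball (0 :: real^'n) 1)"
  have c: "?c > 0" by (simp add: content_cball)
  let ?D = "{x :: real^'n. norm x \<le> 1}"
  have cD: "cball 0 1 = ?D" by auto
  have B0: "0 \<le> B" using B[of 0] by linarith
  define k where "k = (\<lambda>(Q, x). g (Q *v sgn x) * indicator ?D x)"
  have "k \<in> borel_measurable (H \<Otimes>\<^sub>M lborel)" unfolding k_def by measurable
  then have swap: "(\<integral>Q. (\<integral>x. k (Q, x) \<partial>lborel) \<partial>H) = (\<integral>x. (\<integral>Q. k (Q, x) \<partial>H) \<partial>lborel)"
    by (rule integral_swap_bounded_support[OF prob_space_axioms, where B = B and R = 1])
       (use B B0 in \<open>auto simp: k_def indicator_def\<close>)
  have "(\<integral>Q. (\<integral>x. k (Q, x) \<partial>lborel) \<partial>H) = (\<integral>Q. (\<integral>x. g (sgn x) * indicator ?D x \<partial>lborel) \<partial>H)"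
  proof (rule integral_cong_AE)
    show "AE Q in H. (\<integral>x. k (Q, x) \<partial>lborel) = (\<integral>x. g (sgn x) * indicator ?D x \<partial>lborel)"
      using orth_H
    proof eventually_elim
      case (elim Q)
      have lin: "linear (\<lambda>x. Q *v x)" by simp
      have n: "norm (Q *v x) = norm x" for x by (rule norm_orthogonal_matrix_vector[OF elim])
      have s: "Q *v sgn x = sgn (Q *v x)" for x by (simp add: sgn_div_norm n matrix_vector_mult_scaleR)
      have "(\<integral>x. g (sgn x) * indicator ?D x \<partial>lborel) = (\<integral>x. g (sgn x) * indicator ?D x \<partial>distr lborel borel (\<lambda>x. Q *v x))"
        by (simp add: lborel_distr_linear_isometry[OF lin n])
      also have "\<dots> = (\<integral>x. k (Q, x) \<partial>lborel)"
        by (subst integral_distr) (simp_all add: k_def s indicator_def n)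
      finally show ?case by simp
    qed
    show "(\<lambda>Q. \<integral>x. k (Q, x) \<partial>lborel) \<in> borel_measurable H"
      using \<open>k \<in> borel_measurable (H \<Otimes>\<^sub>M lborel)\<close> by measurable
  qed simp
  also have "\<dots> = (\<integral>x. g (sgn x) * indicator ?D x \<partial>lborel)" by (simp add: prob_space)
  finally have 1: "(\<integral>x. g (sgn x) * indicator ?D x \<partial>lborel) = (\<integral>x. (\<integral>Q. k (Q, x) \<partial>H) \<partial>lborel)" using swap by simp
  have "(\<integral>x. (\<integral>Q. k (Q, x) \<partial>H) \<partial>lborel) = (\<integral>x. (\<integral>Q. g (Q *v b1) \<partial>H) * indicator ?D x \<partial>lborel)"
  proof (rule integral_cong_AE)
    show "AE x in lborel. (\<integral>Q. k (Q, x) \<partial>H) = (\<integral>Q. g (Q *v b1) \<partial>H) * indicator ?D x"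
      using AE_lborel_singleton[of "0 :: real^'n"]
    proof eventually_elim
      case (elim x)
      then have "norm (sgn x) = 1" by (simp add: norm_sgn)
      then show ?case using integral_rotate[OF g, of "sgn x"] by (simp add: k_def)
    qed
    show "(\<lambda>x. \<integral>Q. k (Q, x) \<partial>H) \<in> borel_measurable lborel"
      unfolding k_def by measurable
  qed simp
  also have "\<dots> = (\<integral>Q. g (Q *v b1) \<partial>H) * ?c" by (simp add: cD)
  finally have "(\<integral>x. g (sgn x) * indicator ?D x \<partial>lborel) = (\<integral>Q. g (Q *v b1) \<partial>H) * ?c" using 1 by simp
  moreover have "integral\<^sup>L (sphere_measure (UNIV :: (real^'n) set)) g = (LINT x:cball 0 1|lborel. g (sgn x)) / ?c"
    using integral_sphere_measure[of "\<lambda>x :: real^'n. x" g] by (simp add: linear_ident)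
  moreover have "(LINT x:cball 0 1|lborel. g (sgn x)) = (\<integral>x. g (sgn x) * indicator ?D x \<partial>lborel)"
    by (simp add: set_lebesgue_integral_def cD mult.commute)
  ultimately show ?thesis using c by simp
qed

end

text \<open>\<open>\<iota>\<close> selects the subspace over whose unit sphere test functions are
  averaged. Its instances are a plane in, and the whole of, the three-dimensional span of the
  section, for a = 2 and a = 3.\<close>

locale orthogonal_average_frame = orthogonal_average H K J e R \<rho>
    for H :: "(real^'n^'n) measure" and K J e R \<rho> +
  fixes \<iota> :: "'k::euclidean_space \<Rightarrow> real \<times> real \<times> real"
  assumes linear_iota: "linear \<iota>" and norm_iota: "\<And>q. norm (\<iota> q) = norm q"
begin

sublocale frame "\<lambda>q. J (\<iota> q)"
proof (rule frame.intro)
  show "linear (\<lambda>q. J (\<iota> q))" using linear_compose[OF linear_iota linear_J] by (simp add: comp_def)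
qed (simp add: norm_J norm_iota)

text \<open>By \<open>weighted_vol_rotate\<close> every direction \<open>\<iota> (sgn q)\<close>
  yields the same value, so averaging over \<open>q\<close> changes nothing.\<close>

lemma frame_average_weighted:
  fixes F :: "real^'n \<Rightarrow> real"
  assumes [measurable]: "F \<in> borel_measurable borel" and B: "\<And>x. \<bar>F x\<bar> \<le> B"
  shows "(\<integral>Q. frame_average F Q * section_vol t Q \<partial>H) = weighted_vol F t"
proof -
  let ?c = "measure lborel (cball (0 :: 'k) 1)"
  let ?D = "{x :: 'k. norm x \<le> 1}"
  define V where "V = measure lborel (cball (0 :: real \<times> real \<times> real) R)"
  have c: "?c > 0" by (simp add: content_cball)
  have cD: "cball 0 1 = ?D" by auto
  have B0: "0 \<le> B" using B[of 0] by linarith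
  define k where "k = (\<lambda>(Q, q). F (Q *v J (\<iota> (sgn q))) * section_vol t Q * indicator ?D q)"
  have [measurable]: "\<iota> \<in> borel_measurable borel" using linear_iota by (rule borel_measurable_linear)
  have km: "k \<in> borel_measurable (H \<Otimes>\<^sub>M lborel)" unfolding k_def by measurable
  have kB: "\<bar>k (Q, q)\<bar> \<le> B * V" for Q q
  proof -
    have "\<bar>F (Q *v J (\<iota> (sgn q)))\<bar> * \<bar>section_vol t Q\<bar> \<le> B * V"
      using B section_vol_bound B0 by (intro mult_mono) (auto simp: V_def)
    moreover have "0 \<le> B * V" using B0 by (simp add: V_def)
    ultimately show ?thesis by (auto simp: k_def indicator_def abs_mult)
  qed
  have swap: "(\<integral>Q. (\<integral>q. k (Q, q) \<partial>lborel) \<partial>H) = (\<integral>q. (\<integral>Q. k (Q, q) \<partial>H) \<partial>lborel)"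
    using km kB by (rule integral_swap_bounded_support[OF prob_space_axioms, where R = 1]) (auto simp: k_def indicator_def)
  have "frame_average F Q * section_vol t Q = (\<integral>q. k (Q, q) \<partial>lborel) / ?c" for Q
  proof -
    have "(\<integral>q. k (Q, q) \<partial>lborel) = (\<integral>q. section_vol t Q * (indicator ?D q * F (Q *v J (\<iota> (sgn q)))) \<partial>lborel)"
      by (simp add: k_def mult_ac)
    also have "\<dots> = section_vol t Q * (\<integral>q. indicator ?D q * F (Q *v J (\<iota> (sgn q))) \<partial>lborel)"
      by (rule integral_mult_right_zero)
    finally show ?thesis by (simp add: frame_average_def set_lebesgue_integral_def cD)
  qed
  then have "(\<integral>Q. frame_average F Q * section_vol t Q \<partial>H) = (\<integral>q. (\<integral>Q. k (Q, q) \<partial>H) \<partial>lborel) / ?c"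
    using swap by simp
  also have "(\<integral>q. (\<integral>Q. k (Q, q) \<partial>H) \<partial>lborel) = (\<integral>q. weighted_vol F t * indicator ?D q \<partial>lborel)"
  proof (rule integral_cong_AE)
    show "AE q in lborel. (\<integral>Q. k (Q, q) \<partial>H) = weighted_vol F t * indicator ?D q"
      using AE_lborel_singleton[of "0 :: 'k"]
    proof eventually_elim
      case (elim q)
      then have "norm (\<iota> (sgn q)) = 1" by (simp add: norm_iota norm_sgn)
      then show ?case using weighted_vol_rotate[OF assms(1), of "\<iota> (sgn q)" t] by (simp add: k_def)
    qed
    show "(\<lambda>q. \<integral>Q. k (Q, q) \<partial>H) \<in> borel_measurable lborel"
      unfolding k_def by measurable
  qed simp
  also have "\<dots> = weighted_vol F t * ?c" by (simp add: cD)
  finally show ?thesis using c by simp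
qed

text \<open>The weights are normalized to probability densities. Their masses are the differences
  for the constant function 1, hence asymptotic to \<open>2 * disc_area * m\<close> times t^2; the
  constant and t^2 cancel in the quotient and only \<open>m\<close> has to be put back into the
  limit measure. \<open>F\<close> extends \<open>f\<close> from the sphere, because weak limits are
  tested with functions continuous on the whole space.\<close>

theorem representing_measure:
  obtains \<mu> :: "(real^'n^'n) measure"
  where "sets \<mu> = sets borel" "finite_measure \<mu>" "AE P in \<mu>. P \<in> proj_grass (DIM('k))"
    "\<And>(f :: real^'n \<Rightarrow> real) F B. continuous_on UNIV F \<Longrightarrow> (\<And>x. \<bar>F x\<bar> \<le> B) \<Longrightarrow> (\<And>u. norm u = 1 \<Longrightarrow> F u = f u) \<Longrightarrow> f \<in> borel_measurable borel \<Longrightarrow>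
      (\<integral>Q. f (Q *v b1) * \<rho> (Q *v b1) \<partial>H) = (LINT P:proj_grass (DIM('k))|\<mu>. radon f (range (\<lambda>x. P *v x)))"
proof -
  define m where "m = (\<integral>Q. \<rho> (Q *v b1) \<partial>H)"
  have nb: "norm (Q *v b1) = 1" if "orthogonal_matrix Q" for Q :: "real^'n^'n"
    by (simp add: norm_orthogonal_matrix_vector[OF that] norm_b1)
  have rint: "integrable H (\<lambda>Q. \<rho> (Q *v b1))"
    using rho_le rho_pos nb by (intro orth_H_integrable[of _ R]) (simp_all add: abs_of_pos)
  have rpos: "AE Q in H. 0 < \<rho> (Q *v b1)" using orth_H by eventually_elim (simp add: rho_pos nb)
  have m: "m > 0"
  proof -
    have "m \<ge> 0" unfolding m_def using rpos by (intro integral_nonneg_AE) (auto elim: eventually_mono)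
    moreover have "m \<noteq> 0"
    proof
      assume "m = 0"
      then have "AE Q in H. \<rho> (Q *v b1) = 0"
        unfolding m_def using rint rpos by (subst (asm) integral_nonneg_eq_0_iff_AE) (auto elim: eventually_mono)
      then have "AE Q in H. False" using rpos by eventually_elim simp
      then show False by simp
    qed
    ultimately show ?thesis by simp
  qed
  define w where "w t Q = section_vol 0 Q - section_vol t Q" for t Q
  define V where "V = measure lborel (cball (0 :: real \<times> real \<times> real) R)"
  have [measurable]: "w t \<in> borel_measurable borel" for t unfolding w_def by measurable
  have wB: "\<bar>w t Q\<bar> \<le> 2 * V" for t Q
    using section_vol_bound[of 0 Q] section_vol_bound[of t Q] unfolding w_def V_def by linarith
  have w0: "AE Q in H. 0 \<le> w t Q" for t using orth_H by eventually_elim (simp add: w_def section_vol_mono)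
  have svi: "integrable H (\<lambda>Q. \<phi> Q * section_vol t Q)" if "\<phi> \<in> borel_measurable borel" "\<And>Q. \<bar>\<phi> Q\<bar> \<le> B" for \<phi> B t
  proof (rule integrable_const_bound[of _ "B * V"])
    show "AE Q in H. norm (\<phi> Q * section_vol t Q) \<le> B * V"
      using that(2) section_vol_bound order_trans[OF abs_ge_zero that(2)]
      by (intro always_eventually) (auto simp: abs_mult V_def intro!: mult_mono)
  qed (use that in measurable)
  have wv: "(\<integral>Q. frame_average F Q * w t Q \<partial>H) = weighted_vol F 0 - weighted_vol F t"
    if F: "continuous_on UNIV F" and B: "\<And>x. \<bar>F x\<bar> \<le> B" for F B t
  proof -
    have [measurable]: "F \<in> borel_measurable borel" using F by (rule borel_measurable_continuous_onI)
    have c: "0 < measure lborel (cball (0 :: 'k) 1)" by (simp add: content_cball)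
    have fm: "frame_average F \<in> borel_measurable borel"
      using continuous_frame_average[OF F B] by (rule borel_measurable_continuous_onI)
    have fb: "\<bar>frame_average F Q\<bar> \<le> B" for Q by (rule frame_average_bound[OF B])
    have "(\<integral>Q. frame_average F Q * w t Q \<partial>H) = (\<integral>Q. frame_average F Q * section_vol 0 Q - frame_average F Q * section_vol t Q \<partial>H)"
      by (simp add: w_def right_diff_distrib)
    also have "\<dots> = (\<integral>Q. frame_average F Q * section_vol 0 Q \<partial>H) - (\<integral>Q. frame_average F Q * section_vol t Q \<partial>H)"
      by (intro Bochner_Integration.integral_diff svi[OF fm fb])
    also have "\<dots> = weighted_vol F 0 - weighted_vol F t"
      by (simp add: frame_average_weighted[of F B] B)
    finally show ?thesis .
  qed
  define mass where "mass t = (\<integral>Q. w t Q \<partial>H)" for t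
  have wint: "integrable H (w t)" for t
    using wB by (intro integrable_const_bound[of _ "2 * V"]) auto
  have fa1: "frame_average (\<lambda>x. 1) Q = 1" for Q
  proof -
    have "0 < measure lborel (cball (0 :: 'k) 1)" by (simp add: content_cball)
    then show ?thesis by (simp add: frame_average_def set_lebesgue_integral_def)
  qed
  have mass: "mass t = weighted_vol (\<lambda>x. 1) 0 - weighted_vol (\<lambda>x. 1) t" for t
    using wv[of "\<lambda>x. 1" 1 t] by (simp add: mass_def fa1)
  have lim0: "(\<lambda>n. (weighted_vol F 0 - weighted_vol F (t n)) / (t n)\<^sup>2) \<longlonglongrightarrow> 2 * disc_area * (\<integral>Q. F (Q *v b1) * \<rho> (Q *v b1) \<partial>H)"
    if "F \<in> borel_measurable borel" "\<And>x. \<bar>F x\<bar> \<le> B" "t \<longlonglongrightarrow> 0" "\<And>n. t n > 0" for F B t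
    using that by (rule weighted_vol_diff_tendsto)
  have lim_inv: "(\<lambda>n. 1 / real (Suc n)) \<longlonglongrightarrow> 0" by (rule LIMSEQ_Suc[OF lim_1_over_n])
  have "(\<lambda>n. mass (1 / real (Suc n)) / (1 / real (Suc n))\<^sup>2) \<longlonglongrightarrow> 2 * disc_area * m"
    using lim0[of "\<lambda>x. 1" 1 "\<lambda>n. 1 / real (Suc n)"] lim_inv by (simp add: mass m_def)
  moreover have "0 < 2 * disc_area * m" using disc_area_pos m by simp
  ultimately have "eventually (\<lambda>n. 0 < mass (1 / real (Suc n)) / (1 / real (Suc n))\<^sup>2) sequentially"
    by (rule order_tendstoD(1))
  then obtain n0 where n0: "\<And>n. n \<ge> n0 \<Longrightarrow> 0 < mass (1 / real (Suc n))"
    by (auto simp: eventually_sequentially zero_less_divide_iff)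
  \<comment> \<open>Starting at \<open>n0\<close> makes every mass positive, as the normalization
    requires.\<close>
  define t where "t n = 1 / real (Suc (n + n0))" for n
  have t: "t \<longlonglongrightarrow> 0" "\<And>n. t n > 0"
    using LIMSEQ_ignore_initial_segment[OF lim_inv, of n0] by (simp_all add: t_def[abs_def])
  have mt: "mass (t n) > 0" for n using n0[of "n + n0"] by (simp add: t_def)
  define M where "M n = density H (\<lambda>Q. ennreal (w (t n) Q / mass (t n)))" for n
  have sM: "sets (M n) = sets borel" for n by (simp add: M_def sets_H)
  have dn: "AE Q in H. 0 \<le> w (t n) Q / mass (t n)" for n
    using w0[of "t n"] by eventually_elim (simp add: mt less_imp_le)
  have intM: "integral\<^sup>L (M n) \<phi> = (\<integral>Q. \<phi> Q * w (t n) Q \<partial>H) / mass (t n)" if [measurable]: "\<phi> \<in> borel_measurable borel" for \<phi> :: "real^'n^'n \<Rightarrow> real" and n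
  proof -
    have "integral\<^sup>L (M n) \<phi> = (\<integral>Q. (w (t n) Q / mass (t n)) * \<phi> Q \<partial>H)"
      unfolding M_def using dn[of n] by (subst integral_real_density) auto
    also have "\<dots> = (\<integral>Q. (\<phi> Q * w (t n) Q) / mass (t n) \<partial>H)" by (simp add: mult.commute)
    finally show ?thesis by simp
  qed
  have pM: "prob_space (M n)" for n
  proof
    have "emeasure (M n) (space (M n)) = (\<integral>\<^sup>+Q. ennreal (w (t n) Q / mass (t n)) \<partial>H)"
      unfolding M_def by (subst emeasure_density) (auto intro!: nn_integral_cong)
    also have "\<dots> = ennreal (\<integral>Q. w (t n) Q / mass (t n) \<partial>H)"
      using dn[of n] wint by (intro nn_integral_eq_integral) auto
    also have "(\<integral>Q. w (t n) Q / mass (t n) \<partial>H) = 1" using mt[of n] by (simp add: mass_def)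
    finally show "emeasure (M n) (space (M n)) = 1" by simp
  qed
  define Or where "Or = {Q :: real^'n^'n. orthogonal_matrix Q}"
  have cO: "compact Or" unfolding Or_def by (rule compact_orthogonal_matrices)
  have AM: "AE Q in M n. Q \<in> Or" for n
    unfolding M_def using orth_H by (subst AE_density) (auto simp: Or_def elim: eventually_mono)
  obtain r N where "strict_mono r" and N: "prob_space N \<and> sets N = sets borel \<and> (AE Q in N. Q \<in> Or) \<and>
      (\<forall>\<phi> :: real^'n^'n \<Rightarrow> real. continuous_on UNIV \<phi> \<longrightarrow> (\<lambda>n. integral\<^sup>L (M (r n)) \<phi>) \<longlonglongrightarrow> integral\<^sup>L N \<phi>)"
    by (rule weakly_convergent_subsequence_on_compact[where M = M, OF cO pM sM AM]) blast
  then have r: "strict_mono r" and pN: "prob_space N" and sN: "sets N = sets borel" and AN: "AE Q in N. Q \<in> Or"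
    and lim: "\<And>\<phi> :: real^'n^'n \<Rightarrow> real. continuous_on UNIV \<phi> \<Longrightarrow> (\<lambda>n. integral\<^sup>L (M (r n)) \<phi>) \<longlonglongrightarrow> integral\<^sup>L N \<phi>"
    by blast+
  interpret N: prob_space N by (rule pN)
  have [measurable_cong]: "sets N = sets borel" by (rule sN)
  have key: "m * integral\<^sup>L N (frame_average F) = (\<integral>Q. F (Q *v b1) * \<rho> (Q *v b1) \<partial>H)"
    if F: "continuous_on UNIV F" and B: "\<And>x. \<bar>F x\<bar> \<le> B" for F B
  proof -
    have [measurable]: "F \<in> borel_measurable borel" using F by (rule borel_measurable_continuous_onI)
    let ?L = "\<integral>Q. F (Q *v b1) * \<rho> (Q *v b1) \<partial>H"
    have fc: "continuous_on UNIV (frame_average F)" by (rule continuous_frame_average[OF F B])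
    then have fm: "frame_average F \<in> borel_measurable borel" by (rule borel_measurable_continuous_onI)
    have "integral\<^sup>L (M n) (frame_average F) = ((weighted_vol F 0 - weighted_vol F (t n)) / (t n)\<^sup>2) / ((weighted_vol (\<lambda>x. 1) 0 - weighted_vol (\<lambda>x. 1) (t n)) / (t n)\<^sup>2)" for n
      using t(2)[of n] by (simp add: intM[OF fm] wv[OF F B] mass)
    moreover have "(\<lambda>n. ((weighted_vol F 0 - weighted_vol F (t n)) / (t n)\<^sup>2) / ((weighted_vol (\<lambda>x. 1) 0 - weighted_vol (\<lambda>x. 1) (t n)) / (t n)\<^sup>2))
        \<longlonglongrightarrow> (2 * disc_area * ?L) / (2 * disc_area * (\<integral>Q. 1 * \<rho> (Q *v b1) \<partial>H))"
      using m disc_area_pos by (intro tendsto_divide lim0[of _ B] lim0[of "\<lambda>x. 1" 1] t B) (simp_all add: m_def)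
    ultimately have "(\<lambda>n. integral\<^sup>L (M n) (frame_average F)) \<longlonglongrightarrow> ?L / m"
      using disc_area_pos by (simp add: m_def)
    then have "(\<lambda>n. integral\<^sup>L (M (r n)) (frame_average F)) \<longlonglongrightarrow> ?L / m"
      using LIMSEQ_subseq_LIMSEQ[OF _ r] by (simp add: comp_def)
    then have "integral\<^sup>L N (frame_average F) = ?L / m" using lim[OF fc] LIMSEQ_unique by blast
    then show ?thesis using m by simp
  qed
  have fpm[measurable]: "frame_proj \<in> borel_measurable borel"
    using continuous_frame_proj by (rule borel_measurable_continuous_onI)
  \<comment> \<open>The mass \<open>m\<close> is restored and the limit measure pushed from matrices
    to projections.\<close>
  define \<mu> where "\<mu> = distr (density N (\<lambda>_. ennreal m)) borel frame_proj"
  have iso: "isometric Q" if "Q \<in> Or" for Q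
    using that by (simp add: isometric_def Or_def norm_orthogonal_matrix_vector norm_J norm_iota)
  have Gm: "(proj_grass (DIM('k)) :: (real^'n^'n) set) \<in> sets borel" by (rule proj_grass_borel)
  show ?thesis
  proof
    show "sets \<mu> = sets borel" by (simp add: \<mu>_def)
    show "finite_measure \<mu>"
    proof
      have "emeasure \<mu> (space \<mu>) = (\<integral>\<^sup>+Q. ennreal m \<partial>N)"
        unfolding \<mu>_def by (simp add: emeasure_distr emeasure_density)
      also have "\<dots> = ennreal m" by (simp add: N.emeasure_space_1)
      finally show "emeasure \<mu> (space \<mu>) \<noteq> \<infinity>" by simp
    qed
    show "AE P in \<mu>. P \<in> proj_grass (DIM('k))"
    proof -
      have "AE Q in N. frame_proj Q \<in> proj_grass (DIM('k))"
        using AN by eventually_elim (rule frame_proj_in_proj_grass[OF iso])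
      then have "AE Q in density N (\<lambda>_. ennreal m). frame_proj Q \<in> proj_grass (DIM('k))"
        by (subst AE_density) auto
      then show ?thesis unfolding \<mu>_def using Gm by (subst AE_distr_iff) auto
    qed
    fix f F :: "real^'n \<Rightarrow> real" and B
    assume F: "continuous_on UNIV F" and B: "\<And>x. \<bar>F x\<bar> \<le> B" and eq: "\<And>u. norm u = 1 \<Longrightarrow> F u = f u"
      and f[measurable]: "f \<in> borel_measurable borel"
    have Fm[measurable]: "F \<in> borel_measurable borel" using F by (rule borel_measurable_continuous_onI)
    let ?\<psi> = "\<lambda>P. indicator (proj_grass (DIM('k))) P * radon f (range (\<lambda>x. P *v x))"
    have pm[measurable]: "?\<psi> \<in> borel_measurable borel" by (rule radon_proj_grass_borel[OF F B f eq])
    have "(LINT P:proj_grass (DIM('k))|\<mu>. radon f (range (\<lambda>x. P *v x))) = integral\<^sup>L \<mu> ?\<psi>"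
      by (simp add: set_lebesgue_integral_def)
    also have "\<dots> = (\<integral>Q. ?\<psi> (frame_proj Q) \<partial>density N (\<lambda>_. ennreal m))"
      unfolding \<mu>_def by (rule integral_distr) (use pm in auto)
    also have "\<dots> = (\<integral>Q. m * ?\<psi> (frame_proj Q) \<partial>N)"
      using m measurable_compose[OF fpm pm] by (subst integral_real_density) (auto simp: less_imp_le)
    also have "\<dots> = (\<integral>Q. m * frame_average F Q \<partial>N)"
    proof (rule integral_cong_AE)
      show "AE Q in N. m * ?\<psi> (frame_proj Q) = m * frame_average F Q"
        using AN
      proof eventually_elim
        case (elim Q)
        then show ?case
          using frame_proj_in_proj_grass[OF iso[OF elim]] radon_frame_proj[OF iso[OF elim] f Fm eq] by simp
      qed
      show "(\<lambda>Q. m * ?\<psi> (frame_proj Q)) \<in> borel_measurable N"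
        using measurable_compose[OF fpm pm] by simp
      show "(\<lambda>Q. m * frame_average F Q) \<in> borel_measurable N"
        using borel_measurable_continuous_onI[OF continuous_frame_average[OF F B]] by simp
    qed
    also have "\<dots> = (\<integral>Q. F (Q *v b1) * \<rho> (Q *v b1) \<partial>H)" using key[OF F B] by simp
    also have "\<dots> = (\<integral>Q. f (Q *v b1) * \<rho> (Q *v b1) \<partial>H)"
    proof (rule integral_cong_AE)
      show "AE Q in H. F (Q *v b1) * \<rho> (Q *v b1) = f (Q *v b1) * \<rho> (Q *v b1)"
        using orth_H by eventually_elim (simp add: eq nb)
    qed simp_all
    finally show "(\<integral>Q. f (Q *v b1) * \<rho> (Q *v b1) \<partial>H) = (LINT P:proj_grass (DIM('k))|\<mu>. radon f (range (\<lambda>x. P *v x)))" by simp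
  qed
qed

end

section \<open>The comparison theorem\<close>

lemma continuous_on_sphere_extension:
  fixes f :: "real^'n \<Rightarrow> real"
  assumes "continuous_on (sphere 0 1) f"
  shows "\<exists>F B. continuous_on UNIV F \<and> (\<forall>x. \<bar>F x\<bar> \<le> B) \<and> (\<forall>u. norm u = 1 \<longrightarrow> F u = f u)"
proof -
  have "bounded (f ` sphere 0 1)"
    using assms by (intro compact_imp_bounded compact_continuous_image) auto
  then obtain B where "\<forall>y\<in>f ` sphere 0 1. norm y \<le> B" unfolding bounded_iff by blast
  then have B: "f ` sphere 0 1 \<subseteq> {- \<bar>B\<bar>..\<bar>B\<bar>}" by (force simp: abs_le_iff)
  obtain F where F: "continuous_on UNIV F" "F ` UNIV \<subseteq> {- \<bar>B\<bar>..\<bar>B\<bar>}" "\<And>x. x \<in> sphere 0 1 \<Longrightarrow> F x = f x"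
    by (rule Dugundji[of "{- \<bar>B\<bar>..\<bar>B\<bar>}" UNIV "sphere 0 1" f]) (use assms B in auto)
  have "\<bar>F x\<bar> \<le> \<bar>B\<bar>" for x
  proof -
    have "F x \<in> {- \<bar>B\<bar>..\<bar>B\<bar>}" using F(2) by blast
    then show ?thesis by (simp add: abs_le_iff)
  qed
  then show ?thesis using F by (intro exI[of _ F] exI[of _ "\<bar>B\<bar>"]) auto
qed

section \<open>Integration over the unit sphere\<close>

lemma sphere_measure_UNIV_eq:
  "sphere_measure (UNIV :: (real^'n) set) = distr (uniform_measure lborel (cball 0 1)) borel sgn"
  using sphere_measure_linear_isometry[of "\<lambda>x :: real^'n. x"] by (simp add: linear_ident)

lemma sets_sphere_measure [measurable_cong]: "sets (sphere_measure E) = sets borel"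
  by (simp add: sphere_measure_def)

lemma prob_space_sphere_measure: "prob_space (sphere_measure (UNIV :: (real^'n) set))"
proof -
  have "prob_space (uniform_measure lborel (cball (0 :: real^'n) 1))"
    by (rule prob_space_uniform_measure) (simp_all add: emeasure_cball ennreal_eq_0_iff not_le)
  then show ?thesis unfolding sphere_measure_UNIV_eq by (rule prob_space.prob_space_distr) simp
qed

lemma AE_sphere_measure: "AE u in sphere_measure (UNIV :: (real^'n) set). norm u = 1"
proof -
  have "AE x in uniform_measure lborel (cball (0 :: real^'n) 1). x \<noteq> 0"
    using AE_lborel_singleton[of "0 :: real^'n"] by (intro AE_uniform_measureI) auto
  then have "AE x in uniform_measure lborel (cball (0 :: real^'n) 1). norm (sgn x) = 1"
    by eventually_elim (simp add: norm_sgn)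
  then show ?thesis unfolding sphere_measure_UNIV_eq by (subst AE_distr_iff) simp_all
qed

lemma sphere_measure_integrable:
  fixes f :: "real^'n \<Rightarrow> real"
  assumes c: "continuous_on (sphere 0 1) f" and f: "f \<in> borel_measurable borel"
  shows "integrable (sphere_measure UNIV) f"
proof -
  obtain F B where "continuous_on UNIV F" and F: "\<And>x. \<bar>F x\<bar> \<le> B" "\<And>u. norm u = 1 \<Longrightarrow> F u = f u"
    using continuous_on_sphere_extension[OF c] by blast
  interpret prob_space "sphere_measure (UNIV :: (real^'n) set)" by (rule prob_space_sphere_measure)
  show ?thesis
  proof (rule integrable_const_bound[of _ B])
    show "AE u in sphere_measure UNIV. norm (f u) \<le> B"
      using AE_sphere_measure by eventually_elim (metis F real_norm_def)
  qed (use f in measurable)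
qed

text \<open>Dimension at least 4 provides three orthonormal vectors for the section and a fourth for
  the shift.\<close>

lemma orthogonal_frame_exists:
  assumes "CARD('n) \<ge> 4"
  obtains J :: "real \<times> real \<times> real \<Rightarrow> real^'n" and e
  where "linear J" "\<And>p. norm (J p) = norm p" "norm e = 1" "\<And>p. J p \<bullet> e = 0"
proof -
  obtain S :: "(real^'n) set" where S: "subspace S" "dim S = 4"
    using choose_subspace_of_subspace[of 4 "UNIV :: (real^'n) set"] assms by (auto simp: dim_UNIV)
  obtain T :: "real \<times> real \<times> real \<times> real \<Rightarrow> real^'n" where T: "linear T" "\<And>p. norm (T p) = norm p"
    using isometry_subspaces[of "UNIV :: (real \<times> real \<times> real \<times> real) set" S] S by auto
  have inner: "T p \<bullet> T q = p \<bullet> q" for p q by (rule linear_isometry_inner[OF T])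
  define i :: "real \<times> real \<times> real \<Rightarrow> real \<times> real \<times> real \<times> real" where "i = (\<lambda>(x, y, z). (x, y, z, 0))"
  have i: "linear i" by (rule linearI) (auto simp: i_def)
  show ?thesis
  proof
    show "linear (\<lambda>p. T (i p))" using linear_compose[OF i T(1)] by (simp add: comp_def)
    show "norm (T (i p)) = norm p" for p by (cases p) (simp add: T(2) i_def norm_Pair)
    show "norm (T (0, 0, 0, 1)) = 1" by (simp add: T(2) norm_Pair)
    show "T (i p) \<bullet> T (0, 0, 0, 1) = 0" for p by (cases p) (simp add: inner i_def)
  qed
qed

text \<open>Integrability is stated along with the identity: the comparison needs monotonicity of
  the integral in the Radon transform, and an equation between Bochner integrals does not imply
  it.\<close>

lemma (in symmetric_convex_body) radial_representation:
  fixes \<iota> :: "'k::euclidean_space \<Rightarrow> real \<times> real \<times> real"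
  assumes n: "CARD('n) \<ge> 4" and \<iota>: "linear \<iota>" "\<And>q. norm (\<iota> q) = norm q"
  obtains \<mu> :: "(real^'n^'n) measure"
  where "sets \<mu> = sets borel" "finite_measure \<mu>" "AE P in \<mu>. P \<in> proj_grass (DIM('k))"
    "\<And>f :: real^'n \<Rightarrow> real. continuous_on (sphere 0 1) f \<Longrightarrow> f \<in> borel_measurable borel \<Longrightarrow>
      set_integrable \<mu> (proj_grass (DIM('k))) (\<lambda>P. radon f (range (\<lambda>x. P *v x)))"
    "\<And>f :: real^'n \<Rightarrow> real. continuous_on (sphere 0 1) f \<Longrightarrow> f \<in> borel_measurable borel \<Longrightarrow>
      (\<integral>\<theta>. f \<theta> * radial K \<theta> \<partial>sphere_measure UNIV) = (LINT P:proj_grass (DIM('k))|\<mu>. radon f (range (\<lambda>x. P *v x)))"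
proof -
  obtain J :: "real \<times> real \<times> real \<Rightarrow> real^'n" and e
    where J: "linear J" "\<And>p. norm (J p) = norm p" "norm e = 1" "\<And>p. J p \<bullet> e = 0"
    using orthogonal_frame_exists[OF n] by metis
  obtain H :: "(real^'n^'n) measure" where pH: "prob_space H" and H: "sets H = sets borel" "AE Q in H. orthogonal_matrix Q"
    "\<And>R. orthogonal_matrix R \<Longrightarrow> distr H borel (\<lambda>Q. Q ** R) = H"
    using orthogonal_haar_measure by metis
  obtain R where R: "\<And>x. x \<in> K \<Longrightarrow> norm x \<le> R"
    using compact_imp_bounded[OF compact] by (auto simp: bounded_iff)
  interpret H: prob_space H by (rule pH)
  have radial_m[measurable]: "radial K \<in> borel_measurable borel" by (rule radial_borel[OF radial_continuous])
  have u0: "u \<noteq> 0" if "norm u = 1" for u :: "real^'n" using that by auto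
  interpret orthogonal_average_frame H K J e R "radial K" \<iota>
  proof
    show "0 < radial K u" if "norm u = 1" for u by (rule radial_pos[OF u0[OF that]])
    show "x *\<^sub>R u \<in> interior K" if "norm u = 1" "\<bar>x\<bar> < radial K u" for u x
      using scaled_in_interior[OF u0] that by blast
    show "x *\<^sub>R u \<notin> K" if "norm u = 1" "radial K u < \<bar>x\<bar>" for u x
      using scaled_notin[OF u0] that by blast
  qed (use H J R \<iota> convex compact uminus_mem radial_m in
      \<open>auto simp flip: linear_add[OF J(1)] linear_scale[OF J(1)] linear_add[OF \<iota>(1)] linear_scale[OF \<iota>(1)]\<close>)
  obtain \<mu> :: "(real^'n^'n) measure" where "sets \<mu> = sets borel \<and> finite_measure \<mu> \<and> (AE P in \<mu>. P \<in> proj_grass (DIM('k))) \<and>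
      (\<forall>(f :: real^'n \<Rightarrow> real) F B. continuous_on UNIV F \<longrightarrow> (\<forall>x. \<bar>F x\<bar> \<le> B) \<longrightarrow> (\<forall>u. norm u = 1 \<longrightarrow> F u = f u) \<longrightarrow> f \<in> borel_measurable borel \<longrightarrow>
      (\<integral>Q. f (Q *v b1) * radial K (Q *v b1) \<partial>H) = (LINT P:proj_grass (DIM('k))|\<mu>. radon f (range (\<lambda>x. P *v x))))"
    by (rule representing_measure) blast
  then have \<mu>: "sets \<mu> = sets borel" "finite_measure \<mu>" "AE P in \<mu>. P \<in> proj_grass (DIM('k))"
    and rep: "\<And>(f :: real^'n \<Rightarrow> real) F B. continuous_on UNIV F \<Longrightarrow> (\<And>x. \<bar>F x\<bar> \<le> B) \<Longrightarrow> (\<And>u. norm u = 1 \<Longrightarrow> F u = f u) \<Longrightarrow> f \<in> borel_measurable borel \<Longrightarrow>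
      (\<integral>Q. f (Q *v b1) * radial K (Q *v b1) \<partial>H) = (LINT P:proj_grass (DIM('k))|\<mu>. radon f (range (\<lambda>x. P *v x)))"
    by blast+
  interpret \<mu>: finite_measure \<mu> by (rule \<mu>(2))
  show ?thesis
  proof
    show "sets \<mu> = sets borel" "finite_measure \<mu>" "AE P in \<mu>. P \<in> proj_grass (DIM('k))" by (fact \<mu>)+
    fix f :: "real^'n \<Rightarrow> real"
    assume c: "continuous_on (sphere 0 1) f" and f[measurable]: "f \<in> borel_measurable borel"
    obtain F B where F: "continuous_on UNIV F" "\<And>x. \<bar>F x\<bar> \<le> B" "\<And>u. norm u = 1 \<Longrightarrow> F u = f u"
      using continuous_on_sphere_extension[OF c] by blast
    have Fm: "F \<in> borel_measurable borel" using F(1) by (rule borel_measurable_continuous_onI)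
    show "set_integrable \<mu> (proj_grass (DIM('k))) (\<lambda>P. radon f (range (\<lambda>x. P *v x)))"
      unfolding set_integrable_def
    proof (rule \<mu>.integrable_const_bound[of _ B])
      show "(\<lambda>P. indicator (proj_grass (DIM('k))) P *\<^sub>R radon f (range (\<lambda>x. P *v x))) \<in> borel_measurable \<mu>"
        using radon_proj_grass_borel[OF F(1,2) f F(3)] by (simp add: measurable_cong_sets[OF \<mu>(1) refl])
      show "AE P in \<mu>. norm (indicator (proj_grass (DIM('k))) P *\<^sub>R radon f (range (\<lambda>x. P *v x))) \<le> B"
        using \<mu>(3)
      proof eventually_elim
        case (elim P)
        then obtain A where A: "A \<in> isometric_set" "P = frame_proj A" using frame_proj_surj by blast
        then have "radon f (range (\<lambda>x. P *v x)) = frame_average F A"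
          using radon_frame_proj[OF _ f Fm F(3)] by (simp add: isometric_set_def)
        then show ?case using frame_average_bound[OF F(2)] elim by simp
      qed
    qed
    \<comment> \<open>\<open>f\<close> may be unbounded off the sphere; cutting off both factors
      gives a function bounded everywhere that agrees with the original almost everywhere.\<close>
    define g where "g x = (indicator (sphere 0 1) x * F x) * (indicator (sphere 0 1) x * radial K x)" for x
    obtain F2 B2 where "continuous_on UNIV F2" and F2: "\<And>x. \<bar>F2 x\<bar> \<le> B2" "\<And>u. norm u = 1 \<Longrightarrow> F2 u = radial K u"
      using continuous_on_sphere_extension[OF radial_continuous] by blast
    have nn: "0 \<le> B" "0 \<le> B2" using F(2)[of 0] F2(1)[of 0] by linarith+
    have gm[measurable]: "g \<in> borel_measurable borel"
      unfolding g_def using Fm by (intro borel_measurable_times borel_measurable_indicator) simp_all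
    have gB: "\<bar>g x\<bar> \<le> B * B2" for x
    proof (cases "norm x = 1")
      case True
      then have "\<bar>g x\<bar> = \<bar>F x\<bar> * \<bar>F2 x\<bar>" by (simp add: g_def abs_mult F2(2))
      also have "\<dots> \<le> B * B2" using F(2) F2(1) nn by (intro mult_mono) auto
      finally show ?thesis .
    qed (use nn in \<open>simp add: g_def\<close>)
    have "(\<integral>\<theta>. f \<theta> * radial K \<theta> \<partial>sphere_measure UNIV) = (\<integral>\<theta>. g \<theta> \<partial>sphere_measure UNIV)"
    proof (rule integral_cong_AE)
      show "AE \<theta> in sphere_measure UNIV. f \<theta> * radial K \<theta> = g \<theta>"
        using AE_sphere_measure by eventually_elim (simp add: g_def F(3))
    qed measurable
    also have "\<dots> = (\<integral>Q. g (Q *v b1) \<partial>H)" by (rule integral_H_sphere_measure[OF gm gB, symmetric])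
    also have "\<dots> = (\<integral>Q. f (Q *v b1) * radial K (Q *v b1) \<partial>H)"
    proof (rule integral_cong_AE)
      show "AE Q in H. g (Q *v b1) = f (Q *v b1) * radial K (Q *v b1)"
        using H(2) by eventually_elim (simp add: g_def F(3) norm_orthogonal_matrix_vector norm_b1)
    qed (use H(1) in simp_all)
    also have "\<dots> = (LINT P:proj_grass (DIM('k))|\<mu>. radon f (range (\<lambda>x. P *v x)))" by (rule rep[OF F f])
    finally show "(\<integral>\<theta>. f \<theta> * radial K \<theta> \<partial>sphere_measure UNIV) = (LINT P:proj_grass (DIM('k))|\<mu>. radon f (range (\<lambda>x. P *v x)))" .
  qed
qed

section \<open>Volumes as Radon transforms of powers of the radial function\<close>

context star_shaped
begin

lemma radial_power_borel:
  assumes "continuous_on (sphere 0 1) (radial K)"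
  shows "(\<lambda>x. radial K x ^ k) \<in> borel_measurable borel"
  using radial_borel[OF assms] by measurable

lemma measure_eq_radon:
  fixes T :: "'k::euclidean_space \<Rightarrow> real^'n"
  assumes c: "continuous_on (sphere 0 1) (radial K)" and lin: "linear T" and iso: "\<And>x. norm (T x) = norm x"
  shows "measure lborel (T -` K) = measure lborel (cball (0::'k) 1) * radon (\<lambda>x. radial K x ^ DIM('k)) (range T)"
proof -
  have "0 < measure lborel (cball (0 :: 'k) 1)" by (simp add: content_cball)
  then show ?thesis
    unfolding radon_def measure_linear_isometry[OF c lin iso] integral_sphere_measure[OF lin iso radial_power_borel[OF c]]
    by simp
qed

lemma sub_vol_eq_radon:
  fixes T :: "'k::euclidean_space \<Rightarrow> real^'n"
  assumes c: "continuous_on (sphere 0 1) (radial K)" and lin: "linear T" and iso: "\<And>x. norm (T x) = norm x"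
  shows "sub_vol (range T) (K \<inter> range T) = measure lborel (cball (0::'k) 1) * radon (\<lambda>x. radial K x ^ DIM('k)) (range T)"
proof -
  have "closed (range T)" using lin by (intro closed_subspace linear_subspace_image) auto
  then have "K \<inter> range T \<in> sets borel" using compact by (intro sets.Int borel_compact borel_closed)
  then have "sub_vol (range T) (K \<inter> range T) = measure lborel (T -` (K \<inter> range T))"
    by (rule sub_vol_linear_isometry[OF lin iso])
  also have "T -` (K \<inter> range T) = T -` K" by auto
  finally show ?thesis using measure_eq_radon[OF assms] by simp
qed

end

text \<open>In polar coordinates on \<open>E\<close> the section volume is the volume of the unit
  ball times the Radon transform of the \<open>a\<close>-th power of the radial function, and the
  positive factor cancels.\<close>

lemma radon_le_of_sub_vol_le:
  fixes K L :: "(real^'n) set"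
  assumes K: "star_body K" and L: "star_body L" and E: "subspace E" "dim E = a" and a: "a = DIM('k::euclidean_space)"
    and le: "sub_vol E (K \<inter> E) \<le> sub_vol E (L \<inter> E)"
  shows "radon (\<lambda>x. radial K x ^ a) E \<le> radon (\<lambda>x. radial L x ^ a) E"
proof -
  obtain T :: "'k \<Rightarrow> real^'n" where T: "linear T" "range T = E" "\<And>q. norm (T q) = norm q"
    using isometry_subspaces[of "UNIV :: 'k set" E] E a by auto
  have "0 < measure lborel (cball (0 :: 'k) 1)" by (simp add: content_cball)
  moreover have "continuous_on (sphere 0 1) (radial K)" "continuous_on (sphere 0 1) (radial L)"
    using K L by (simp_all add: star_body_def)
  ultimately show ?thesis
    using le star_shaped.sub_vol_eq_radon[OF star_body_star_shaped[OF K] _ T(1,3)]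
      star_shaped.sub_vol_eq_radon[OF star_body_star_shaped[OF L] _ T(1,3)]
    by (simp add: T(2) a)
qed

lemma measure_star_body:
  fixes L :: "(real^'n) set"
  assumes "star_body L"
  shows "measure lebesgue L = measure lborel (cball (0 :: real^'n) 1) * (\<integral>\<theta>. radial L \<theta> ^ CARD('n) \<partial>sphere_measure UNIV)"
proof -
  interpret star_shaped L using assms by (rule star_body_star_shaped)
  have "continuous_on (sphere 0 1) (radial L)" using assms by (simp add: star_body_def)
  then have "measure lborel L = measure lborel (cball (0 :: real^'n) 1) * radon (\<lambda>x. radial L x ^ CARD('n)) UNIV"
    using measure_eq_radon[of "\<lambda>x. x"] by (simp add: linear_ident)
  moreover have "measure lebesgue L = measure lborel L"
    using compact by (intro measure_completion) (simp add: borel_compact)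
  ultimately show ?thesis by (simp add: radon_def)
qed

text \<open>Young's inequality with the weights a/n and 1 - a/n, applied below to the radial
  functions of \<open>L\<close> and \<open>Ka\<close>. Zero values are set apart because real powers
  enter.\<close>

lemma power_mult_power_le:
  fixes x y :: real
  assumes "0 \<le> x" "0 \<le> y" "0 < a" "a < n"
  shows "x ^ a * y ^ (n - a) \<le> (real a / real n) * x ^ n + (1 - real a / real n) * y ^ n"
proof (cases "x = 0 \<or> y = 0")
  case True
  then show ?thesis using assms by (auto simp: power_0_left intro!: mult_nonneg_nonneg add_nonneg_nonneg)
next
  case False
  then have xy: "x > 0" "y > 0" using assms by auto
  have "(x ^ n) powr (real a / real n) = x ^ a" "(y ^ n) powr (1 - real a / real n) = y ^ (n - a)"
  proof -
    have "(x ^ n) powr (real a / real n) = x powr (real n * (real a / real n))"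
      using xy by (simp add: powr_powr flip: powr_realpow)
    then show "(x ^ n) powr (real a / real n) = x ^ a" using xy assms by (simp add: powr_realpow)
    have "(y ^ n) powr (1 - real a / real n) = y powr (real n * (1 - real a / real n))"
      using xy by (simp add: powr_powr flip: powr_realpow)
    also have "real n * (1 - real a / real n) = real (n - a)" using assms by (simp add: field_simps of_nat_diff)
    finally show "(y ^ n) powr (1 - real a / real n) = y ^ (n - a)" using xy by (simp add: powr_realpow)
  qed
  moreover have "(x ^ n) powr (real a / real n) * (y ^ n) powr (1 - real a / real n) \<le> (real a / real n) * x ^ n + (1 - real a / real n) * y ^ n"
    using xy assms by (intro Youngs_inequality_0) auto
  ultimately show ?thesis by simp
qed

text \<open>The test functions in \<open>bp_body\<close> are continuous on the sphere but arbitrary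
  elsewhere, so they need not be Borel on the whole space. As the sphere measures carry the
  uncompleted Borel sets, the Bochner integral then takes its default value 0.\<close>

lemma radon_not_measurable:
  assumes "f \<notin> borel_measurable borel"
  shows "radon f E = 0"
proof -
  have "\<not> integrable (sphere_measure E) f"
    using assms borel_measurable_integrable[of "sphere_measure E" f] by (auto simp: measurable_cong_sets[OF sets_sphere_measure refl])
  then show ?thesis by (simp add: radon_def not_integrable_integral_eq)
qed

theorem theorem1p1:
  fixes K :: "(real^'n) set" and a :: nat
  assumes "CARD('n) \<ge> 4"
    and "convex K" and "compact K" and "interior K \<noteq> {}" and "uminus ` K = K"
    and "a \<in> {2, 3}"
  shows "bp_body (CARD('n) - a)
           (star_of (\<lambda>\<theta>. radial K \<theta> powr (1 / (real CARD('n) - real a))))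
       \<and> (\<forall>L :: (real^'n) set. star_body L \<and>
            (\<forall>H \<in> grass a.
               sub_vol H (star_of (\<lambda>\<theta>. radial K \<theta> powr (1 / (real CARD('n) - real a))) \<inter> H)
                 \<le> sub_vol H (L \<inter> H))
          \<longrightarrow> measure lebesgue
                (star_of (\<lambda>\<theta>. radial K \<theta> powr (1 / (real CARD('n) - real a))))
              \<le> measure lebesgue L)"
proof -
  define n where "n = CARD('n)"
  define h where "h \<theta> = radial K \<theta> powr (1 / (real n - real a))" for \<theta>
  define Ka where "Ka = star_of h"
  have a: "0 < a" "a < n" using assms(1,6) by (auto simp: n_def)
  interpret symmetric_convex_body K using assms by unfold_locales
  have u0: "u \<noteq> 0" if "norm u = 1" for u :: "real^'n" using that by auto
  have h0: "0 \<le> h u" for u by (simp add: h_def)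
  have heven: "h (- u) = h u" if "norm u = 1" for u using radial_uminus[OF u0[OF that]] by (simp add: h_def)
  have hc: "continuous_on (sphere 0 1) h"
  proof -
    have "radial K u \<noteq> 0" if "u \<in> sphere 0 1" for u using radial_pos[OF u0, of u] that by simp
    then show ?thesis unfolding h_def by (intro continuous_on_powr radial_continuous continuous_on_const) auto
  qed
  have sb: "star_body Ka" unfolding Ka_def by (rule star_body_star_of[OF hc h0 heven])
  then interpret Ka: star_shaped Ka by (rule star_body_star_shaped)
  have rKa: "radial Ka u = h u" if "norm u = 1" for u
    unfolding Ka_def by (rule radial_star_of[OF that h0 heven[OF that]])
  have hp: "radial Ka u ^ (n - a) = radial K u" if "norm u = 1" for u
  proof -
    have pos: "radial K u > 0" by (rule radial_pos[OF u0[OF that]])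
    then have "h u > 0" by (simp add: h_def)
    then have "h u ^ (n - a) = h u powr (real n - real a)" using a by (simp add: powr_realpow[symmetric] of_nat_diff)
    also have "\<dots> = radial K u" unfolding h_def using pos a by (simp add: powr_powr)
    finally show ?thesis by (simp add: rKa that)
  qed
  have cKa: "continuous_on (sphere 0 1) (radial Ka)" using sb by (simp add: star_body_def)
  have mKa[measurable]: "radial Ka \<in> borel_measurable borel" by (rule Ka.radial_borel[OF cKa])
  have mK[measurable]: "radial K \<in> borel_measurable borel" by (rule radial_borel[OF radial_continuous])
  obtain \<mu> :: "(real^'n^'n) measure" where \<mu>: "sets \<mu> = sets borel" "finite_measure \<mu>" "AE P in \<mu>. P \<in> proj_grass a"
    and int: "\<And>f :: real^'n \<Rightarrow> real. continuous_on (sphere 0 1) f \<Longrightarrow> f \<in> borel_measurable borel \<Longrightarrow>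
      set_integrable \<mu> (proj_grass a) (\<lambda>P. radon f (range (\<lambda>x. P *v x)))"
    and rep: "\<And>f :: real^'n \<Rightarrow> real. continuous_on (sphere 0 1) f \<Longrightarrow> f \<in> borel_measurable borel \<Longrightarrow>
      (\<integral>\<theta>. f \<theta> * radial K \<theta> \<partial>sphere_measure UNIV) = (LINT P:proj_grass a|\<mu>. radon f (range (\<lambda>x. P *v x)))"
  \<comment> \<open>The plane is embedded as the first two coordinates for \<open>a = 2\<close>, the
    whole three-dimensional space by the identity for \<open>a = 3\<close>.\<close>
  proof (cases "a = 2")
    case True
    have "linear (\<lambda>q :: real \<times> real. (fst q, snd q, 0 :: real))" by (rule linearI) auto
    moreover have "norm (fst q, snd q, 0 :: real) = norm q" for q :: "real \<times> real" by (cases q) (simp add: norm_Pair)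
    moreover have "DIM(real \<times> real) = 2" by simp
    ultimately show ?thesis
      using radial_representation[OF assms(1), of "\<lambda>q :: real \<times> real. (fst q, snd q, 0)" thesis] that
      unfolding True by (simp only:)
  next
    case False
    then have a3: "a = 3" using assms(6) by simp
    have "DIM(real \<times> real \<times> real) = 3" by simp
    then show ?thesis
      using radial_representation[OF assms(1) linear_ident refl, of thesis] that
      unfolding a3 by (simp only:)
  qed
  have rep': "(\<integral>\<theta>. f \<theta> * radial Ka \<theta> ^ (n - a) \<partial>sphere_measure UNIV) = (LINT P:proj_grass a|\<mu>. radon f (range (\<lambda>x. P *v x)))"
    if c: "continuous_on (sphere 0 1) f" for f :: "real^'n \<Rightarrow> real"
  proof (cases "f \<in> borel_measurable borel")
    case True
    then have [measurable]: "f \<in> borel_measurable borel" .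
    have "(\<integral>\<theta>. f \<theta> * radial Ka \<theta> ^ (n - a) \<partial>sphere_measure UNIV) = (\<integral>\<theta>. f \<theta> * radial K \<theta> \<partial>sphere_measure UNIV)"
    proof (rule integral_cong_AE)
      show "AE \<theta> in sphere_measure UNIV. f \<theta> * radial Ka \<theta> ^ (n - a) = f \<theta> * radial K \<theta>"
        using AE_sphere_measure by eventually_elim (simp add: hp)
    qed measurable
    then show ?thesis using rep[OF c True] by simp
  next
    \<comment> \<open>Away from 0 the radial function of \<open>Ka\<close> is positive, so
      \<open>f\<close> could be recovered by division if its product with the power were Borel.
      Hence the left integrand is not measurable either and both sides are 0 by default.\<close>
    case False
    have "\<not> integrable (sphere_measure UNIV) (\<lambda>\<theta>. f \<theta> * radial Ka \<theta> ^ (n - a))"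
    proof
      assume "integrable (sphere_measure UNIV) (\<lambda>\<theta>. f \<theta> * radial Ka \<theta> ^ (n - a))"
      then have [measurable]: "(\<lambda>\<theta>. f \<theta> * radial Ka \<theta> ^ (n - a)) \<in> borel_measurable borel"
        using borel_measurable_integrable measurable_cong_sets[OF sets_sphere_measure refl] by blast
      have "f \<theta> = (if \<theta> = 0 then f 0 else (f \<theta> * radial Ka \<theta> ^ (n - a)) / radial Ka \<theta> ^ (n - a))" for \<theta>
      proof -
        have "radial Ka \<theta> \<noteq> 0" if "\<theta> \<noteq> 0"
        proof -
          have "0 < radial Ka (sgn \<theta>) ^ (n - a)"
            using that hp[of "sgn \<theta>"] radial_pos[of "sgn \<theta>"] by (simp add: norm_sgn sgn_zero_iff)
          then have "radial Ka (sgn \<theta>) \<noteq> 0" using a by (auto simp: power_0_left)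
          then show ?thesis using Ka.radial_eq_sgn[OF that] that by simp
        qed
        then show ?thesis by simp
      qed
      then have eq: "f = (\<lambda>\<theta>. if \<theta> = 0 then f 0 else (f \<theta> * radial Ka \<theta> ^ (n - a)) / radial Ka \<theta> ^ (n - a))"
        by (rule ext)
      have "f \<in> borel_measurable borel" by (subst eq) measurable
      then show False using False by blast
    qed
    then show ?thesis by (simp add: not_integrable_integral_eq radon_not_measurable[OF False])
  qed
  have ka: "CARD('n) - (n - a) = a" using a by (simp add: n_def)
  have bp: "bp_body (n - a) Ka"
    unfolding bp_body_def ka
  proof (intro conjI exI allI impI)
    show "1 \<le> n - a" "n - a \<le> CARD('n) - 1" using a by (auto simp: n_def)
  qed (use sb \<mu> rep' in auto)
  have "measure lebesgue Ka \<le> measure lebesgue L"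
    if L: "star_body L" and le: "\<And>H. H \<in> grass a \<Longrightarrow> sub_vol H (Ka \<inter> H) \<le> sub_vol H (L \<inter> H)" for L :: "(real^'n) set"
  proof -
    interpret L: star_shaped L using L by (rule star_body_star_shaped)
    let ?I = "\<lambda>f. integral\<^sup>L (sphere_measure (UNIV :: (real^'n) set)) f"
    have cL: "continuous_on (sphere 0 1) (radial L)" using L by (simp add: star_body_def)
    have mL[measurable]: "radial L \<in> borel_measurable borel" by (rule L.radial_borel[OF cL])
    have cpow: "continuous_on (sphere 0 1) (\<lambda>\<theta>. radial Ka \<theta> ^ k)" "continuous_on (sphere 0 1) (\<lambda>\<theta>. radial L \<theta> ^ k)" for k
      using cKa cL by (auto intro: continuous_on_power)
    have mpow: "(\<lambda>\<theta>. radial Ka \<theta> ^ k) \<in> borel_measurable borel" "(\<lambda>\<theta>. radial L \<theta> ^ k) \<in> borel_measurable borel" for k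
      by measurable
    have nn: "0 \<le> radial Ka u" "0 \<le> radial L u" if "norm u = 1" for u
      using Ka.radial_nonneg L.radial_nonneg u0[OF that] by auto
    have rle: "radon (\<lambda>x. radial Ka x ^ a) E \<le> radon (\<lambda>x. radial L x ^ a) E" if E: "E \<in> grass a" for E
    proof -
      have E1: "subspace E" "dim E = a" using E by (auto simp: grass_def)
      have "a = DIM(real \<times> real) \<or> a = DIM(real \<times> real \<times> real)" using assms(6) by auto
      then show ?thesis
      proof
        assume "a = DIM(real \<times> real)"
        then show ?thesis by (rule radon_le_of_sub_vol_le[OF sb L E1 _ le[OF E]])
      next
        assume "a = DIM(real \<times> real \<times> real)"
        then show ?thesis by (rule radon_le_of_sub_vol_le[OF sb L E1 _ le[OF E]])
      qed
    qed
    \<comment> \<open>The total power n splits as a + (n - a), so the volume of \<open>Ka\<close>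
      becomes the representation tested on the \<open>a\<close>-th power. Applied in both
      directions, it passes from \<open>Ka\<close> to \<open>L\<close> in this factor alone, because
      the representing measure is nonnegative.\<close>
    have "?I (\<lambda>\<theta>. radial Ka \<theta> ^ n) = ?I (\<lambda>\<theta>. radial Ka \<theta> ^ a * radial Ka \<theta> ^ (n - a))"
      using a by (simp flip: power_add)
    also have "\<dots> = (LINT P:proj_grass a|\<mu>. radon (\<lambda>x. radial Ka x ^ a) (range (\<lambda>x. P *v x)))"
      by (rule rep'[OF cpow(1)])
    also have "\<dots> \<le> (LINT P:proj_grass a|\<mu>. radon (\<lambda>x. radial L x ^ a) (range (\<lambda>x. P *v x)))"
    proof (rule set_integral_mono)
      fix P :: "real^'n^'n" assume "P \<in> proj_grass a"
      then have "range (\<lambda>x. P *v x) \<in> grass a"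
        unfolding proj_grass_def grass_def by (auto intro!: linear_subspace_image)
      then show "radon (\<lambda>x. radial Ka x ^ a) (range (\<lambda>x. P *v x)) \<le> radon (\<lambda>x. radial L x ^ a) (range (\<lambda>x. P *v x))"
        by (rule rle)
    qed (intro int cpow mpow)+
    also have "\<dots> = ?I (\<lambda>\<theta>. radial L \<theta> ^ a * radial Ka \<theta> ^ (n - a))"
      by (rule rep'[OF cpow(2), symmetric])
    also have "\<dots> \<le> ?I (\<lambda>\<theta>. (real a / real n) * radial L \<theta> ^ n + (1 - real a / real n) * radial Ka \<theta> ^ n)"
    proof (rule integral_mono_AE)
      show "integrable (sphere_measure UNIV) (\<lambda>\<theta>. radial L \<theta> ^ a * radial Ka \<theta> ^ (n - a))"
        "integrable (sphere_measure UNIV) (\<lambda>\<theta>. (real a / real n) * radial L \<theta> ^ n + (1 - real a / real n) * radial Ka \<theta> ^ n)"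
        by (intro sphere_measure_integrable continuous_intros cpow; measurable)+
      show "AE \<theta> in sphere_measure UNIV. radial L \<theta> ^ a * radial Ka \<theta> ^ (n - a)
          \<le> (real a / real n) * radial L \<theta> ^ n + (1 - real a / real n) * radial Ka \<theta> ^ n"
        using AE_sphere_measure by eventually_elim (intro power_mult_power_le nn a)
    qed
    also have "\<dots> = (real a / real n) * ?I (\<lambda>\<theta>. radial L \<theta> ^ n) + (1 - real a / real n) * ?I (\<lambda>\<theta>. radial Ka \<theta> ^ n)"
      by (simp add: sphere_measure_integrable cpow mpow)
    \<comment> \<open>Young's inequality returns a multiple 1 - a/n of the left side; moving it over
      leaves the positive factor a/n on both sides.\<close>
    finally have "(real a / real n) * ?I (\<lambda>\<theta>. radial Ka \<theta> ^ n) \<le> (real a / real n) * ?I (\<lambda>\<theta>. radial L \<theta> ^ n)"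
      by (simp add: left_diff_distrib)
    then have "?I (\<lambda>\<theta>. radial Ka \<theta> ^ n) \<le> ?I (\<lambda>\<theta>. radial L \<theta> ^ n)"
      by (rule mult_left_le_imp_le) (use a in simp)
    then show ?thesis
      unfolding measure_star_body[OF sb] measure_star_body[OF L] n_def[symmetric] by (intro mult_left_mono) auto
  qed
  with bp show ?thesis by (auto simp: Ka_def h_def[abs_def] n_def)
qed

end
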